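(* Let $f$ be a completely multiplicative arithmetic function with integer values, and let $F(x)=\sum_{n\le x}f(n)$ be its summatory function. Suppose that all ordinary arithmetic operations on integers have constant cost $O(1)$, and that: 1. each value $f(n)$ may be computed in time $O(1)$, not depending on the size of $n$; 2. there is an algorithm computing $$S_0(y,x)=\sum_{1\le n\le y}\mu(n)f(n)F\!\left(\frac xn\right),\qquad y=x^{1/3}(\log x)^3\log\log x,$$ in time $O\!\left(x^{2/3}/\log^2x\right)$. Then there is an algorithm computing $$\pi_f(x)=\sum_{p\le x,\ p\text{ prime}}f(p)$$ in time $O\!\left(x^{2/3}/\log^2 x\right)$. Moreover, when $F(u)$ can be computed in $O(1)$ time, the second hypothesis is satisfied.
   Context: An arithmetic function $f$ (defined on the positive integers) is called completely multiplicative if $f(ab)=f(a)f(b)$ for all positive integers $a,b$. $\mu$ is the Möbius function. The cost model is the unit-cost one: every arithmetic operation on integers (and every table access) costs $O(1)$ regardless of the size of the operands. All time bounds are as $x\to\infty$. *)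

theory Defs
  imports Complex_Main
    "HOL-Library.Landau_Symbols"
    "HOL-Computational_Algebra.Primes"
    "HOL-Computational_Algebra.Squarefree"
begin

section \<open>Arithmetic functions\<close>

text \<open>An arithmetic function is a function on \<open>nat\<close> whose value at \<open>0\<close> is never used.\<close>

definition completely_multiplicative :: "(nat \<Rightarrow> int) \<Rightarrow> bool" where
  "completely_multiplicative f \<longleftrightarrow> (\<forall>a b. a > 0 \<longrightarrow> b > 0 \<longrightarrow> f (a * b) = f a * f b)"

definition moebius :: "nat \<Rightarrow> int" where
  "moebius n = (if squarefree n then (- 1) ^ card (prime_factors n) else 0)"

definition summatory :: "(nat \<Rightarrow> int) \<Rightarrow> real \<Rightarrow> int" where
  "summatory f u = (\<Sum>n | 1 \<le> n \<and> real n \<le> u. f n)"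

definition prime_sum :: "(nat \<Rightarrow> int) \<Rightarrow> real \<Rightarrow> int" where
  "prime_sum f x = (\<Sum>p | prime p \<and> real p \<le> x. f p)"

definition S0 :: "(nat \<Rightarrow> int) \<Rightarrow> real \<Rightarrow> real \<Rightarrow> int" where
  "S0 f y x = (\<Sum>n | 1 \<le> n \<and> real n \<le> y. moebius n * f n * summatory f (x / real n))"

definition y_of :: "real \<Rightarrow> real" where
  "y_of x = x powr (1/3) * (ln x) ^ 3 * ln (ln x)"

section \<open>The unit-cost model\<close>

text \<open>
  Programs of a deterministic while language compute on unbounded integers held in tables.
  Tables are numbered by natural numbers and each has one cell for every integer index; a scalar
  variable is a cell at a constant index. Each arithmetic operation, comparison, constant and table
  access costs one unit, whatever the size of the operands. \<open>Div\<close> and \<open>Mod\<close> are the (floor)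
  operations \<open>div\<close> and \<open>mod\<close> on \<open>int\<close>.

  The parameter \<open>prim\<close> is an arbitrary family of additional unary functions available at unit cost.
  It makes the notion of computability relative: with a constant family, say, the model is a plain
  integer RAM, while putting \<open>f\<close> into the family makes \<open>f\<close> a black box that is evaluated
  in constant time.
\<close>

datatype binop = Add | Sub | Mul | Div | Mod | Less | Eq

datatype expr =
    Const int
  | Cell nat expr
  | Bin binop expr expr
  | Prim nat expr

datatype prog =
    Skip
  | Store nat expr expr
  | Seq prog prog
  | Cond expr prog prog
  | While expr prog

type_synonym memory = "nat \<Rightarrow> int \<Rightarrow> int"

fun binop_val :: "binop \<Rightarrow> int \<Rightarrow> int \<Rightarrow> int" where
  "binop_val Add a b = a + b"
| "binop_val Sub a b = a - b"
| "binop_val Mul a b = a * b"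
| "binop_val Div a b = a div b"
| "binop_val Mod a b = a mod b"
| "binop_val Less a b = of_bool (a < b)"
| "binop_val Eq a b = of_bool (a = b)"

fun eval_expr :: "(nat \<Rightarrow> int \<Rightarrow> int) \<Rightarrow> expr \<Rightarrow> memory \<Rightarrow> int" where
  "eval_expr prim (Const k) s = k"
| "eval_expr prim (Cell t e) s = s t (eval_expr prim e s)"
| "eval_expr prim (Bin b e e') s = binop_val b (eval_expr prim e s) (eval_expr prim e' s)"
| "eval_expr prim (Prim k e) s = prim k (eval_expr prim e s)"

fun expr_cost :: "expr \<Rightarrow> nat" where
  "expr_cost (Const k) = 1"
| "expr_cost (Cell t e) = expr_cost e + 1"
| "expr_cost (Bin b e e') = expr_cost e + expr_cost e' + 1"
| "expr_cost (Prim k e) = expr_cost e + 1"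

text \<open>\<open>exec prim c s n s'\<close>: started in memory \<open>s\<close>, the program \<open>c\<close> halts at cost \<open>n\<close> in memory \<open>s'\<close>.
  \<open>Store t e e'\<close> writes the value of \<open>e'\<close> to the cell of table \<open>t\<close> at index \<open>e\<close>;
  a condition holds if its value is nonzero.\<close>

inductive exec :: "(nat \<Rightarrow> int \<Rightarrow> int) \<Rightarrow> prog \<Rightarrow> memory \<Rightarrow> nat \<Rightarrow> memory \<Rightarrow> bool" for prim where
  Skip: "exec prim Skip s 1 s"
| Store: "exec prim (Store t e e') s (expr_cost e + expr_cost e' + 1)
            (s(t := (s t)(eval_expr prim e s := eval_expr prim e' s)))"
| Seq: "exec prim c s m s' \<Longrightarrow> exec prim d s' n s'' \<Longrightarrow> exec prim (Seq c d) s (m + n) s''"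
| CondT: "eval_expr prim e s \<noteq> 0 \<Longrightarrow> exec prim c s n s' \<Longrightarrow>
            exec prim (Cond e c d) s (expr_cost e + n) s'"
| CondF: "eval_expr prim e s = 0 \<Longrightarrow> exec prim d s n s' \<Longrightarrow>
            exec prim (Cond e c d) s (expr_cost e + n) s'"
| WhileF: "eval_expr prim e s = 0 \<Longrightarrow> exec prim (While e c) s (expr_cost e) s"
| WhileT: "eval_expr prim e s \<noteq> 0 \<Longrightarrow> exec prim c s m s' \<Longrightarrow> exec prim (While e c) s' n s'' \<Longrightarrow>
            exec prim (While e c) s (expr_cost e + m + n) s''"

text \<open>Arguments are passed in the initial cells of table \<open>0\<close> and the result is returned in its
  cell \<open>0\<close>. All other cells are uninitialised: the program has to work whatever they contain, so
  that it can be called repeatedly as a subroutine.\<close>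

definition computes_within ::
    "(nat \<Rightarrow> int \<Rightarrow> int) \<Rightarrow> prog \<Rightarrow> int list \<Rightarrow> int \<Rightarrow> nat \<Rightarrow> bool" where
  "computes_within prim c args r n \<longleftrightarrow>
     (\<forall>s. (\<forall>i<length args. s 0 (int i) = args ! i) \<longrightarrow>
        (\<exists>m s'. m \<le> n \<and> exec prim c s m s' \<and> s' 0 0 = r))"

text \<open>Some program computes \<open>g x\<close> from the arguments \<open>args x\<close>, correctly for every \<open>x \<in> X\<close>,
  in time \<open>O(b x)\<close> as \<open>x\<close> tends to infinity. For \<open>b = (\<lambda>_. 1)\<close> this is a uniform bound on the
  running time.\<close>

definition computable_in_time ::
    "(nat \<Rightarrow> int \<Rightarrow> int) \<Rightarrow> nat set \<Rightarrow> (nat \<Rightarrow> int list) \<Rightarrow> (nat \<Rightarrow> int) \<Rightarrow> (nat \<Rightarrow> real) \<Rightarrow> bool" where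
  "computable_in_time prim X args g b \<longleftrightarrow>
     (\<exists>c T. (\<forall>x\<in>X. computes_within prim c (args x) (g x) (T x)) \<and> (\<lambda>x. real (T x)) \<in> O(b))"

text \<open>An algorithm for \<open>S0 f y x\<close> takes both \<open>y\<close> (through its integer part, on which alone the sum
  depends) and \<open>x\<close> as arguments, but it only has to be correct for \<open>y = y_of x\<close>. The domain
  \<open>x \<ge> 2\<close> is where \<open>ln (ln x)\<close> is meaningful.\<close>

definition S0_fast :: "(nat \<Rightarrow> int \<Rightarrow> int) \<Rightarrow> (nat \<Rightarrow> int) \<Rightarrow> bool" where
  "S0_fast prim f \<longleftrightarrow>
     computable_in_time prim {2..} (\<lambda>x. [\<lfloor>y_of (real x)\<rfloor>, int x])
       (\<lambda>x. S0 f (y_of (real x)) (real x)) (\<lambda>x. real x powr (2/3) / (ln (real x))\<^sup>2)"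

end

theory Submission
  imports Defs "HOL-Number_Theory.Residues" "HOL-Real_Asymp.Real_Asymp"
begin

text \<open>
  Write \<open>y = y_of X\<close>, \<open>M = X div (\<lfloor>y\<rfloor> + 1)\<close> and expand \<open>S0 f y X\<close> as the sum of
  \<open>moebius d * f (d * m)\<close> over \<open>d \<le> y\<close>, \<open>d * m \<le> X\<close>. The pairs in which \<open>m\<close> has a prime factor
  \<open>p > M\<close> contribute exactly \<open>f p\<close> for each such \<open>p\<close>, by Moebius inversion, since all divisors of a
  number up to \<open>X / p\<close> are at most \<open>y\<close>. So one has to find the contribution of the \<open>M\<close>-smooth \<open>m\<close>
  in time \<open>O(M log X)\<close>, which is within the bound by the choice of \<open>y\<close>.

  Here the unit-cost model replaces the sieve of Deleglise and Rivat. A Dirichlet polynomial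
  \<open>\<Sum>a(n) n^-s\<close> is packed into the single integer \<open>\<Sum>a(n) H^e(n)\<close>, where \<open>e\<close> is the completely
  additive function with \<open>e(p) = \<lfloor>L log p\<rfloor>\<close> (logarithm to base 2), and \<open>L\<close> is so large that
  \<open>n \<le> X\<close> is equivalent to \<open>e(n) \<le> \<lfloor>L log X\<rfloor>\<close>. Euler products are then products of integers,
  truncation at \<open>X\<close> is a residue modulo a power of \<open>H\<close>, and the sum of the coefficients is a
  residue modulo \<open>H - 1\<close>.

  The given algorithm for \<open>S0\<close> may only be called with the exact integer part of \<open>y_of x\<close>, but the
  machine can only approximate \<open>y_of x\<close>. If \<open>y_of x\<close> is too close to an integer, \<open>x\<close> is replaced by
  \<open>X = x + w\<close> with \<open>w\<close> about \<open>x / (2 y_of x)\<close>, which moves \<open>y_of x\<close> by roughly \<open>1/6\<close>; the primes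
  between \<open>x\<close> and \<open>X\<close> are then subtracted one by one.
\<close>

section \<open>The Moebius function\<close>

text \<open>The choice of \<open>y\<close> makes \<open>M\<close> about
  \<open>X powr (2/3) / (ln X ^ 3 * ln (ln X))\<close>, so O(log X) operations for each
  \<open>n\<close> up to \<open>M\<close> fit with a factor ln ln X to spare. Within that allowance
  each \<open>n\<close> gets a primality test, a rounded logarithm and one factor of each Euler
  product. No sieve table is kept: apart from the argument cells, the programs built here use
  finitely many scalar variables, and a whole Dirichlet polynomial sits in one of them. Nothing is
  known about the size of \<open>f\<close>, so the base \<open>H\<close> cannot be fixed in advance.
  It is computed from \<open>f\<close> by a preliminary Euler product with absolute values. The
  hypothesis on \<open>S0\<close> says nothing about a call with another integer part, not even that
  it halts; an approximate \<open>y\<close> is therefore useless until its integer part is certain.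
  The displacement \<open>w\<close> balances two demands: \<open>y_of\<close> has derivative about
  \<open>y_of x / (3 * x)\<close>, so \<open>w\<close> must be of order \<open>x / y_of x\<close> to
  move it by a constant, and a window of that length is still no longer than \<open>M\<close> up to
  a constant factor.\<close>

lemma moebius_1 [simp]: "moebius (Suc 0) = 1"
  by (simp add: moebius_def)

lemma abs_moebius_le: "\<bar>moebius n\<bar> \<le> 1"
  by (simp add: moebius_def power_abs)

lemma moebius_prime_dvd: "prime p \<Longrightarrow> p dvd n \<Longrightarrow> moebius (p * n) = 0"
  unfolding moebius_def squarefree_def
  by (metis mult_dvd_mono dvd_refl not_prime_unit power2_eq_square)

lemma moebius_prime_mult:
  assumes "prime p" "\<not> p dvd n"
  shows "moebius (p * n) = - moebius n"
proof -
  have n: "n \<noteq> 0" using assms by (metis dvd_0_right)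
  have cop: "coprime p n" using assms by (simp add: prime_imp_coprime)
  have sq: "squarefree (p * n) \<longleftrightarrow> squarefree n"
    using assms(1) cop squarefree_mult_coprime[OF cop] squarefree_prime squarefree_multD(2)
    by blast
  have "prime_factors (p * n) = insert p (prime_factors n)"
    using assms n by (simp add: prime_factors_product prime_prime_factors prime_gt_0_nat)
  moreover have "p \<notin> prime_factors n" using assms by auto
  ultimately show ?thesis by (simp add: moebius_def sq)
qed

lemma moebius_prime_power:
  assumes "prime p" "\<not> p dvd n"
  shows "moebius (p ^ k * n) = (if k = 0 then 1 else if k = 1 then - 1 else 0) * moebius n"
proof (cases k)
  case (Suc j)
  show ?thesis
  proof (cases j)
    case 0
    then show ?thesis using Suc moebius_prime_mult[OF assms] by simp
  next
    case (Suc i)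
    have "moebius (p * (p ^ j * n)) = 0"
      using assms Suc by (intro moebius_prime_dvd) auto
    then show ?thesis using \<open>k = Suc j\<close> Suc by (simp add: mult.assoc)
  qed
qed simp

text \<open>For a prime \<open>p\<close> dividing \<open>k\<close>, the divisors fall into those
  prime to \<open>p\<close> (\<open>A\<close>), \<open>p\<close> times those (from
  \<open>B\<close>), and the multiples of \<open>p ^ 2\<close> (from \<open>C\<close>).
  \<open>moebius\<close> vanishes on the last class and changes sign between the first two.\<close>

lemma sum_moebius_divisors:
  assumes "k > 0"
  shows "(\<Sum>d | d dvd k. moebius d) = (if k = 1 then 1 else 0)"
proof (cases "k = 1")
  case False
  then obtain p where p: "prime p" "p dvd k" using prime_factor_nat by blast
  define A where "A = {d. d dvd k \<and> \<not> p dvd d}"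
  define B where "B = {d. p * d dvd k \<and> \<not> p dvd d}"
  define C where "C = {d. p * d dvd k \<and> p dvd d}"
  have fin: "finite {d. d dvd k}" using assms by simp
  have finA: "finite A" by (rule finite_subset[OF _ fin]) (auto simp: A_def)
  have finB: "finite B" by (rule finite_subset[OF _ fin]) (auto simp: B_def dest: dvd_mult_right)
  have finC: "finite C" by (rule finite_subset[OF _ fin]) (auto simp: C_def dest: dvd_mult_right)
  have p0: "p > 0" using p(1) prime_gt_0_nat by blast
  have inj: "inj_on ((*) p) S" for S using p0 by (auto simp: inj_on_def)
  have split: "{d. d dvd k} = A \<union> ((*) p ` B \<union> (*) p ` C)"
    by (auto simp: A_def B_def C_def elim!: dvdE[of p] dest: dvd_mult_left)
  have BC: "(*) p ` B \<inter> (*) p ` C = {}" using p0 by (auto simp: B_def C_def)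
  have "(\<Sum>d | d dvd k. moebius d)
      = sum moebius A + (sum moebius ((*) p ` B) + sum moebius ((*) p ` C))"
    unfolding split using finA finB finC BC
    by (subst sum.union_disjoint) (auto simp: A_def B_def C_def sum.union_disjoint)
  also have "sum moebius ((*) p ` C) = 0"
    using p(1) inj by (auto simp: sum.reindex C_def intro!: sum.neutral moebius_prime_dvd)
  also have "sum moebius ((*) p ` B) = (\<Sum>d\<in>B. - moebius d)"
    using p(1) inj by (auto simp: sum.reindex B_def intro!: sum.cong moebius_prime_mult)
  also have "B = A"
    using p prime_imp_coprime[OF p(1)]
    by (auto simp: A_def B_def dest: dvd_mult_right intro: divides_mult)
  finally show ?thesis using False by (simp add: sum_negf)
qed auto

section \<open>Rounded logarithms\<close>

definition elog :: "nat \<Rightarrow> nat \<Rightarrow> nat" where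
  "elog L n = nat \<lfloor>real L * log 2 (real n)\<rfloor>"

text \<open>Replaces the real logarithm by a bracketing between powers of two, which integer
  arithmetic can test.\<close>

lemma elog_unique:
  assumes "n > 0" "2 ^ e \<le> n ^ L" "n ^ L < 2 ^ Suc e"
  shows "elog L n = e"
proof -
  have n: "real n > 0" using assms(1) by simp
  have "(2::real) ^ e \<le> real n ^ L" using assms(2) of_nat_mono[of "2 ^ e" "n ^ L", where 'a = real] by simp
  then have 1: "real e \<le> L * log 2 n"
    using n log_le_cancel_iff[of 2 "2 ^ e" "real n ^ L"] by (simp add: log_nat_power)
  have "real n ^ L < (2::real) ^ Suc e"
    using assms(3) of_nat_less_iff[of "n ^ L" "2 ^ Suc e", where 'a = real] by (simp del: power_Suc)
  then have "log 2 (real n ^ L) < log 2 (2 ^ Suc e)"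
    using n by (intro log_less) auto
  then have 2: "L * log 2 n < real e + 1"
    using n by (simp add: log_nat_power del: power_Suc)
  from 1 2 show ?thesis unfolding elog_def by linarith
qed

lemma elog_le: "n > 0 \<Longrightarrow> 2 ^ elog L n \<le> n ^ L"
  and elog_less: "n > 0 \<Longrightarrow> n ^ L < 2 ^ Suc (elog L n)"
proof -
  assume n: "n > 0"
  obtain e where "2 ^ e \<le> n ^ L" "n ^ L < 2 ^ Suc e"
    using ex_power_ivl1[of 2 "n ^ L"] n by auto
  then show "2 ^ elog L n \<le> n ^ L" "n ^ L < 2 ^ Suc (elog L n)"
    using elog_unique[OF n] by auto
qed

text \<open>Only primes are rounded, since \<open>elog L\<close> itself is not additive. Additivity
  makes \<open>H ^ eadd L n\<close> multiplicative, as an Euler product requires.\<close>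

definition eadd :: "nat \<Rightarrow> nat \<Rightarrow> nat" where
  "eadd L n = (\<Sum>p\<in>#prime_factorization n. elog L p)"

lemma eadd_1 [simp]: "eadd L (Suc 0) = 0"
  by (simp add: eadd_def)

lemma eadd_mult: "m > 0 \<Longrightarrow> n > 0 \<Longrightarrow> eadd L (m * n) = eadd L m + eadd L n"
  by (simp add: eadd_def prime_factorization_mult)

lemma eadd_prime: "prime p \<Longrightarrow> eadd L p = elog L p"
  by (simp add: eadd_def prime_factorization_prime)

lemma eadd_prime_power: "prime p \<Longrightarrow> eadd L (p ^ k) = k * elog L p"
  by (induction k) (auto simp: eadd_mult eadd_prime prime_gt_0_nat)

text \<open>Rounding loses less than a factor 2, hence at most a factor \<open>p\<close>, at each
  prime factor \<open>p\<close>; over the whole factorization these losses multiply to at most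
  \<open>n\<close>.\<close>

lemma eadd_bounds:
  assumes "n > 0"
  shows "2 ^ eadd L n \<le> n ^ L \<and> n ^ L \<le> n * 2 ^ eadd L n"
  using assms
proof (induction n rule: less_induct)
  case (less n)
  show ?case
  proof (cases "n = 1")
    case False
    then obtain p where "prime p" "p dvd n" using prime_factor_nat by blast
    then obtain m where p: "prime p" "n = p * m" by blast
    then have m: "m > 0" "m < n" using less.prems prime_gt_1_nat[of p] by auto
    have p0: "p > 0" using p prime_gt_0_nat by blast
    have "p ^ L \<le> 2 * 2 ^ elog L p" using elog_less[OF p0, of L] by simp
    also have "\<dots> \<le> p * 2 ^ elog L p" using prime_ge_2_nat[OF p(1)] by simp
    finally have 1: "p ^ L \<le> p * 2 ^ elog L p" .
    have 2: "2 ^ elog L p \<le> p ^ L" using elog_le[OF p0] .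
    have eq: "eadd L n = elog L p + eadd L m"
      using p m p0 by (simp add: eadd_mult eadd_prime)
    have IH: "2 ^ eadd L m \<le> m ^ L" "m ^ L \<le> m * 2 ^ eadd L m" using less.IH[OF m(2,1)] by auto
    show ?thesis
      using mult_mono[OF 2 IH(1)] mult_mono[OF 1 IH(2)]
      by (simp add: eq power_mult_distrib power_add mult_ac flip: p(2))
        (simp add: p(2) power_mult_distrib power_add mult_ac)
  qed simp
qed

text \<open>The accumulated rounding loss is beaten by the gap between \<open>x\<close> and
  \<open>x + 1\<close>: if \<open>n > x\<close> had a small exponent, cancelling one factor
  \<open>n\<close> would give \<open>(x + 1) ^ j <= x ^ (j + 1)\<close> with
  \<open>j = L - 1 >= x ^ 2\<close>, against Bernoulli's inequality for
  \<open>(1 + 1 / x) ^ j\<close>.\<close>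

lemma eadd_le_iff:
  assumes "n > 0" "x > 0" "L > x ^ 2"
  shows "eadd L n \<le> elog L x \<longleftrightarrow> n \<le> x"
proof
  assume "n \<le> x"
  have "(2::nat) ^ eadd L n \<le> n ^ L" using eadd_bounds[OF assms(1)] by simp
  also have "\<dots> \<le> x ^ L" using \<open>n \<le> x\<close> by (simp add: power_mono)
  also have "\<dots> < 2 ^ Suc (elog L x)" using elog_less assms by blast
  finally show "eadd L n \<le> elog L x"
    by (metis less_Suc_eq_le one_less_numeral_iff power_less_imp_less_exp semiring_norm(76))
next
  assume le: "eadd L n \<le> elog L x"
  show "n \<le> x"
  proof (rule ccontr)
    assume "\<not> n \<le> x"
    then have n: "x + 1 \<le> n" by simp
    obtain j where j: "L = Suc j" "x ^ 2 \<le> j" using assms(3) by (cases L) auto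
    have "n ^ Suc j \<le> n * 2 ^ eadd L n" using eadd_bounds[OF assms(1), of L] unfolding j(1) by blast
    then have "n ^ j \<le> 2 ^ eadd L n" using assms(1) by simp
    also have "\<dots> \<le> 2 ^ elog L x" using le by simp
    also have "\<dots> \<le> x ^ Suc j" using elog_le[OF assms(2), of L] j by simp
    finally have "(x + 1) ^ j \<le> x ^ Suc j" using n power_mono[of "x + 1" n j] by simp
    then have a: "real (x + 1) ^ j \<le> real x * real x ^ j" by (metis of_nat_le_iff of_nat_mult of_nat_power power_Suc)
    have x: "real x > 0" using assms by simp
    have "1 + real j * (1 / x) \<le> (1 + 1 / real x) ^ j"
      using x by (intro Bernoulli_inequality) (auto intro: order.trans[of _ 0])
    also have "(1 + 1 / real x) ^ j = (real (x + 1) / real x) ^ j" using x by (simp add: field_simps)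
    also have "\<dots> \<le> real x" using a x by (simp add: power_divide field_simps)
    finally have "1 + real j / real x \<le> real x" by simp
    moreover have "real x \<le> real j / real x"
      using j(2) x by (simp add: field_simps power2_eq_square flip: of_nat_mult)
    ultimately show False by simp
  qed
qed


section \<open>Smooth numbers, finite Euler products and digit extraction\<close>

text \<open>Exponents are capped at \<open>K\<close> so that the set is finite and every Euler
  factor is a finite geometric sum; below \<open>2 ^ Suc K\<close> the cap excludes nothing. The
  recursion adjoins one prime at a time, in step with a product over \<open>1..n\<close>.\<close>

primrec smooth :: "nat \<Rightarrow> nat \<Rightarrow> nat set" where
  "smooth K 0 = {1}"
| "smooth K (Suc n) = (if prime (Suc n)
     then (\<lambda>(k, m). Suc n ^ k * m) ` ({..K} \<times> smooth K n) else smooth K n)"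

lemma finite_smooth [simp]: "finite (smooth K n)"
  by (induction n) auto

lemma smooth_pos: "m \<in> smooth K n \<Longrightarrow> m > 0"
  by (induction n arbitrary: m) (auto split: if_splits)

lemma smooth_prime_le: "m \<in> smooth K n \<Longrightarrow> prime p \<Longrightarrow> p dvd m \<Longrightarrow> p \<le> n"
proof (induction n arbitrary: m)
  case (Suc n)
  show ?case
  proof (cases "prime (Suc n)")
    case True
    then obtain k m' where m: "m' \<in> smooth K n" "m = Suc n ^ k * m'"
      using Suc.prems(1) by auto
    from Suc.prems(3) consider "p dvd Suc n ^ k" | "p dvd m'"
      using prime_dvd_mult_iff[OF Suc.prems(2)] m(2) by blast
    then show ?thesis
    proof cases
      case 1
      then have "p dvd Suc n" using Suc.prems(2) prime_dvd_power by blast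
      then show ?thesis by (rule dvd_imp_le) simp
    next
      case 2
      then show ?thesis using Suc.IH[OF m(1) Suc.prems(2)] by simp
    qed
  next
    case False
    then show ?thesis using Suc.prems Suc.IH[of m] by simp
  qed
qed auto

lemma in_smoothI:
  "m > 0 \<Longrightarrow> m < 2 ^ Suc K \<Longrightarrow> (\<And>p. prime p \<Longrightarrow> p dvd m \<Longrightarrow> p \<le> n) \<Longrightarrow> m \<in> smooth K n"
proof (induction n arbitrary: m)
  case 0
  then have "m = 1" using prime_factor_nat[of m] prime_gt_0_nat by (metis le_zero_eq less_irrefl)
  then show ?case by simp
next
  case (Suc n)
  show ?case
  proof (cases "prime (Suc n)")
    case True
    obtain k m' where m: "m = Suc n ^ k * m'" "\<not> Suc n dvd m'"
      using multiplicity_decompose'[of m "Suc n"] Suc.prems(1) True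
      by (metis not_prime_unit neq0_conv)
    have m': "m' > 0" using m Suc.prems(1) by (cases m') auto
    have "m' \<le> m" "Suc n ^ k \<le> m" using m m' by auto
    moreover have "2 ^ k \<le> Suc n ^ k" using prime_ge_2_nat[OF True] by (rule power_mono) simp
    ultimately have "(2::nat) ^ k < 2 ^ Suc K" using Suc.prems(2) by linarith
    then have k: "k \<le> K" by (metis less_Suc_eq_le one_less_numeral_iff power_less_imp_less_exp semiring_norm(76))
    have "m' \<in> smooth K n"
    proof (rule Suc.IH)
      show "m' < 2 ^ Suc K" using \<open>m' \<le> m\<close> Suc.prems(2) by simp
      fix p assume p: "prime p" "p dvd m'"
      then have "p \<le> Suc n" "p \<noteq> Suc n" using Suc.prems(3)[of p] m by auto
      then show "p \<le> n" by simp
    qed (rule m')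
    then show ?thesis using True k m(1) by force
  next
    case False
    then have "p \<le> n" if "prime p" "p dvd m" for p
      using Suc.prems(3)[OF that] that(1) by (cases "p = Suc n") auto
    then show ?thesis using False Suc.IH[of m] Suc.prems by simp
  qed
qed

text \<open>Unique factorization, one prime at a time: the exponent of \<open>Suc n\<close> is
  recovered as a multiplicity, so the parametrization is injective and the sum factors. The
  multiplicativity assumed is weak enough to admit weights containing
  \<open>moebius\<close>.\<close>

lemma sum_smooth:
  fixes h :: "nat \<Rightarrow> int"
  assumes one: "h 1 = 1"
    and mult: "\<And>p k m. prime p \<Longrightarrow> \<not> p dvd m \<Longrightarrow> m > 0 \<Longrightarrow> h (p ^ k * m) = h (p ^ k) * h m"
  shows "(\<Sum>m\<in>smooth K n. h m) = (\<Prod>p=1..n. if prime p then \<Sum>k\<le>K. h (p ^ k) else 1)"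
proof (induction n)
  case 0
  then show ?case using one by simp
next
  case (Suc n)
  show ?case
  proof (cases "prime (Suc n)")
    case True
    let ?p = "Suc n"
    have nd: "\<not> ?p dvd m" if "m \<in> smooth K n" for m
      using smooth_prime_le[OF that True] by auto
    have inj: "inj_on (\<lambda>(k, m). ?p ^ k * m) ({..K} \<times> smooth K n)"
    proof (rule inj_onI, clarify)
      fix k m k' m' assume *: "m \<in> smooth K n" "m' \<in> smooth K n" "?p ^ k * m = ?p ^ k' * m'"
      have "multiplicity ?p (?p ^ k * m) = k" "multiplicity ?p (?p ^ k' * m') = k'"
        using True nd[OF *(1)] nd[OF *(2)] smooth_pos[OF *(1)] smooth_pos[OF *(2)]
        by (auto simp: prime_elem_multiplicity_mult_distrib not_dvd_imp_multiplicity_0 simp del: power_Suc)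
      then show "k = k' \<and> m = m'" using *(3) by simp
    qed
    have "(\<Sum>m\<in>smooth K (Suc n). h m) = (\<Sum>(k, m)\<in>{..K} \<times> smooth K n. h (?p ^ k * m))"
      using True inj by (simp add: sum.reindex case_prod_unfold)
    also have "\<dots> = (\<Sum>(k, m)\<in>{..K} \<times> smooth K n. h (?p ^ k) * h m)"
      using mult[OF True nd smooth_pos] by (intro sum.cong) auto
    also have "\<dots> = (\<Sum>k\<le>K. h (?p ^ k)) * (\<Sum>m\<in>smooth K n. h m)"
      by (simp add: sum_product sum.cartesian_product)
    finally show ?thesis using True Suc.IH by simp
  qed (use Suc.IH in simp)
qed

text \<open>The representative of least absolute value, so that signed digits can be recovered.\<close>

definition bal :: "int \<Rightarrow> int \<Rightarrow> int" where
  "bal a m = (a + m div 2) mod m - m div 2"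

lemma bal_eq:
  assumes "m dvd a - r" "2 * \<bar>r\<bar> < m"
  shows "bal a m = r"
proof -
  obtain k where "a = r + m * k" using assms(1) by (auto simp: dvd_def algebra_simps)
  then have "(a + m div 2) mod m = (r + m div 2) mod m"
    using mod_mult_self2[of "r + m div 2" m k] by (simp add: algebra_simps)
  also have "\<dots> = r + m div 2" using assms(2) by (intro mod_pos_pos_trivial) linarith+
  finally show ?thesis by (simp add: bal_def)
qed

text \<open>Terms with exponent above \<open>E\<close> vanish modulo \<open>H ^ Suc E\<close>, and
  the others sum to less than half the modulus in absolute value. Exponents may collide, because the
  bound concerns the total of all coefficients.\<close>

lemma bal_truncate:
  fixes a :: "'i \<Rightarrow> int"
  assumes "finite S" "2 * (\<Sum>i\<in>S. \<bar>a i\<bar>) < H"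
  shows "bal (\<Sum>i\<in>S. a i * H ^ e i) (H ^ Suc E) = (\<Sum>i\<in>{i\<in>S. e i \<le> E}. a i * H ^ e i)"
proof (rule bal_eq)
  have "0 \<le> (\<Sum>i\<in>S. \<bar>a i\<bar>)" by (intro sum_nonneg) simp
  then have H: "H \<ge> 1" using assms(2) by linarith
  have "(\<Sum>i\<in>S. a i * H ^ e i) - (\<Sum>i\<in>{i\<in>S. e i \<le> E}. a i * H ^ e i)
      = (\<Sum>i\<in>S - {i\<in>S. e i \<le> E}. a i * H ^ e i)"
    using assms(1) by (subst sum_diff) auto
  also have "H ^ Suc E dvd \<dots>"
    by (intro dvd_sum dvd_mult le_imp_power_dvd) auto
  finally show "H ^ Suc E dvd (\<Sum>i\<in>S. a i * H ^ e i) - (\<Sum>i\<in>{i\<in>S. e i \<le> E}. a i * H ^ e i)" .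
  have "\<bar>\<Sum>i\<in>{i\<in>S. e i \<le> E}. a i * H ^ e i\<bar> \<le> (\<Sum>i\<in>{i\<in>S. e i \<le> E}. \<bar>a i * H ^ e i\<bar>)"
    by (rule sum_abs)
  also have "\<dots> \<le> (\<Sum>i\<in>{i\<in>S. e i \<le> E}. \<bar>a i\<bar> * H ^ E)"
    using H by (intro sum_mono) (auto simp: abs_mult intro!: mult_left_mono power_increasing)
  also have "\<dots> \<le> (\<Sum>i\<in>S. \<bar>a i\<bar> * H ^ E)"
    using H assms(1) by (intro sum_mono2) auto
  also have "\<dots> = (\<Sum>i\<in>S. \<bar>a i\<bar>) * H ^ E" by (simp add: sum_distrib_right)
  finally have "2 * \<bar>\<Sum>i\<in>{i\<in>S. e i \<le> E}. a i * H ^ e i\<bar> \<le> (2 * (\<Sum>i\<in>S. \<bar>a i\<bar>)) * H ^ E"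
    by simp
  also have "\<dots> < H * H ^ E" using assms(2) H by (intro mult_strict_right_mono) auto
  finally show "2 * \<bar>\<Sum>i\<in>{i\<in>S. e i \<le> E}. a i * H ^ e i\<bar> < H ^ Suc E" by simp
qed

text \<open>\<open>H\<close> is 1 modulo \<open>H - 1\<close>, so all powers of \<open>H\<close>
  disappear at once.\<close>

lemma bal_digit_sum:
  fixes a :: "'i \<Rightarrow> int"
  assumes "2 * (\<Sum>i\<in>S. \<bar>a i\<bar>) < H - 1"
  shows "bal (\<Sum>i\<in>S. a i * H ^ e i) (H - 1) = (\<Sum>i\<in>S. a i)"
proof (rule bal_eq)
  have "(\<Sum>i\<in>S. a i * H ^ e i) - (\<Sum>i\<in>S. a i) = (\<Sum>i\<in>S. a i * (H ^ e i - 1))"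
    by (simp add: sum_subtractf algebra_simps)
  also have "H - 1 dvd \<dots>"
    by (intro dvd_sum dvd_mult) (metis dvd_triv_left power_diff_1_eq)
  finally show "H - 1 dvd (\<Sum>i\<in>S. a i * H ^ e i) - (\<Sum>i\<in>S. a i)" .
  show "2 * \<bar>\<Sum>i\<in>S. a i\<bar> < H - 1" using assms sum_abs[of a S] by linarith
qed

section \<open>Smooth and non-smooth parts of the sum\<close>

text \<open>At non-primes the Euler factors become \<open>1 - 0\<close> and
  \<open>0 ^ 0 + 0 + ...\<close>, both equal to 1, so a product over all \<open>n\<close> is a
  product over primes.\<close>

definition pf :: "(nat \<Rightarrow> int) \<Rightarrow> nat \<Rightarrow> int" where
  "pf f n = (if prime n then f n else 0)"

locale cmult =
  fixes f :: "nat \<Rightarrow> int"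
  assumes mult: "a > 0 \<Longrightarrow> b > 0 \<Longrightarrow> f (a * b) = f a * f b" and f1: "f 1 = 1"
begin

lemma f_power: "p > 0 \<Longrightarrow> f (p ^ k) = f p ^ k"
  using f1 by (induction k) (auto simp: mult)

lemma prod_Q:
  "(\<Prod>p=1..n. \<Sum>k\<le>K. (pf f p * H ^ elog L p) ^ k) = (\<Sum>m\<in>smooth K n. f m * H ^ eadd L m)"
proof -
  have "(\<Sum>m\<in>smooth K n. f m * H ^ eadd L m)
      = (\<Prod>p=1..n. if prime p then \<Sum>k\<le>K. f (p ^ k) * H ^ eadd L (p ^ k) else 1)"
    using f1 by (intro sum_smooth)
      (auto simp: mult prime_gt_0_nat eadd_mult power_add)
  also have "\<dots> = (\<Prod>p=1..n. \<Sum>k\<le>K. (pf f p * H ^ elog L p) ^ k)"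
  proof (intro prod.cong refl)
    fix p
    show "(if prime p then \<Sum>k\<le>K. f (p ^ k) * H ^ eadd L (p ^ k) else 1)
        = (\<Sum>k\<le>K. (pf f p * H ^ elog L p) ^ k)"
    proof (cases "prime p")
      case True
      then show ?thesis
        by (simp add: pf_def f_power prime_gt_0_nat eadd_prime_power power_mult_distrib
            power_mult[symmetric] mult.commute)
    qed (simp add: pf_def power_0_left)
  qed
  finally show ?thesis ..
qed

text \<open>The yardstick for the coefficients: in either packed polynomial their absolute values
  add up to at most this integer, which a program can find as a product.\<close>

lemma prod_C: "(\<Prod>p=1..n. \<Sum>k\<le>K. \<bar>pf f p\<bar> ^ k) = (\<Sum>m\<in>smooth K n. \<bar>f m\<bar>)"
proof -
  have "(\<Sum>m\<in>smooth K n. \<bar>f m\<bar>)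
      = (\<Prod>p=1..n. if prime p then \<Sum>k\<le>K. \<bar>f (p ^ k)\<bar> else 1)"
    using f1 by (intro sum_smooth) (auto simp: mult prime_gt_0_nat abs_mult)
  also have "\<dots> = (\<Prod>p=1..n. \<Sum>k\<le>K. \<bar>pf f p\<bar> ^ k)"
    by (intro prod.cong refl) (auto simp: pf_def f_power prime_gt_0_nat power_abs power_0_left)
  finally show ?thesis ..
qed

lemma prod_P:
  assumes "K > 0"
  shows "(\<Prod>p=1..n. 1 - pf f p * H ^ elog L p)
      = (\<Sum>m\<in>smooth K n. moebius m * f m * H ^ eadd L m)"
proof -
  have mp: "moebius (p ^ k * m) = moebius (p ^ k) * moebius m" if "prime p" "\<not> p dvd m" for p k m
  proof -
    have "\<not> p dvd 1" using that(1) not_prime_unit by blast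
    then show ?thesis
      using moebius_prime_power[OF that, of k] moebius_prime_power[of p 1 k] that(1) by simp
  qed
  have "(\<Sum>m\<in>smooth K n. moebius m * f m * H ^ eadd L m)
      = (\<Prod>p=1..n. if prime p then \<Sum>k\<le>K. moebius (p ^ k) * f (p ^ k) * H ^ eadd L (p ^ k) else 1)"
    using f1 by (intro sum_smooth)
      (auto simp: mult prime_gt_0_nat eadd_mult power_add mp)
  also have "\<dots> = (\<Prod>p=1..n. 1 - pf f p * H ^ elog L p)"
  proof (intro prod.cong refl)
    fix p assume "p \<in> {1..n}"
    have "(\<Sum>k\<le>K. moebius (p ^ k) * f (p ^ k) * H ^ eadd L (p ^ k)) = 1 - f p * H ^ elog L p"
      if "prime p"
    proof -
      have "\<not> p dvd 1" using that not_prime_unit by blast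
      then have mk: "moebius (p ^ k) = (if k = 0 then 1 else if k = 1 then - 1 else 0)" for k
        using moebius_prime_power[of p 1 k] that by simp
      then have "(\<Sum>k\<le>K. moebius (p ^ k) * f (p ^ k) * H ^ eadd L (p ^ k))
          = (\<Sum>k\<in>{0, 1}. moebius (p ^ k) * f (p ^ k) * H ^ eadd L (p ^ k))"
        using assms mk by (intro sum.mono_neutral_right) auto
      also have "\<dots> = 1 - f p * H ^ elog L p"
        using f1 mk[of 1] that by (simp add: eadd_prime)
      finally show ?thesis .
    qed
    then show "(if prime p then \<Sum>k\<le>K. moebius (p ^ k) * f (p ^ k) * H ^ eadd L (p ^ k) else 1)
        = 1 - pf f p * H ^ elog L p"
      by (simp add: pf_def)
  qed
  finally show ?thesis ..
qed

text \<open>Truncating the Moebius side at \<open>y\<close> leaves exactly the \<open>d\<close> up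
  to \<open>y\<close>, because \<open>y <= N\<close> and the bound on \<open>X\<close> put all of
  \<open>{1..y}\<close> among the smooth numbers. After multiplication by \<open>Q\<close> the terms
  are indexed by pairs, with absolute values adding up to at most \<open>C ^ 2\<close>. The choice
  of \<open>H\<close> makes \<open>2 * C ^ 2\<close> smaller than \<open>H - 1\<close>, as the digit
  sum requires; the two truncations ask for less.\<close>

lemma smooth_part:
  assumes y: "0 < y" "y \<le> N" "y \<le> X" and L: "X ^ 2 < L" and K: "K > 0" "X < 2 ^ Suc K"
    and C: "C = (\<Prod>p=1..N. \<Sum>k\<le>K. \<bar>pf f p\<bar> ^ k)"
    and H: "H = 4 * C ^ 2 + 3"
    and P: "P = (\<Prod>p=1..N. 1 - pf f p * H ^ elog L p)"
    and Q: "Q = (\<Prod>p=1..N. \<Sum>k\<le>K. (pf f p * H ^ elog L p) ^ k)"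
  shows "bal (bal (bal P (H ^ Suc (elog L y)) * Q) (H ^ Suc (elog L X))) (H - 1)
    = (\<Sum>(d, m) | d \<in> {1..y} \<and> m \<in> smooth K N \<and> d * m \<le> X. moebius d * f (d * m))"
proof -
  let ?A = "smooth K N"
  have C': "C = (\<Sum>m\<in>?A. \<bar>f m\<bar>)" unfolding C by (rule prod_C)
  have C0: "C \<ge> 0" unfolding C' by (rule sum_nonneg) simp
  have CC: "C \<le> C ^ 2"
  proof (cases "C = 0")
    case False
    with C0 have "C * 1 \<le> C * C" by (intro mult_left_mono) auto
    then show ?thesis by (simp add: power2_eq_square)
  qed simp
  have L1: "y ^ 2 < L" using L power_mono[OF y(3), of 2] by linarith
  have bd: "(\<Sum>m\<in>?A. \<bar>moebius m * f m\<bar>) \<le> C"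
    unfolding C'
  proof (rule sum_mono)
    show "\<bar>moebius m * f m\<bar> \<le> \<bar>f m\<bar>" for m
      using mult_right_mono[OF abs_moebius_le[of m], of "\<bar>f m\<bar>"] by (simp add: abs_mult)
  qed
  have eq_y: "{m \<in> ?A. eadd L m \<le> elog L y} = {m \<in> ?A. m \<le> y}"
    using eadd_le_iff[OF smooth_pos y(1) L1] by auto
  have X0: "X > 0" using y by simp
  have "bal P (H ^ Suc (elog L y)) = (\<Sum>m\<in>{m \<in> ?A. eadd L m \<le> elog L y}. moebius m * f m * H ^ eadd L m)"
    unfolding P prod_P[OF K(1)] using bd CC C0 H by (intro bal_truncate) auto
  also have "\<dots> = (\<Sum>d=1..y. moebius d * f d * H ^ eadd L d)"
  proof -
    have "d \<in> ?A" if "d \<in> {1..y}" for d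
    proof (rule in_smoothI)
      fix p assume "prime p" "p dvd d"
      then have "p \<le> d" using that by (intro dvd_imp_le) auto
      then show "p \<le> N" using that y by simp
    qed (use that y K in auto)
    moreover have "m > 0" if "m \<in> ?A" for m using smooth_pos[OF that] .
    ultimately have "{m \<in> ?A. m \<le> y} = {1..y}" by (auto simp: Suc_le_eq)
    then show ?thesis by (simp add: eq_y)
  qed
  finally have M: "bal P (H ^ Suc (elog L y)) = (\<Sum>d=1..y. moebius d * f d * H ^ eadd L d)" .
  let ?S = "{1..y} \<times> ?A"
  let ?a = "\<lambda>(d, m). moebius d * f (d * m)"
  let ?e = "\<lambda>(d, m). eadd L (d * m)"
  have pos: "fst i * snd i > 0" if "i \<in> ?S" for i using that smooth_pos[of "snd i"] by auto
  have MQ: "bal P (H ^ Suc (elog L y)) * Q = (\<Sum>i\<in>?S. ?a i * H ^ ?e i)"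
    unfolding M Q prod_Q sum_product sum.cartesian_product
    using smooth_pos by (intro sum.cong) (auto simp: eadd_mult mult power_add algebra_simps)
  have "(\<Sum>i\<in>?S. \<bar>?a i\<bar>) \<le> (\<Sum>(d, m)\<in>?S. \<bar>f d\<bar> * \<bar>f m\<bar>)"
  proof (intro sum_mono, clarify)
    fix d m assume "d \<in> {1..y}" "m \<in> ?A"
    then show "\<bar>moebius d * f (d * m)\<bar> \<le> \<bar>f d\<bar> * \<bar>f m\<bar>"
      using smooth_pos[of m] mult_right_mono[OF abs_moebius_le[of d], of "\<bar>f (d * m)\<bar>"]
      by (simp add: abs_mult mult)
  qed
  also have "\<dots> = (\<Sum>d=1..y. \<bar>f d\<bar>) * C" unfolding C' sum_product sum.cartesian_product ..
  also have "\<dots> \<le> C * C"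
  proof (rule mult_right_mono[OF _ C0])
    have "{1..y} \<subseteq> ?A"
    proof
      fix d assume d: "d \<in> {1..y}"
      show "d \<in> ?A"
      proof (rule in_smoothI)
        fix p assume "prime p" "p dvd d"
        then have "p \<le> d" using d by (intro dvd_imp_le) auto
        then show "p \<le> N" using d y by simp
      qed (use d y K in auto)
    qed
    then show "(\<Sum>d=1..y. \<bar>f d\<bar>) \<le> C" unfolding C' by (intro sum_mono2) auto
  qed
  finally have abs: "(\<Sum>i\<in>?S. \<bar>?a i\<bar>) \<le> C ^ 2" by (simp add: power2_eq_square)
  have S: "{i \<in> ?S. ?e i \<le> elog L X} = {(d, m). d \<in> {1..y} \<and> m \<in> ?A \<and> d * m \<le> X}"
    using eadd_le_iff[OF pos X0 L] by auto
  have T: "bal (bal P (H ^ Suc (elog L y)) * Q) (H ^ Suc (elog L X))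
      = (\<Sum>i\<in>{(d, m). d \<in> {1..y} \<and> m \<in> ?A \<and> d * m \<le> X}. ?a i * H ^ ?e i)"
    unfolding MQ S[symmetric]
    by (rule bal_truncate) (use abs H zero_le_power2[of C] in \<open>linarith | simp\<close>)+
  have "(\<Sum>i\<in>{(d, m). d \<in> {1..y} \<and> m \<in> ?A \<and> d * m \<le> X}. \<bar>?a i\<bar>) \<le> (\<Sum>i\<in>?S. \<bar>?a i\<bar>)"
    by (intro sum_mono2) auto
  then show ?thesis
    unfolding T using abs H zero_le_power2[of C] by (intro bal_digit_sum) linarith
qed

text \<open>Grouping the pairs by \<open>k = d * m\<close> leaves the divisor sum of
  \<open>moebius\<close>, which kills every \<open>k\<close> but 1.\<close>

lemma sum_moebius_pairs:
  assumes "M > 0"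
  shows "(\<Sum>(d, m) | d > 0 \<and> m > 0 \<and> d * m \<le> M. moebius d * f (d * m)) = 1"
proof -
  have "(\<Sum>(d, m) | d > 0 \<and> m > 0 \<and> d * m \<le> M. moebius d * f (d * m))
      = (\<Sum>(k, d)\<in>Sigma {1..M} (\<lambda>k. {d. d dvd k}). moebius d * f k)"
    by (rule sum.reindex_bij_witness[where i = "\<lambda>(k, d). (d, k div d)" and j = "\<lambda>(d, m). (d * m, d)"])
      (auto simp: dvd_imp_le intro: Suc_leI elim!: dvdE)
  also have "\<dots> = (\<Sum>k=1..M. \<Sum>d | d dvd k. moebius d * f k)"
    by (subst sum.Sigma) auto
  also have "\<dots> = (\<Sum>k=1..M. f k * (\<Sum>d | d dvd k. moebius d))"
    by (simp add: sum_distrib_left mult.commute)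
  also have "\<dots> = (\<Sum>k=1..M. if k = 1 then f 1 else 0)"
    by (intro sum.cong) (auto simp: sum_moebius_divisors)
  also have "\<dots> = 1" using assms f1 by simp
  finally show ?thesis .
qed

lemma S0_pairs:
  assumes "\<lfloor>yr\<rfloor> = int y"
  shows "S0 f yr (real X)
    = (\<Sum>(d, m) | d \<in> {1..y} \<and> m > 0 \<and> d * m \<le> X. moebius d * f (d * m))"
proof -
  have 1: "{n. 1 \<le> n \<and> real n \<le> yr} = {1..y}"
    using assms by (auto simp: floor_eq_iff)
  have 2: "{m. 1 \<le> m \<and> real m \<le> real X / real d} = {m. m > 0 \<and> d * m \<le> X}" if "d \<in> {1..y}" for d
  proof -
    have "real m \<le> real X / real d \<longleftrightarrow> d * m \<le> X" for m
      using that by (simp add: pos_le_divide_eq mult.commute del: of_nat_mult add: of_nat_mult[symmetric])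
    then show ?thesis by auto
  qed
  have fin: "finite {m. m > 0 \<and> d * m \<le> X}" if "d > 0" for d
    by (rule finite_subset[of _ "{..X}"]) (use that in \<open>auto intro: order.trans[rotated]\<close>)
  have "S0 f yr (real X) = (\<Sum>d=1..y. \<Sum>m | m > 0 \<and> d * m \<le> X. moebius d * f (d * m))"
    unfolding S0_def summatory_def 1
  proof (intro sum.cong refl)
    fix d assume d: "d \<in> {1..y}"
    then show "moebius d * f d * (\<Sum>m | 1 \<le> m \<and> real m \<le> real X / real d. f m)
        = (\<Sum>m | m > 0 \<and> d * m \<le> X. moebius d * f (d * m))"
      unfolding 2[OF d] sum_distrib_left by (intro sum.cong) (auto simp: mult)
  qed
  also have "\<dots> = (\<Sum>(d, m)\<in>Sigma {1..y} (\<lambda>d. {m. m > 0 \<and> d * m \<le> X}). moebius d * f (d * m))"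
    using fin by (subst sum.Sigma) auto
  also have "Sigma {1..y} (\<lambda>d. {m. m > 0 \<and> d * m \<le> X}) = {(d, m). d \<in> {1..y} \<and> m > 0 \<and> d * m \<le> X}"
    by auto
  finally show ?thesis .
qed

text \<open>The two size conditions have separate jobs. \<open>X < (N + 1) ^ 2\<close> makes the
  prime \<open>q > N\<close> dividing a non-smooth \<open>m\<close> unique, so that the pairs are
  parametrized by \<open>q\<close>, \<open>d\<close> and \<open>m div q\<close>.
  \<open>X < (N + 1) * (y + 1)\<close> makes the restriction \<open>d <= y\<close> automatic for
  them, and the pairs belonging to one \<open>q\<close> contribute \<open>f q\<close> times a
  complete Moebius sum.\<close>

lemma large_part:
  assumes y: "\<lfloor>yr\<rfloor> = int y" and N: "X < (N + 1) ^ 2" "X < (N + 1) * (y + 1)"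
    and K: "X < 2 ^ Suc K"
  shows "S0 f yr (real X) - (\<Sum>(d, m) | d \<in> {1..y} \<and> m \<in> smooth K N \<and> d * m \<le> X. moebius d * f (d * m))
    = (\<Sum>p | prime p \<and> N < p \<and> p \<le> X. f p)"
proof -
  let ?A = "smooth K N"
  let ?D = "{(d, m). d \<in> {1..y} \<and> m > 0 \<and> d * m \<le> X}"
  let ?E = "{(d, m). d \<in> {1..y} \<and> m \<in> ?A \<and> d * m \<le> X}"
  let ?P = "{p. prime p \<and> N < p \<and> p \<le> X}"
  let ?F = "\<lambda>q. {(d, m). d > 0 \<and> m > 0 \<and> d * m \<le> X div q}"
  have "d * m \<le> X \<Longrightarrow> d > 0 \<Longrightarrow> m \<le> X" for d m :: nat
    by (metis One_nat_def Suc_leI le_trans mult_le_mono1 nat_mult_1)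
  then have finD: "finite ?D" by (intro finite_subset[of ?D "{1..y} \<times> {..X}"]) auto
  have "?E \<subseteq> ?D" using smooth_pos by auto
  then have "S0 f yr (real X) - (\<Sum>(d, m)\<in>?E. moebius d * f (d * m)) = (\<Sum>(d, m)\<in>?D - ?E. moebius d * f (d * m))"
    unfolding S0_pairs[OF y] using finD by (subst sum_diff) auto
  also have "?D - ?E = (\<lambda>(q, d, m). (d, q * m)) ` Sigma ?P ?F" (is "?L = ?R")
  proof
    show "?L \<subseteq> ?R"
    proof
      fix i assume "i \<in> ?L"
      then obtain d m where i: "i = (d, m)" and d: "1 \<le> d" "d \<le> y" and m: "m > 0" "d * m \<le> X" "m \<notin> ?A"
        by auto
      have "1 * m \<le> d * m" using d by (intro mult_le_mono) auto
      then have mX: "m \<le> X" using m(2) by linarith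
      \<comment> \<open>Below \<open>2 ^ Suc K\<close> the exponent cap excludes nothing, so being
        outside \<open>?A\<close> means having a prime factor above \<open>N\<close>.\<close>
      have "\<exists>q. prime q \<and> q dvd m \<and> N < q"
      proof (rule ccontr)
        assume "\<not> ?thesis"
        then have "p \<le> N" if "prime p" "p dvd m" for p using that not_less by blast
        moreover have "m < 2 ^ Suc K" using mX K by linarith
        ultimately show False using in_smoothI[of m K N] m by blast
      qed
      then obtain q m' where q: "prime q" "N < q" "m = q * m'" by blast
      have m': "m' > 0" using m(1) q(3) by (cases m') auto
      have "d * m' * q \<le> X" using m(2) q(3) by (simp add: mult_ac)
      then have "d * m' \<le> X div q"
        using prime_gt_0_nat[OF q(1)] by (simp add: less_eq_div_iff_mult_less_eq)
      moreover have "q * 1 \<le> q * m'" using m' by (intro mult_le_mono) auto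
      then have "q \<le> X" using mX q(3) by linarith
      ultimately have "(q, d, m') \<in> Sigma ?P ?F" using q d m' by simp
      then show "i \<in> ?R" unfolding i q(3) by (rule rev_image_eqI) simp
    qed
  next
    show "?R \<subseteq> ?L"
    proof (clarify, intro DiffI)
      fix q d m assume *: "prime q" "N < q" "q \<le> X" "d > 0" "m > 0" "d * m \<le> X div q"
      have q0: "q > 0" using *(1) prime_gt_0_nat by blast
      have le: "d * (q * m) \<le> X" using *(6) q0 by (simp add: less_eq_div_iff_mult_less_eq mult_ac)
      have "(N + 1) * 1 \<le> q * m" using *(2,5) by (intro mult_le_mono) auto
      then have "d * (N + 1) \<le> d * (q * m)" by (intro mult_le_mono) auto
      then have "(N + 1) * d < (N + 1) * (y + 1)" using le N(2) by (metis le_less_trans le_trans mult.commute)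
      then have "d < y + 1" unfolding mult_less_cancel1 by blast
      then show "(d, q * m) \<in> ?D" using *(4,5) le q0 by simp
      show "(d, q * m) \<notin> ?E" using smooth_prime_le[of "q * m" K N q] *(1,2) by auto
    qed
  qed
  also have "(\<Sum>(d, m)\<in>\<dots>. moebius d * f (d * m))
      = (\<Sum>(q, d, m)\<in>Sigma ?P ?F. moebius d * f (d * (q * m)))"
  proof -
    have "inj_on (\<lambda>(q, d, m). (d, q * m)) (Sigma ?P ?F)"
    proof (rule inj_onI, clarify)
      fix q d m q' m'
      assume 1: "prime q" "N < q" "prime q'" "N < q'" "0 < d" "0 < m" "d * m \<le> X div q"
        "q * m = q' * m'"
      have q0: "q > 0" "q' > 0" using 1(1,3) prime_gt_0_nat by auto
      have "q = q'"
      proof (rule ccontr)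
        assume "q \<noteq> q'"
        then have "coprime q q'" using 1(1,3) primes_coprime by blast
        moreover have "q' dvd q * m" unfolding 1(8) by simp
        ultimately have "q' dvd m" by (simp add: coprime_commute coprime_dvd_mult_right_iff)
        then have "q' \<le> m" using 1(6) by (intro dvd_imp_le)
        have "(N + 1) ^ 2 \<le> q * q'" unfolding power2_eq_square using 1(2,4) by (intro mult_le_mono) auto
        also have "\<dots> \<le> q * m" using \<open>q' \<le> m\<close> by simp
        also have "\<dots> = 1 * m * q" by simp
        also have "\<dots> \<le> d * m * q" using 1(5) by (intro mult_le_mono) auto
        also have "\<dots> \<le> X" using 1(7) q0 by (simp add: less_eq_div_iff_mult_less_eq)
        finally show False using N(1) by simp
      qed
      then show "q = q' \<and> (d, m) = (d, m')" using 1(8) q0 by simp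
    qed
    then show ?thesis by (simp add: sum.reindex case_prod_unfold)
  qed
  also have "\<dots> = (\<Sum>q\<in>?P. \<Sum>(d, m)\<in>?F q. moebius d * f (d * (q * m)))"
  proof -
    have "finite (?F q)" for q
      by (rule finite_subset[of _ "{..X div q} \<times> {..X div q}"])
        (auto intro: order.trans[rotated])
    then show ?thesis by (subst sum.Sigma) auto
  qed
  also have "\<dots> = (\<Sum>q\<in>?P. f q)"
  proof (intro sum.cong refl)
    fix q assume q: "q \<in> ?P"
    then have q0: "q > 0" using prime_gt_0_nat by auto
    have "(\<Sum>(d, m)\<in>?F q. moebius d * f (d * (q * m))) = (\<Sum>(d, m)\<in>?F q. f q * (moebius d * f (d * m)))"
      using q0 by (intro sum.cong) (auto simp: mult)
    also have "\<dots> = f q * (\<Sum>(d, m)\<in>?F q. moebius d * f (d * m))"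
      by (simp add: sum_distrib_left case_prod_unfold)
    also have "\<dots> = f q" using q q0 by (subst sum_moebius_pairs) (auto simp: div_greater_zero_iff)
    finally show "(\<Sum>(d, m)\<in>?F q. moebius d * f (d * (q * m))) = f q" .
  qed
  finally show ?thesis .
qed

end

section \<open>Approximation of the parameter\<close>

text \<open>About three times the binary logarithm. One number serves as the count of squarings
  (with \<open>L = 2 ^ ell x\<close>), as the exponent cap in \<open>smooth\<close> and as the bit
  length in the cost bounds. The cube lets \<open>L\<close> exceed \<open>x ^ 2\<close>, as
  \<open>eadd_le_iff\<close> asks, and keeps rounding errors of logarithms below
  \<open>ln 2 / x ^ 3\<close>.\<close>

definition ell :: "nat \<Rightarrow> nat" where
  "ell x = (LEAST l. x ^ 3 < 2 ^ l)"

lemma ell_less: "x ^ 3 < 2 ^ ell x"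
  unfolding ell_def by (rule LeastI[of _ "x ^ 3"]) (rule less_exp)

lemma ell_iff: "x ^ 3 < 2 ^ l \<longleftrightarrow> ell x \<le> l"
proof
  assume "ell x \<le> l"
  then have "(2::nat) ^ ell x \<le> 2 ^ l" by simp
  then show "x ^ 3 < 2 ^ l" using ell_less[of x] by linarith
qed (auto simp: ell_def intro: Least_le)

text \<open>The constant: \<open>ln 2 >= 1/2\<close> turns \<open>l * ln 2 <= 3 * ln x\<close> into
  \<open>l <= 6 * ln x\<close>, and the remaining unit is paid by
  \<open>1 <= 2 * ln x\<close>.\<close>

lemma ell_le:
  assumes "x \<ge> 2"
  shows "real (ell x) \<le> 8 * ln (real x)"
proof -
  have "2 ^ 0 \<le> x ^ 3" using assms by simp
  then have "ell x > 0" using ell_iff[of x 0] by auto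
  then obtain l where l: "ell x = Suc l" by (cases "ell x") auto
  then have "2 ^ l \<le> x ^ 3" using ell_iff[of x l] by linarith
  then have "(2::real) ^ l \<le> real x ^ 3" by (metis of_nat_le_iff of_nat_numeral of_nat_power)
  then have "ln ((2::real) ^ l) \<le> ln (real x ^ 3)" using assms by (subst ln_le_cancel_iff) auto
  then have 1: "real l * ln 2 \<le> 3 * ln (real x)" using assms by (simp add: ln_realpow)
  have 2: "ln 2 \<le> ln (real x)" using assms by simp
  have "exp (1::real) \<le> 2 ^ 2" by (rule order.trans[OF exp_le]) simp
  then have "1 \<le> ln ((2::real) ^ 2)" by (subst ln_ge_iff) auto
  then have 3: "1 / 2 \<le> ln (2::real)" by (subst (asm) ln_realpow) auto
  then have "real l * (1 / 2) \<le> real l * ln 2" by (intro mult_left_mono) auto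
  with 1 2 3 show ?thesis unfolding l by simp
qed

lemma elog_real_bounds:
  assumes "n > 0" "L > 0"
  shows "ln (real n) - ln 2 / real L \<le> real (elog L n) * (ln 2 / real L)"
    and "real (elog L n) * (ln 2 / real L) \<le> ln (real n)"
proof -
  have l2: "ln (2::real) > 0" by simp
  have "real L * log 2 (real n) \<ge> 0" using assms by simp
  then have "real (elog L n) \<le> real L * log 2 (real n)" "real L * log 2 (real n) < real (elog L n) + 1"
    unfolding elog_def by linarith+
  then have 1: "real (elog L n) * (ln 2 / real L) \<le> real L * log 2 (real n) * (ln 2 / real L)"
    and 2: "real L * log 2 (real n) * (ln 2 / real L) \<le> (real (elog L n) + 1) * (ln 2 / real L)"
    using l2 by (intro mult_right_mono; simp)+
  have 3: "real L * log 2 (real n) * (ln 2 / real L) = ln (real n)"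
    using assms l2 by (simp add: log_def)
  show "ln (real n) - ln 2 / real L \<le> real (elog L n) * (ln 2 / real L)"
    using 2 unfolding 3 distrib_right by linarith
  show "real (elog L n) * (ln 2 / real L) \<le> ln (real n)"
    using 1 unfolding 3 .
qed

text \<open>With \<open>L = 2 ^ ell x\<close> the difference \<open>elog L (x + 1) - elog L x\<close> is about \<open>L / (x ln 2)\<close>, so
  \<open>num_of x / den_of x\<close> and \<open>lnln_of x / den_of x\<close> approximate \<open>ln x\<close> and \<open>ln (ln x)\<close>; no
  numerical value of \<open>ln 2\<close> is needed.\<close>

definition num_of :: "nat \<Rightarrow> nat" where
  "num_of x = elog (2 ^ ell x) x"

definition den_of :: "nat \<Rightarrow> nat" where
  "den_of x = x * (elog (2 ^ ell x) (x + 1) - elog (2 ^ ell x) x)"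

definition lnln_of :: "nat \<Rightarrow> int" where
  "lnln_of x = int (elog (2 ^ ell x) (num_of x)) - int (elog (2 ^ ell x) (den_of x))"

definition y_approx :: "nat \<Rightarrow> real" where
  "y_approx x = real x powr (1/3) * (num_of x / den_of x) ^ 3 * (lnln_of x / den_of x)"

lemma elog_mono: "0 < m \<Longrightarrow> m \<le> n \<Longrightarrow> elog L m \<le> elog L n"
  unfolding elog_def by (intro nat_mono floor_mono mult_left_mono) auto

text \<open>Every rounding error is replaced by its worst case \<open>ln 2 / x ^ 3\<close>. The
  dominant relative error is then that of \<open>x * ln (1 + 1/x)\<close> against 1, of order
  \<open>1 / x\<close>; since \<open>y_of\<close> is a cube root up to logarithms, the absolute
  error tends to 0.\<close>

lemma upper_approx:
  "((\<lambda>x::real. x powr (1/3) * (ln x / (x * (ln (1+1/x) - ln 2/x^3)))^3 *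
     ((ln (ln x / (x * (ln (1+1/x) - ln 2/x^3))) + ln 2/x^3) / (x * (ln (1+1/x) - ln 2/x^3))) -
     y_of x) \<longlongrightarrow> 0) at_top"
  unfolding y_of_def by real_asymp

lemma lower_approx:
  "((\<lambda>x::real. x powr (1/3) * ((ln x - ln 2/x^3) / (x * (ln (1+1/x) + ln 2/x^3)))^3 *
     ((ln ((ln x - ln 2/x^3) / (x * (ln (1+1/x) + ln 2/x^3))) - ln 2/x^3) / (x * (ln (1+1/x) + ln 2/x^3))) -
     y_of x) \<longlongrightarrow> 0) at_top"
  unfolding y_of_def by real_asymp

lemma eventually_nat: "eventually P at_top \<Longrightarrow> eventually (\<lambda>n. P (real n)) at_top"
  using eventually_compose_filterlim filterlim_real_sequentially by blast

text \<open>Interval arithmetic. Multiplied by \<open>e = ln 2 / L\<close>, the integers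
  \<open>num_of x\<close>, \<open>den_of x\<close> and \<open>lnln_of x\<close> become \<alpha> near
  \<open>ln x\<close>, \<beta> near 1 and \<gamma> near \<open>ln (ln x)\<close>, and
  \<open>e\<close> cancels in the quotients that form \<open>y_approx\<close>.\<close>

lemma y_approx_bounds:
  fixes x :: nat
  defines "d \<equiv> ln 2 / real x ^ 3"
  defines "w1 \<equiv> real x * (ln (1 + 1 / real x) - d)" and "w2 \<equiv> real x * (ln (1 + 1 / real x) + d)"
  assumes x: "x > 1" and w1: "w1 > 0" and ld: "ln (real x) - d > 0"
    and lld: "ln ((ln (real x) - d) / w2) - d > 0"
  shows "num_of x > 0 \<and> den_of x > 0 \<and> lnln_of x > 0 \<and>
    real x powr (1/3) * ((ln (real x) - d) / w2) ^ 3 * ((ln ((ln (real x) - d) / w2) - d) / w2) \<le> y_approx x \<and>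
    y_approx x \<le> real x powr (1/3) * (ln (real x) / w1) ^ 3 * ((ln (ln (real x) / w1) + d) / w1)"
proof -
  define L where "L = (2::nat) ^ ell x"
  define e where "e = ln 2 / real L"
  have L: "L > 0" "real x ^ 3 \<le> real L"
    using ell_less[of x] by (simp_all add: L_def flip: of_nat_power)
  have x0: "real x > 0" using x by simp
  have e: "0 < e" "e \<le> d"
    unfolding e_def d_def using L x0 by (auto intro!: divide_left_mono)
  have "real (x + 1) = real x * (1 + 1 / real x)" using x0 by (simp add: field_simps)
  then have ln1: "ln (real (x + 1)) = ln (real x) + ln (1 + 1 / real x)"
    using x0 by (simp only: ln_mult_pos add_pos_pos zero_less_one zero_less_divide_1_iff)
  define c where "c = real (elog L (x + 1)) - real (elog L x)"
  have c_eq: "real (elog L (x + 1) - elog L x) = c"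
    using elog_mono[of x "x + 1" L] x by (simp add: c_def)
  have c: "ln (1 + 1 / real x) - d \<le> c * e" "c * e \<le> ln (1 + 1 / real x) + d"
    using elog_real_bounds[of x L] elog_real_bounds[of "x + 1" L] x L(1) e
    unfolding c_def e_def[symmetric] ln1 by (auto simp: algebra_simps)
  define \<beta> where "\<beta> = real (den_of x) * e"
  have \<beta>_eq: "\<beta> = real x * (c * e)" 
    unfolding \<beta>_def den_of_def L_def[symmetric] of_nat_mult c_eq by (simp only: mult.assoc)
  have \<beta>: "w1 \<le> \<beta>" "\<beta> \<le> w2"
    unfolding \<beta>_eq w1_def w2_def using c x0 by (auto intro!: mult_left_mono)
  then have \<beta>0: "\<beta> > 0" using w1 by linarith
  then have den: "den_of x > 0" by (auto simp: \<beta>_def intro: Nat.gr0I)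
  define \<alpha> where "\<alpha> = real (num_of x) * e"
  have \<alpha>: "ln (real x) - d \<le> \<alpha>" "\<alpha> \<le> ln (real x)"
    using elog_real_bounds[of x L] x L(1) e
    unfolding \<alpha>_def num_of_def L_def[symmetric] e_def[symmetric] by auto
  then have \<alpha>0: "\<alpha> > 0" using ld by linarith
  then have num: "num_of x > 0" by (auto simp: \<alpha>_def intro: Nat.gr0I)
  define u where "u = \<alpha> / \<beta>"
  have u_eq: "u = real (num_of x) / real (den_of x)" unfolding u_def \<alpha>_def \<beta>_def using e by simp
  have u: "(ln (real x) - d) / w2 \<le> u" "u \<le> ln (real x) / w1"
    unfolding u_def using \<alpha> \<beta> \<alpha>0 \<beta>0 ld w1 by (auto intro!: frac_le)
  have w2: "w2 > 0" using \<beta> \<beta>0 by linarith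
  have ulo: "(ln (real x) - d) / w2 > 0" using ld w2 by simp
  define \<gamma> where "\<gamma> = real_of_int (lnln_of x) * e"
  have lnu: "ln u = ln (real (num_of x)) - ln (real (den_of x))"
    unfolding u_eq using num den by (simp add: ln_div)
  have \<gamma>: "ln u - d \<le> \<gamma>" "\<gamma> \<le> ln u + d"
    using elog_real_bounds[OF num L(1)] elog_real_bounds[OF den L(1)] e
    unfolding \<gamma>_def lnln_of_def lnu L_def[symmetric] e_def[symmetric] by (auto simp: algebra_simps)
  have lnu_mono: "ln ((ln (real x) - d) / w2) \<le> ln u" "ln u \<le> ln (ln (real x) / w1)"
    using u ulo by auto
  have \<gamma>0: "\<gamma> > 0" using \<gamma> lnu_mono lld by linarith
  then have lnln: "lnln_of x > 0" using e by (simp add: \<gamma>_def zero_less_mult_iff)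
  have v_eq: "real_of_int (lnln_of x) / real (den_of x) = \<gamma> / \<beta>"
    unfolding \<gamma>_def \<beta>_def using e by simp
  have v: "(ln ((ln (real x) - d) / w2) - d) / w2 \<le> \<gamma> / \<beta>"
      "\<gamma> / \<beta> \<le> (ln (ln (real x) / w1) + d) / w1"
    using \<gamma> lnu_mono \<gamma>0 \<beta> \<beta>0 lld w1 by (auto intro!: frac_le)
  have y: "y_approx x = real x powr (1/3) * u ^ 3 * (\<gamma> / \<beta>)"
    unfolding y_approx_def v_eq[symmetric] u_eq ..
  have "(ln ((ln (real x) - d) / w2) - d) / w2 \<ge> 0" using lld w2 by simp
  then show ?thesis
    using num den lnln u v ulo \<gamma>0 \<beta>0 unfolding y
    by (intro conjI mult_mono power_mono) (auto intro!: mult_nonneg_nonneg)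
qed

lemma y_approx_correct:
  "\<forall>\<^sub>F x in at_top. num_of x > 0 \<and> den_of x > 0 \<and> lnln_of x > 0 \<and> \<bar>y_approx x - y_of (real x)\<bar> < 1/100"
proof -
  have e1: "eventually (\<lambda>x::real. x > 1) at_top" by real_asymp
  have e2: "eventually (\<lambda>x::real. x * (ln (1+1/x) - ln 2/x^3) > 0) at_top" by real_asymp
  have e3: "eventually (\<lambda>x::real. ln x - ln 2/x^3 > 0) at_top" by real_asymp
  have e4: "eventually (\<lambda>x::real. ln ((ln x - ln 2/x^3) / (x * (ln (1+1/x) + ln 2/x^3))) - ln 2/x^3 > 0) at_top"
    by real_asymp
  have e5: "\<forall>\<^sub>F x in at_top. x powr (1/3) * (ln x / (x * (ln (1+1/x) - ln 2/x^3)))^3 *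
     ((ln (ln x / (x * (ln (1+1/x) - ln 2/x^3))) + ln 2/x^3) / (x * (ln (1+1/x) - ln 2/x^3))) -
     y_of x < 1/100"
    by (rule order_tendstoD(2)[OF upper_approx]) simp
  have e6: "\<forall>\<^sub>F x in at_top. - (1/100) < x powr (1/3) * ((ln x - ln 2/x^3) / (x * (ln (1+1/x) + ln 2/x^3)))^3 *
     ((ln ((ln x - ln 2/x^3) / (x * (ln (1+1/x) + ln 2/x^3))) - ln 2/x^3) / (x * (ln (1+1/x) + ln 2/x^3))) -
     y_of x"
    by (rule order_tendstoD(1)[OF lower_approx]) simp
  from e1[THEN eventually_nat] e2[THEN eventually_nat] e3[THEN eventually_nat]
    e4[THEN eventually_nat] e5[THEN eventually_nat] e6[THEN eventually_nat]
  show ?thesis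
  proof eventually_elim
    case (elim x)
    have "x > 1" using elim(1) by simp
    from y_approx_bounds[OF this elim(2-4)] elim(5,6) show ?case
      unfolding abs_less_iff by (elim conjE, intro conjI; (assumption | linarith))
  qed
qed


section \<open>Growth of \<open>y_of\<close> and the effect of a displacement\<close>

lemma y_of_deriv:
  "\<forall>\<^sub>F t in at_top. (y_of has_real_derivative
     y_of t * (1 / (3 * t) + 3 / (t * ln t) + 1 / (t * ln t * ln (ln t)))) (at t)"
  using eventually_gt_at_top[of "exp (1::real)"]
proof eventually_elim
  case (elim t)
  have t: "t > 0" using elim exp_gt_zero[of "1::real"] by linarith
  then have l: "ln t > 1" using elim ln_less_cancel_iff[of "exp 1" t] by simp
  then have "ln (ln t) > 0" by simp
  have "t > 1" using elim one_less_exp_iff[of "1::real"] by linarith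
  have pw: "t * t powr - (2 / 3) = t powr (1 / 3)" using t powr_mult_base[of t "- (2 / 3)"] by simp
  then have "((\<lambda>x. x powr (1/3) * (ln x) ^ 3 * ln (ln x)) has_real_derivative
     y_of t * (1 / (3 * t) + 3 / (t * ln t) + 1 / (t * ln t * ln (ln t)))) (at t)"
    unfolding y_of_def using t l \<open>t > 1\<close> pw
    by (auto intro!: derivative_eq_intros simp: field_simps powr_diff power2_eq_square power3_eq_cube)
  then show ?case unfolding y_of_def[abs_def] .
qed

text \<open>By the mean value theorem the increment is \<open>w\<close> times a derivative between
  \<open>y_of z / (3 * z)\<close> and \<open>y_of z / (2 * z)\<close>, where
  \<open>x < z <= 2 * x\<close>. Crude bounds suffice: a value within 1/50 of an integer only has to
  be carried to one that is not within 1/50 of any integer. The number \<open>k\<close> stands for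
  the computed approximation to \<open>100 * y_of x\<close>.\<close>

lemma y_of_shift:
  "\<forall>\<^sub>F x in at_top. \<forall>k. \<bar>real k / 100 - y_of (real x)\<bar> \<le> 1 / 50 \<longrightarrow>
     (let w = x div (2 * (k div 100 + 1)) in
       w \<le> x \<and> real w \<le> real x / y_of (real x) \<and> 1 / 20 \<le> y_of (real (x + w)) - y_of (real x) \<and> y_of (real (x + w)) - y_of (real x) \<le> 3 / 5)"
proof -
  have "\<forall>\<^sub>F t in at_top. 1 / (3 * t) + 3 / (t * ln t) + 1 / (t * ln t * ln (ln t)) \<le> 1 / 2 / t \<and>
      1 / 3 / t \<le> 1 / (3 * t) + 3 / (t * ln t) + 1 / (t * ln t * ln (ln t)) \<and> y_of t \<ge> 100 \<and> t \<ge> 1"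
    unfolding y_of_def by (intro eventually_conj) real_asymp+
  with y_of_deriv have "\<forall>\<^sub>F t in at_top. t \<ge> 1 \<and> y_of t \<ge> 100 \<and> (\<exists>D. (y_of has_real_derivative D) (at t) \<and>
      y_of t / (3 * t) \<le> D \<and> D \<le> y_of t / (2 * t))"
  proof eventually_elim
    case (elim t)
    let ?q = "1 / (3 * t) + 3 / (t * ln t) + 1 / (t * ln t * ln (ln t))"
    have "y_of t * (1 / 3 / t) \<le> y_of t * ?q" "y_of t * ?q \<le> y_of t * (1 / 2 / t)"
      using elim by (intro mult_left_mono; simp)+
    then show ?case using elim by (intro conjI exI[of _ "y_of t * ?q"]) auto
  qed
  then obtain t0 where t0: "\<And>t. t \<ge> t0 \<Longrightarrow> t \<ge> 1 \<and> y_of t \<ge> 100 \<and> (\<exists>D. (y_of has_real_derivative D) (at t) \<and>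
      y_of t / (3 * t) \<le> D \<and> D \<le> y_of t / (2 * t))"
    unfolding eventually_at_top_linorder by blast
  have "((\<lambda>x. y_of (2 * x) / y_of x) \<longlongrightarrow> 2 powr (1/3)) at_top"
    unfolding y_of_def by real_asymp
  moreover have "2 powr (1/3) < (2::real)" using powr_less_mono[of "1/3" 1 "2::real"] by simp
  ultimately have "\<forall>\<^sub>F x in at_top. y_of (2 * x) / y_of x < 2" by (rule order_tendstoD(2))
  moreover have "\<forall>\<^sub>F x in at_top. y_of x / (6 * x) \<le> 1 / 100 \<and> y_of x > 0"
    unfolding y_of_def by (intro eventually_conj) real_asymp+
  ultimately have "\<forall>\<^sub>F x in at_top. y_of (2 * x) \<le> 2 * y_of x \<and> y_of x / (6 * x) \<le> 1 / 100"
    by eventually_elim (auto simp: field_simps)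
  from eventually_nat[OF this] eventually_nat[OF eventually_ge_at_top[of t0]]
  show ?thesis
  proof eventually_elim
    case (elim x)
    show ?case
    proof (intro allI impI)
      fix k assume k: "\<bar>real k / 100 - y_of (real x)\<bar> \<le> 1 / 50"
      let ?y = "y_of (real x)"
      define q where "q = k div 100 + 1"
      define w where "w = x div (2 * q)"
      have y100: "?y \<ge> 100" and x1: "real x \<ge> 1" using t0[of "real x"] elim by auto
      have "real (k div 100) \<le> real k / 100" "real k / 100 < real (k div 100) + 1" by linarith+
      moreover have "real q = real (k div 100) + 1" by (simp add: q_def)
      \<comment> \<open>51/50 is the 1/50 of the approximation plus the 1 added after rounding
        down.\<close>
      ultimately have q: "?y - 1/50 < q" "q \<le> ?y + 51/50" using k unfolding abs_le_iff by linarith+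
      have q0: "q > 0" by (simp add: q_def)
      have w: "real w \<le> real x / (2 * q)" "real x / (2 * q) - 1 < real w"
        using floor_divide_of_nat_eq[of x "2 * q", where 'a = real] unfolding w_def[symmetric]
        by (simp_all add: floor_eq_iff)
      have "real x / (2 * q) \<le> real x / (2 * (?y - 1/50))"
        using q y100 by (intro divide_left_mono mult_pos_pos) auto
      then have wu: "real w \<le> real x / (2 * (?y - 1/50))" using w by linarith
      have "real x / (2 * (?y + 51/50)) \<le> real x / (2 * q)"
        using q y100 q0 by (intro divide_left_mono mult_pos_pos) auto
      then have wl: "real x / (2 * (?y + 51/50)) - 1 \<le> real w" using w by linarith
      have "real x / (2 * (?y - 1/50)) \<le> real x / ?y"
        using y100 by (intro divide_left_mono) auto
      then have wy: "real w \<le> real x / ?y" using wu by linarith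
      also have "\<dots> \<le> real x / 1" using y100 by (intro divide_left_mono) auto
      finally have wx: "w \<le> x" by simp
      have mono: "y_of s \<le> y_of t" if "real x \<le> s" "s \<le> t" for s t
      proof (rule DERIV_nonneg_imp_nondecreasing[OF that(2)])
        fix r assume "s \<le> r" "r \<le> t"
        then have r: "r \<ge> t0" using that elim by linarith
        then obtain D where D: "(y_of has_real_derivative D) (at r)" "y_of r / (3 * r) \<le> D" using t0 by blast
        have "0 \<le> y_of r / (3 * r)" using t0[OF r] by simp
        with D show "\<exists>D. (y_of has_real_derivative D) (at r) \<and> 0 \<le> D" by (intro exI[of _ D]) auto
      qed
      have "1 \<le> real x / (2 * (?y + 51/50)) - 1"
      proof -
        have "6 * real x \<ge> 100 * ?y" using elim(1) x1 by (simp add: field_simps)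
        moreover have "2 * (2 * (Y + 51/50)) \<le> X" if "100 * Y \<le> 6 * X" "100 \<le> Y" for X Y :: real
          using that by simp
        ultimately have "2 * (2 * (?y + 51/50)) \<le> real x" using y100 by blast
        then show ?thesis using y100 by (simp add: field_simps)
      qed
      then have w0: "w > 0" using wl by (intro Nat.gr0I) simp
      have "\<exists>z>real x. z < real (x + w) \<and> (\<exists>D. y_of z / (3 * z) \<le> D \<and> D \<le> y_of z / (2 * z) \<and>
          y_of (real (x + w)) - y_of (real x) = real w * D)"
      proof -
        define D where "D = (\<lambda>z. SOME D. (y_of has_real_derivative D) (at z) \<and>
            y_of z / (3 * z) \<le> D \<and> D \<le> y_of z / (2 * z))"
        have D: "(y_of has_real_derivative D z) (at z) \<and> y_of z / (3 * z) \<le> D z \<and> D z \<le> y_of z / (2 * z)"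
          if "z \<ge> t0" for z
          unfolding D_def by (rule someI_ex) (use t0[OF that] in blast)
        have "\<exists>z>real x. z < real (x + w) \<and> y_of (real (x + w)) - y_of (real x) = (real (x + w) - real x) * D z"
          by (rule MVT2) (use w0 D elim in auto)
        then obtain z where z: "z > real x" "z < real (x + w)"
            "y_of (real (x + w)) - y_of (real x) = (real (x + w) - real x) * D z" by blast
        then show ?thesis using D[of z] elim by (intro exI[of _ z]) auto
      qed
      then obtain z D where z: "real x < z" "z < real (x + w)" and D: "y_of z / (3 * z) \<le> D" "D \<le> y_of z / (2 * z)"
          and diff: "y_of (real (x + w)) - ?y = real w * D" by blast
      have z2: "z \<le> 2 * real x" using z wx by simp
      have "y_of z \<le> y_of (2 * real x)" using z z2 by (intro mono) auto
      then have yz: "y_of z \<le> 2 * ?y" using elim(1) by linarith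
      have yz': "?y \<le> y_of z" using z by (intro mono) auto
      have "D \<le> 2 * ?y / (2 * real x)"
        by (rule order.trans[OF D(2) frac_le]) (use yz z x1 y100 in auto)
      then have Du: "D \<le> ?y / real x" by simp
      have "?y / (3 * (2 * real x)) \<le> D"
        by (rule order.trans[OF frac_le D(1)]) (use yz' z z2 x1 y100 in auto)
      then have Dl: "?y / (6 * real x) \<le> D" by simp
      have Dl0: "0 \<le> ?y / (6 * real x)" using y100 x1 by simp
      have "real w * D \<le> real x / (2 * (?y - 1/50)) * (?y / real x)"
        using wu Du Dl Dl0 by (intro mult_mono) (auto intro: order.trans[of _ "real w"])
      also have "\<dots> = ?y / (2 * (?y - 1/50))" using x1 by simp
      also have "\<dots> \<le> 3 / 5" using y100 by (simp add: field_simps)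
      finally have up: "real w * D \<le> 3 / 5" .
      \<comment> \<open>For values of \<open>y_of\<close> from 100 on the quotient exceeds 0.08; the
        1/100 pays for the unit lost in rounding \<open>w\<close> down.\<close>
      have "1 / 20 \<le> ?y / (12 * (?y + 51/50)) - 1 / 100"
        using y100 by (simp add: field_simps)
      also have "\<dots> \<le> ?y / (12 * (?y + 51/50)) - ?y / (6 * real x)" using elim(1) by simp
      also have "\<dots> = (real x / (2 * (?y + 51/50)) - 1) * (?y / (6 * real x))"
      proof -
        have key: "Y / (12 * D) - Y / (6 * X) = (X / (2 * D) - 1) * (Y / (6 * X))" if "X > 0" "D > 0" for X Y D :: real
          using that by (simp add: field_simps)
        show ?thesis by (rule key) (use x1 y100 in linarith)+
      qed
      also have "\<dots> \<le> real w * D"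
        using wl Dl Dl0 by (intro mult_mono) auto
      finally have lo: "1 / 20 \<le> real w * D" .
      show "let w = x div (2 * (k div 100 + 1)) in
         w \<le> x \<and> real w \<le> real x / y_of (real x) \<and> 1 / 20 \<le> y_of (real (x + w)) - y_of (real x) \<and> y_of (real (x + w)) - y_of (real x) \<le> 3 / 5"
        unfolding Let_def q_def[symmetric] w_def[symmetric] using wx wy up lo diff by simp
    qed
  qed
qed

section \<open>Program verification\<close>

text \<open>A fragment of \<open>expr\<close> whose value depends on the local variables alone, so
  that assertions need not speak of the whole memory.\<close>

datatype lexp = Var nat | Lit int | Op binop lexp lexp

abbreviation lplus (infixl "\<^bold>+" 65) where "e \<^bold>+ e' \<equiv> Op Add e e'"
abbreviation lminus (infixl "\<^bold>-" 65) where "e \<^bold>- e' \<equiv> Op Sub e e'"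
abbreviation ltimes (infixl "\<^bold>*" 70) where "e \<^bold>* e' \<equiv> Op Mul e e'"
abbreviation ldiv (infixl "\<^bold>'/" 70) where "e \<^bold>/ e' \<equiv> Op Div e e'"
abbreviation lmod (infixl "\<^bold>%" 70) where "e \<^bold>% e' \<equiv> Op binop.Mod e e'"
abbreviation lequal (infix "\<^bold>=" 50) where "e \<^bold>= e' \<equiv> Op Eq e e'"
abbreviation lless (infix "\<^bold><" 50) where "e \<^bold>< e' \<equiv> Op Less e e'"

primrec lpow :: "lexp \<Rightarrow> nat \<Rightarrow> lexp" where
  "lpow e 0 = Lit 1"
| "lpow e (Suc n) = e \<^bold>* lpow e n"

primrec val :: "lexp \<Rightarrow> (nat \<Rightarrow> int) \<Rightarrow> int" where
  "val (Var i) \<sigma> = \<sigma> i"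
| "val (Lit k) \<sigma> = k"
| "val (Op b e e') \<sigma> = binop_val b (val e \<sigma>) (val e' \<sigma>)"

primrec lcost :: "lexp \<Rightarrow> nat" where
  "lcost (Var i) = 2"
| "lcost (Lit k) = 1"
| "lcost (Op b e e') = lcost e + lcost e' + 1"

lemma val_lpow [simp]: "val (lpow e n) \<sigma> = val e \<sigma> ^ n"
  by (induction n) auto

lemma lcost_lpow [simp]: "lcost (lpow e n) = n * (lcost e + 1) + 1"
  by (induction n) auto

primrec stores :: "prog \<Rightarrow> nat set" where
  "stores Skip = {}"
| "stores (Store t e e') = {t}"
| "stores (Seq c d) = stores c \<union> stores d"
| "stores (Cond e c d) = stores c \<union> stores d"
| "stores (While e c) = stores c"

lemma finite_stores [simp]: "finite (stores c)"
  by (induction c) auto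

lemma exec_frame: "exec prim c s n s' \<Longrightarrow> t \<notin> stores c \<Longrightarrow> s' t = s t"
  by (induction rule: exec.induct) auto

text \<open>Local variable \<open>j\<close> of a program is kept in cell \<open>0\<close> of table \<open>b + j\<close>. With \<open>b\<close> above all tables
  that the given subroutines write to, a call only destroys the variable that receives its result.\<close>

locale machine =
  fixes prim :: "nat \<Rightarrow> int \<Rightarrow> int" and b :: nat
  assumes b_pos: "0 < b"
begin

definition vars :: "memory \<Rightarrow> nat \<Rightarrow> int" where
  "vars s j = s (b + j) 0"

primrec cexpr :: "lexp \<Rightarrow> expr" where
  "cexpr (Var i) = Cell (b + i) (Const 0)"
| "cexpr (Lit k) = Const k"
| "cexpr (Op f e e') = Bin f (cexpr e) (cexpr e')"

lemma expr_cost_cexpr [simp]: "expr_cost (cexpr e) = lcost e"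
  by (induction e) auto

lemma eval_cexpr [simp]: "eval_expr prim (cexpr e) s = val e (vars s)"
  by (induction e) (auto simp: vars_def)

definition asg :: "nat \<Rightarrow> lexp \<Rightarrow> prog" where
  "asg v e = Store (b + v) (Const 0) (cexpr e)"

definition cond :: "lexp \<Rightarrow> prog \<Rightarrow> prog \<Rightarrow> prog" where
  "cond e c d = Cond (cexpr e) c d"

definition loop :: "lexp \<Rightarrow> prog \<Rightarrow> prog" where
  "loop e c = While (cexpr e) c"

abbreviation sequence :: "prog \<Rightarrow> prog \<Rightarrow> prog" (infixr ";;" 40) where
  "c ;; d \<equiv> Seq c d"

definition call1 :: "prog \<Rightarrow> nat \<Rightarrow> lexp \<Rightarrow> prog" where
  "call1 c r e = (Store 0 (Const 0) (cexpr e) ;; c ;; Store (b + r) (Const 0) (Cell 0 (Const 0)))"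

definition call2 :: "prog \<Rightarrow> nat \<Rightarrow> lexp \<Rightarrow> lexp \<Rightarrow> prog" where
  "call2 c r e e' = (Store 0 (Const 0) (cexpr e) ;; Store 0 (Const 1) (cexpr e') ;; c ;;
     Store (b + r) (Const 0) (Cell 0 (Const 0)))"

definition main1 :: "prog \<Rightarrow> nat \<Rightarrow> prog" where
  "main1 c r = (Store b (Const 0) (Cell 0 (Const 0)) ;; c ;; Store 0 (Const 0) (cexpr (Var r)))"

definition main2 :: "prog \<Rightarrow> nat \<Rightarrow> prog" where
  "main2 c r = (Store b (Const 0) (Cell 0 (Const 0)) ;; Store (b + 1) (Const 0) (Cell 0 (Const 1)) ;;
     c ;; Store 0 (Const 0) (cexpr (Var r)))"

definition mods :: "prog \<Rightarrow> nat set" where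
  "mods c = {j. b + j \<in> stores c}"

lemma mods_simps [simp]:
  "mods (asg v e) = {v}" "mods (c ;; d) = mods c \<union> mods d" "mods Skip = {}"
  "mods (cond e c d) = mods c \<union> mods d" "mods (loop e c) = mods c"
  by (auto simp: mods_def asg_def cond_def loop_def)

lemma mods_call1 [simp]: "stores c \<subseteq> {..<b} \<Longrightarrow> mods (call1 c r e) = {r}"
  using b_pos by (force simp: mods_def call1_def)

text \<open>Assertions see the memory only through \<open>vars\<close>, so a subroutine may leave
  anything in the tables below \<open>b\<close> without disturbing them.\<close>

definition ht :: "((nat \<Rightarrow> int) \<Rightarrow> bool) \<Rightarrow> prog \<Rightarrow> nat \<Rightarrow> ((nat \<Rightarrow> int) \<Rightarrow> bool) \<Rightarrow> bool" where
  "ht P c n Q \<longleftrightarrow>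
     (\<forall>s. P (vars s) \<longrightarrow> (\<exists>m s'. m \<le> n \<and> exec prim c s m s' \<and> Q (vars s')))"

lemma vars_upd [simp]: "vars (s(b + v := (s (b + v))(0 := k))) = (vars s)(v := k)"
  by (auto simp: vars_def fun_eq_iff)

lemma vars_upd0 [simp]: "vars (s(0 := h)) = vars s"
  using b_pos by (auto simp: vars_def fun_eq_iff)

lemma ht_asg: "ht (\<lambda>\<sigma>. Q (\<sigma>(v := val e \<sigma>))) (asg v e) (lcost e + 2) Q"
  unfolding ht_def asg_def
proof (intro allI impI)
  fix s assume "Q ((vars s)(v := val e (vars s)))"
  with exec.Store[of prim "b + v" "Const 0" "cexpr e" s]
  show "\<exists>m s'. m \<le> lcost e + 2 \<and>
      exec prim (Store (b + v) (Const 0) (cexpr e)) s m s' \<and> Q (vars s')"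
    by (intro exI[of _ "lcost e + 2"] exI[of _ "s(b + v := (s (b + v))(0 := val e (vars s)))"]) auto
qed

lemma ht_skip: "ht Q Skip 1 Q"
  unfolding ht_def using exec.Skip by blast

lemma ht_seq:
  assumes "ht R d m Q" and "ht P c n R"
  shows "ht P (c ;; d) (n + m) Q"
  unfolding ht_def
proof (intro allI impI)
  fix s assume "P (vars s)"
  then obtain i s' where 1: "i \<le> n" "exec prim c s i s'" "R (vars s')"
    using assms(2) unfolding ht_def by blast
  then obtain j s'' where 2: "j \<le> m" "exec prim d s' j s''" "Q (vars s'')"
    using assms(1) unfolding ht_def by blast
  show "\<exists>k s'. k \<le> n + m \<and> exec prim (c ;; d) s k s' \<and> Q (vars s')"
    using exec.Seq[OF 1(2) 2(2)] 1 2 by (intro exI[of _ "i + j"] exI[of _ s'']) auto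
qed

text \<open>\<open>ht_seq\<close> lets the method \<open>rule\<close> compute preconditions backwards from a given
  postcondition; \<open>ht_compose\<close> chains proved triples with \<open>OF\<close>.\<close>

lemma ht_compose: "ht P c n R \<Longrightarrow> ht R d m Q \<Longrightarrow> ht P (c ;; d) (n + m) Q"
  by (rule ht_seq)

lemma ht_cond:
  assumes "ht P1 c n Q" and "ht P2 d m Q"
  shows "ht (\<lambda>\<sigma>. if val e \<sigma> \<noteq> 0 then P1 \<sigma> else P2 \<sigma>) (cond e c d) (lcost e + max n m) Q"
  unfolding ht_def cond_def
proof (intro allI impI)
  fix s assume *: "if val e (vars s) \<noteq> 0 then P1 (vars s) else P2 (vars s)"
  show "\<exists>k s'. k \<le> lcost e + max n m \<and> exec prim (Cond (cexpr e) c d) s k s' \<and> Q (vars s')"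
  proof (cases "val e (vars s) = 0")
    case True
    with * assms(2) obtain j s' where "j \<le> m" "exec prim d s j s'" "Q (vars s')"
      unfolding ht_def by force
    with exec.CondF[of prim "cexpr e" s d j s' c] True show ?thesis
      by (intro exI[of _ "lcost e + j"] exI[of _ s']) auto
  next
    case False
    with * assms(1) obtain j s' where "j \<le> n" "exec prim c s j s'" "Q (vars s')"
      unfolding ht_def by force
    with exec.CondT[of prim "cexpr e" s c j s' d] False show ?thesis
      by (intro exI[of _ "lcost e + j"] exI[of _ s']) auto
  qed
qed

lemma ht_conseq:
  assumes "ht P c n Q" and "\<And>\<sigma>. P' \<sigma> \<Longrightarrow> P \<sigma>" and "\<And>\<sigma>. Q \<sigma> \<Longrightarrow> Q' \<sigma>" and "n \<le> n'"
  shows "ht P' c n' Q'"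
  using assms unfolding ht_def by (meson le_trans)

lemma ht_pre:
  assumes "ht P c n Q" and "\<And>\<sigma>. P' \<sigma> \<Longrightarrow> P \<sigma>" and "n \<le> n'"
  shows "ht P' c n' Q"
  using assms unfolding ht_def by (meson le_trans)

lemma ht_false: "ht (\<lambda>_. False) c n Q"
  by (simp add: ht_def)

lemma ht_cond_true:
  assumes "ht P c n Q" "\<And>\<sigma>. P \<sigma> \<Longrightarrow> val e \<sigma> \<noteq> 0"
  shows "ht P (cond e c d) (lcost e + n) Q"
  by (rule ht_pre[OF ht_cond[OF assms(1) ht_false[of d 0]]]) (use assms(2) in auto)

lemma ht_cond_false:
  assumes "ht P d n Q" "\<And>\<sigma>. P \<sigma> \<Longrightarrow> val e \<sigma> = 0"
  shows "ht P (cond e c d) (lcost e + n) Q"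
  by (rule ht_pre[OF ht_cond[OF ht_false[of c 0] assms(1)]]) (use assms(2) in auto)

text \<open>Carries facts about untouched variables around a triple proved for \<open>c\<close>
  alone, so that each subprogram is specified by its own inputs and outputs only.\<close>

lemma ht_frame:
  assumes "ht P c n Q" and "\<And>\<sigma>. P' \<sigma> \<Longrightarrow> P \<sigma>"
    and "\<And>\<sigma> \<sigma>'. P' \<sigma> \<Longrightarrow> Q \<sigma>' \<Longrightarrow> (\<And>j. j \<notin> mods c \<Longrightarrow> \<sigma>' j = \<sigma> j) \<Longrightarrow> Q' \<sigma>'"
    and "n \<le> n'"
  shows "ht P' c n' Q'"
  unfolding ht_def
proof (intro allI impI)
  fix s assume *: "P' (vars s)"
  then obtain m s' where m: "m \<le> n" "exec prim c s m s'" "Q (vars s')"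
    using assms(1,2) unfolding ht_def by blast
  have "vars s' j = vars s j" if "j \<notin> mods c" for j
    using exec_frame[OF m(2)] that by (simp add: mods_def vars_def)
  then have "Q' (vars s')" using assms(3)[OF * m(3)] by blast
  with m assms(4) show "\<exists>m s'. m \<le> n' \<and> exec prim c s m s' \<and> Q' (vars s')"
    by (meson le_trans)
qed

lemma ht_loop:
  assumes body: "\<And>k. k < n \<Longrightarrow> ht (I k) c m (I (Suc k))"
    and cond: "\<And>k \<sigma>. k \<le> n \<Longrightarrow> I k \<sigma> \<Longrightarrow> val e \<sigma> \<noteq> 0 \<longleftrightarrow> k < n"
  shows "ht (I 0) (loop e c) (n * (m + lcost e) + lcost e) (I n)"
proof -
  have "ht (I (n - i)) (loop e c) (i * (m + lcost e) + lcost e) (I n)" if "i \<le> n" for i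
    using that
  proof (induction i)
    case 0
    show ?case unfolding ht_def loop_def
    proof (intro allI impI)
      fix s assume "I (n - 0) (vars s)"
      with cond[of n] exec.WhileF[of prim "cexpr e" s c]
      show "\<exists>m' s'. m' \<le> 0 * (m + lcost e) + lcost e \<and> exec prim (While (cexpr e) c) s m' s' \<and>
          I n (vars s')"
        by (intro exI[of _ "lcost e"] exI[of _ s]) auto
    qed
  next
    case (Suc i)
    show ?case unfolding ht_def loop_def
    proof (intro allI impI)
      fix s assume *: "I (n - Suc i) (vars s)"
      have "n - Suc i < n" and eq: "Suc (n - Suc i) = n - i" using Suc.prems by auto
      with body[of "n - Suc i"] * obtain j s' where j: "j \<le> m" "exec prim c s j s'"
          "I (n - i) (vars s')"
        unfolding ht_def by metis
      with Suc obtain k s'' where k: "k \<le> i * (m + lcost e) + lcost e"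
          "exec prim (While (cexpr e) c) s' k s''" "I n (vars s'')"
        unfolding ht_def loop_def by (meson Suc_leD)
      have "val e (vars s) \<noteq> 0" using cond[OF _ *] Suc.prems by simp
      with exec.WhileT[of prim "cexpr e" s c j s' k s''] j k
      show "\<exists>m' s'. m' \<le> Suc i * (m + lcost e) + lcost e \<and>
          exec prim (While (cexpr e) c) s m' s' \<and> I n (vars s')"
        by (intro exI[of _ "lcost e + j + k"] exI[of _ s'']) auto
    qed
  qed
  from this[of n] show ?thesis by simp
qed

lemma ht_call1:
  assumes "computes_within prim c [a] res T" and "stores c \<subseteq> {..<b}"
  shows "ht (\<lambda>\<sigma>. val e \<sigma> = a \<and> Q (\<sigma>(r := res))) (call1 c r e) (T + lcost e + 6) Q"
  unfolding ht_def call1_def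
proof (intro allI impI)
  fix s assume *: "val e (vars s) = a \<and> Q ((vars s)(r := res))"
  define s1 where "s1 = s(0 := (s 0)(0 := a))"
  have 1: "exec prim (Store 0 (Const 0) (cexpr e)) s (lcost e + 2) s1"
    using exec.Store[of prim 0 "Const 0" "cexpr e" s] * by (simp add: s1_def)
  have "\<forall>i<length [a]. s1 0 (int i) = [a] ! i" by (simp add: s1_def)
  then obtain m s2 where 2: "m \<le> T" "exec prim c s1 m s2" "s2 0 0 = res"
    using assms(1) unfolding computes_within_def by blast
  have v2: "vars s2 = vars s"
  proof
    fix j
    have "b + j \<notin> stores c" using assms(2) by auto
    then show "vars s2 j = vars s j"
      using exec_frame[OF 2(2)] b_pos by (simp add: vars_def s1_def)
  qed
  define s3 where "s3 = s2(b + r := (s2 (b + r))(0 := res))"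
  have 3: "exec prim (Store (b + r) (Const 0) (Cell 0 (Const 0))) s2 4 s3"
    using exec.Store[of prim "b + r" "Const 0" "Cell 0 (Const 0)" s2] 2 by (simp add: s3_def numeral_eq_Suc)
  have "exec prim (Seq (Store 0 (Const 0) (cexpr e)) (Seq c (Store (b + r) (Const 0) (Cell 0 (Const 0)))))
      s (lcost e + 2 + (m + 4)) s3"
    by (intro exec.Seq[OF 1] exec.Seq[OF 2(2)] 3)
  moreover have "vars s3 = (vars s)(r := res)" by (simp add: s3_def v2)
  ultimately show "\<exists>m s'. m \<le> T + lcost e + 6 \<and> exec prim (Store 0 (Const 0) (cexpr e) ;; c ;;
      Store (b + r) (Const 0) (Cell 0 (Const 0))) s m s' \<and> Q (vars s')"
    using 2(1) * by (intro exI[of _ "lcost e + 2 + (m + 4)"] exI[of _ s3]) auto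
qed

lemma ht_call2:
  assumes "computes_within prim c [a, a'] res T" and "stores c \<subseteq> {..<b}"
  shows "ht (\<lambda>\<sigma>. val e \<sigma> = a \<and> val e' \<sigma> = a' \<and> Q (\<sigma>(r := res))) (call2 c r e e')
    (T + lcost e + lcost e' + 8) Q"
  unfolding ht_def call2_def
proof (intro allI impI)
  fix s assume *: "val e (vars s) = a \<and> val e' (vars s) = a' \<and> Q ((vars s)(r := res))"
  define s0 where "s0 = s(0 := (s 0)(0 := a))"
  define s1 where "s1 = s0(0 := (s0 0)(1 := a'))"
  have v0: "vars s0 = vars s" by (simp add: s0_def)
  have 0: "exec prim (Store 0 (Const 0) (cexpr e)) s (lcost e + 2) s0"
    using exec.Store[of prim 0 "Const 0" "cexpr e" s] * by (simp add: s0_def)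
  have 1: "exec prim (Store 0 (Const 1) (cexpr e')) s0 (lcost e' + 2) s1"
    using exec.Store[of prim 0 "Const 1" "cexpr e'" s0] * v0 by (simp add: s1_def)
  have "\<forall>i<length [a, a']. s1 0 (int i) = [a, a'] ! i"
    by (auto simp: s1_def s0_def less_Suc_eq)
  then obtain m s2 where 2: "m \<le> T" "exec prim c s1 m s2" "s2 0 0 = res"
    using assms(1) unfolding computes_within_def by blast
  have v2: "vars s2 = vars s"
  proof
    fix j
    have "b + j \<notin> stores c" using assms(2) by auto
    then show "vars s2 j = vars s j"
      using exec_frame[OF 2(2)] b_pos by (simp add: vars_def s1_def s0_def)
  qed
  define s3 where "s3 = s2(b + r := (s2 (b + r))(0 := res))"
  have 3: "exec prim (Store (b + r) (Const 0) (Cell 0 (Const 0))) s2 4 s3"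
    using exec.Store[of prim "b + r" "Const 0" "Cell 0 (Const 0)" s2] 2 by (simp add: s3_def numeral_eq_Suc)
  have "exec prim (Seq (Store 0 (Const 0) (cexpr e)) (Seq (Store 0 (Const 1) (cexpr e'))
      (Seq c (Store (b + r) (Const 0) (Cell 0 (Const 0))))))
      s (lcost e + 2 + (lcost e' + 2 + (m + 4))) s3"
    by (intro exec.Seq[OF 0] exec.Seq[OF 1] exec.Seq[OF 2(2)] 3)
  moreover have "vars s3 = (vars s)(r := res)" by (simp add: s3_def v2)
  ultimately show "\<exists>m s'. m \<le> T + lcost e + lcost e' + 8 \<and> exec prim (Store 0 (Const 0) (cexpr e) ;;
      Store 0 (Const 1) (cexpr e') ;; c ;;
      Store (b + r) (Const 0) (Cell 0 (Const 0))) s m s' \<and> Q (vars s')"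
    using 2(1) * by (intro exI[of _ "lcost e + 2 + (lcost e' + 2 + (m + 4))"] exI[of _ s3]) auto
qed

lemma ht_main:
  assumes "ht (\<lambda>\<sigma>. \<sigma> 0 = a) c n (\<lambda>\<sigma>. \<sigma> r = res)"
  shows "computes_within prim (main1 c r) [a] res (n + 8)"
  unfolding computes_within_def main1_def
proof (intro allI impI)
  fix s :: memory assume "\<forall>i<length [a]. s 0 (int i) = [a] ! i"
  then have *: "s 0 0 = a" by simp
  define s1 where "s1 = s(b := (s b)(0 := a))"
  have 1: "exec prim (Store b (Const 0) (Cell 0 (Const 0))) s 4 s1"
    using exec.Store[of prim b "Const 0" "Cell 0 (Const 0)" s] * by (simp add: s1_def numeral_eq_Suc)
  have "vars s1 0 = a" by (simp add: vars_def s1_def)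
  with assms obtain m s2 where 2: "m \<le> n" "exec prim c s1 m s2" "vars s2 r = res"
    unfolding ht_def by blast
  define s3 where "s3 = s2(0 := (s2 0)(0 := res))"
  have 3: "exec prim (Store 0 (Const 0) (cexpr (Var r))) s2 4 s3"
    using exec.Store[of prim 0 "Const 0" "cexpr (Var r)" s2] 2(3) by (simp add: s3_def vars_def numeral_eq_Suc)
  show "\<exists>m s'. m \<le> n + 8 \<and> exec prim (Store b (Const 0) (Cell 0 (Const 0)) ;; c ;;
      Store 0 (Const 0) (cexpr (Var r))) s m s' \<and> s' 0 0 = res"
    using exec.Seq[OF 1 exec.Seq[OF 2(2) 3]] 2(1)
    by (intro exI[of _ "4 + (m + 4)"] exI[of _ s3]) (auto simp: s3_def)
qed

lemma ht_main2:
  assumes "ht (\<lambda>\<sigma>. \<sigma> 0 = a \<and> \<sigma> 1 = a') c n (\<lambda>\<sigma>. \<sigma> r = res)"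
  shows "computes_within prim (main2 c r) [a, a'] res (n + 12)"
  unfolding computes_within_def main2_def
proof (intro allI impI)
  fix s :: memory assume h: "\<forall>i<length [a, a']. s 0 (int i) = [a, a'] ! i"
  have *: "s 0 0 = a" "s 0 1 = a'" using h[rule_format, of 0] h[rule_format, of 1] by auto
  define s0 where "s0 = s(b := (s b)(0 := a))"
  define s1 where "s1 = s0(b + 1 := (s0 (b + 1))(0 := a'))"
  have 0: "exec prim (Store b (Const 0) (Cell 0 (Const 0))) s 4 s0"
    using exec.Store[of prim b "Const 0" "Cell 0 (Const 0)" s] * by (simp add: s0_def numeral_eq_Suc)
  have 1: "exec prim (Store (b + 1) (Const 0) (Cell 0 (Const 1))) s0 4 s1"
    using exec.Store[of prim "b + 1" "Const 0" "Cell 0 (Const 1)" s0] * b_pos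
    by (simp add: s1_def s0_def numeral_eq_Suc)
  have "vars s1 0 = a" "vars s1 1 = a'" by (simp_all add: vars_def s1_def s0_def)
  with assms obtain m s2 where 2: "m \<le> n" "exec prim c s1 m s2" "vars s2 r = res"
    unfolding ht_def by blast
  define s3 where "s3 = s2(0 := (s2 0)(0 := res))"
  have 3: "exec prim (Store 0 (Const 0) (cexpr (Var r))) s2 4 s3"
    using exec.Store[of prim 0 "Const 0" "cexpr (Var r)" s2] 2(3) by (simp add: s3_def vars_def numeral_eq_Suc)
  show "\<exists>m s'. m \<le> n + 12 \<and> exec prim (Store b (Const 0) (Cell 0 (Const 0)) ;;
      Store (b + 1) (Const 0) (Cell 0 (Const 1)) ;; c ;;
      Store 0 (Const 0) (cexpr (Var r))) s m s' \<and> s' 0 0 = res"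
    using exec.Seq[OF 0 exec.Seq[OF 1 exec.Seq[OF 2(2) 3]]] 2(1)
    by (intro exI[of _ "4 + (4 + (m + 4))"] exI[of _ s3]) (auto simp: s3_def)
qed

end

text \<open>The finitely many arguments below \<open>n\<close>, to which asymptotic estimates do not apply, are answered
  from a table.\<close>

primrec lookup :: "nat \<Rightarrow> (nat \<Rightarrow> int) \<Rightarrow> prog \<Rightarrow> nat \<Rightarrow> prog" where
  "lookup i g c 0 = c"
| "lookup i g c (Suc n) = Cond (Bin Eq (Cell 0 (Const (int i))) (Const (int n)))
     (Store 0 (Const 0) (Const (g n))) (lookup i g c n)"

lemma lookup_large:
  assumes "computes_within prim c args r m" "i < length args" "args ! i = int x" "n \<le> x"
  shows "computes_within prim (lookup i g c n) args r (4 * n + m)"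
  using assms(4)
proof (induction n)
  case (Suc n)
  show ?case unfolding computes_within_def
  proof (intro allI impI)
    fix s :: memory assume s: "\<forall>i<length args. s 0 (int i) = args ! i"
    have "n \<le> x" using Suc.prems by simp
    then obtain k s' where k: "k \<le> 4 * n + m" "exec prim (lookup i g c n) s k s'" "s' 0 0 = r"
      using Suc.IH s unfolding computes_within_def by blast
    have "s 0 (int i) \<noteq> int n" using s assms(2,3) Suc.prems by simp
    then have "exec prim (lookup i g c (Suc n)) s
        (expr_cost (Bin Eq (Cell 0 (Const (int i))) (Const (int n))) + k) s'"
      unfolding lookup.simps using k(2) by (intro exec.CondF) auto
    with k show "\<exists>ma s'. ma \<le> 4 * Suc n + m \<and> exec prim (lookup i g c (Suc n)) s ma s' \<and> s' 0 0 = r"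
      by (intro exI[of _ "expr_cost (Bin Eq (Cell 0 (Const (int i))) (Const (int n))) + k"] exI[of _ s']) auto
  qed
qed (use assms(1) in simp)

lemma lookup_small:
  assumes "i < length args" "args ! i = int x" "x < n"
  shows "computes_within prim (lookup i g c n) args (g x) (4 * n + 3)"
  using assms(3)
proof (induction n)
  case (Suc n)
  show ?case unfolding computes_within_def
  proof (intro allI impI)
    fix s :: memory assume s: "\<forall>i<length args. s 0 (int i) = args ! i"
    show "\<exists>ma s'. ma \<le> 4 * Suc n + 3 \<and> exec prim (lookup i g c (Suc n)) s ma s' \<and> s' 0 0 = g x"
    proof (cases "x = n")
      case True
      then have "s 0 (int i) = int n" using s assms(1,2) by simp
      then have "exec prim (lookup i g c (Suc n)) s (4 + 3) (s(0 := (s 0)(0 := g n)))"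
        using exec.CondT[of prim "Bin Eq (Cell 0 (Const (int i))) (Const (int n))" s _ 3]
          exec.Store[of prim 0 "Const 0" "Const (g n)" s] by (simp add: numeral_eq_Suc)
      with True show ?thesis
        by (intro exI[of _ "4 + 3"] exI[of _ "s(0 := (s 0)(0 := g n))"]) auto
    next
      case False
      with Suc.prems have "x < n" by simp
      then obtain k s' where
        k: "k \<le> 4 * n + 3" "exec prim (lookup i g c n) s k s'" "s' 0 0 = g x"
        using Suc.IH s unfolding computes_within_def by blast
      have "s 0 (int i) \<noteq> int n" using s assms(1,2) False by simp
      then have "exec prim (lookup i g c (Suc n)) s
          (expr_cost (Bin Eq (Cell 0 (Const (int i))) (Const (int n))) + k) s'"
        unfolding lookup.simps using k(2) by (intro exec.CondF) auto
      with k show ?thesis by (intro exI[of _ "expr_cost (Bin Eq (Cell 0 (Const (int i))) (Const (int n))) + k"] exI[of _ s']) auto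
    qed
  qed
qed simp

lemma computes_within_mono:
  "computes_within prim c args r n \<Longrightarrow> n \<le> m \<Longrightarrow> computes_within prim c args r m"
  unfolding computes_within_def by (meson le_trans)

lemma computable_in_timeI:
  assumes large: "\<And>x. x \<ge> x0 \<Longrightarrow> computes_within prim c (args x) (g x) (T x)"
    and arg: "\<And>x. i < length (args x) \<and> args x ! i = int x"
    and T: "(\<lambda>x. real (T x)) \<in> O(bd)" and one: "(\<lambda>_. 1) \<in> O(bd)"
  shows "computable_in_time prim X args g bd"
  unfolding computable_in_time_def
proof (intro exI conjI ballI)
  fix x assume "x \<in> X"
  show "computes_within prim (lookup i g c x0) (args x) (g x) ((4 * x0 + 3) + T x)"
  proof (cases "x \<ge> x0")
    case True
    have "computes_within prim (lookup i g c x0) (args x) (g x) (4 * x0 + T x)"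
      using lookup_large[OF large[OF True], of i x x0 g] arg[of x] True by simp
    then show ?thesis by (rule computes_within_mono) simp
  next
    case False
    then have "computes_within prim (lookup i g c x0) (args x) (g x) (4 * x0 + 3)"
      using lookup_small[of i "args x" x x0 prim g c] arg[of x] by simp
    then show ?thesis by (rule computes_within_mono) simp
  qed
next
  have "(\<lambda>x. real (4 * x0 + 3)) \<in> O(\<lambda>_. 1)" by (rule bigoI[of _ "real (4 * x0 + 3)"]) simp
  from sum_in_bigo(1)[OF landau_o.big_trans[OF this one] T]
  show "(\<lambda>x. real ((4 * x0 + 3) + T x)) \<in> O(bd)" by (simp only: of_nat_add)
qed

section \<open>The algorithm for the sum over primes\<close>

context machine begin

text \<open>
  Variables of the main program: 0 is \<open>x\<close>, 1 is \<open>X\<close>, 2 is \<open>ell X\<close>, 4 is the base \<open>H\<close>; 5 to 10 belong to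
  \<open>log_prog\<close>, which returns \<open>elog L n\<close> in 8 and \<open>H ^ elog L n\<close> in 9 for \<open>n\<close> in 5; 12 is \<open>y\<close>, 13 the
  result, 14 is \<open>M\<close>, 15 the loop variable \<open>n\<close>, 16 a factorial, 17 the value \<open>pf f n\<close>, 18 the sum of
  these values, 19 the bound \<open>C\<close> on the coefficients, 20 and 21 argument and value of a geometric sum,
  22 and 23 the Euler products, 30 is \<open>M!\<close>.

  \<open>log_prog\<close> squares \<open>n\<close> repeatedly; each squaring doubles the rounded logarithm or makes it one more
  than the double.
\<close>

definition log_incr :: prog where
  "log_incr = (asg 7 (Var 7 \<^bold>+ Var 7) ;; asg 8 (Var 8 \<^bold>+ Lit 1) ;; asg 9 (Var 9 \<^bold>* Var 4))"

definition log_prog :: prog where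
  "log_prog = (asg 6 (Var 5) ;; asg 7 (Lit 1) ;; asg 8 (Lit 0) ;; asg 9 (Lit 1) ;;
     loop (Var 7 \<^bold>+ Var 7 \<^bold>< Var 6 \<^bold>+ Lit 1) log_incr ;;
     asg 10 (Lit 0) ;;
     loop (Var 10 \<^bold>< Var 2)
       (asg 6 (Var 6 \<^bold>* Var 6) ;; asg 7 (Var 7 \<^bold>* Var 7) ;; asg 8 (Var 8 \<^bold>+ Var 8) ;; asg 9 (Var 9 \<^bold>* Var 9) ;;
        cond (Var 7 \<^bold>+ Var 7 \<^bold>< Var 6 \<^bold>+ Lit 1) log_incr Skip ;; asg 10 (Var 10 \<^bold>+ Lit 1)))"

lemma mods_log_prog [simp]: "mods log_prog = {6, 7, 8, 9, 10}"
  by (auto simp: log_prog_def log_incr_def)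

text \<open>Squaring the bracket \<open>2 ^ e <= v < 2 ^ Suc e\<close> confines \<open>v ^ 2\<close>
  to two consecutive binary intervals, and one comparison decides between them.\<close>

lemma elog_double:
  assumes "n > 0"
  shows "elog (2 ^ Suc k) n = (if 2 * 2 ^ (2 * elog (2 ^ k) n) \<le> (n ^ 2 ^ Suc k :: nat)
    then 2 * elog (2 ^ k) n + 1 else 2 * elog (2 ^ k) n)"
proof -
  define e where "e = elog (2 ^ k) n"
  have sq: "n ^ 2 ^ Suc k = (n ^ 2 ^ k) ^ 2" by (simp only: power_Suc power_even_eq)
  have "2 ^ e \<le> n ^ 2 ^ k" "n ^ 2 ^ k < 2 ^ Suc e"
    unfolding e_def using elog_le elog_less assms by blast+
  then have "(2 ^ e) ^ 2 \<le> (n ^ 2 ^ k) ^ 2" "(n ^ 2 ^ k) ^ 2 < (2 ^ Suc e) ^ 2"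
    by (auto intro: power_mono power_strict_mono simp del: power_Suc)
  then have "2 ^ (2 * e) \<le> n ^ 2 ^ Suc k" "n ^ 2 ^ Suc k < 2 ^ Suc (Suc (2 * e))"
    unfolding sq by (simp_all add: power_mult[symmetric] mult.commute flip: power_Suc)
  then show ?thesis unfolding e_def[symmetric]
    using elog_unique[OF assms, of "2 * e" "2 ^ Suc k"] elog_unique[OF assms, of "Suc (2 * e)" "2 ^ Suc k"]
    by (auto simp: not_le)
qed

lemma log_prog_correct:
  assumes n: "n > 0" "n < 2 ^ B"
  shows "ht (\<lambda>\<sigma>. \<sigma> 5 = int n \<and> \<sigma> 2 = int l \<and> \<sigma> 4 = H) log_prog (1000 * (B + l + 1))
    (\<lambda>\<sigma>. \<sigma> 8 = int (elog (2 ^ l) n) \<and> \<sigma> 9 = H ^ elog (2 ^ l) n)"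
proof -
  define t where "t = elog 1 n"
  have t: "2 ^ t \<le> n" "n < 2 ^ Suc t" using elog_le[OF n(1), of 1] elog_less[OF n(1), of 1] by (auto simp: t_def)
  have tB: "t \<le> B"
  proof (rule ccontr)
    assume "\<not> t \<le> B"
    then have "(2::nat) ^ B \<le> 2 ^ t" by simp
    then show False using t n by linarith
  qed
  \<comment> \<open>Variables 7 and 9 carry the powers of 2 and of \<open>H\<close> in parallel with
    the exponent in 8, so that neither power is ever recomputed.\<close>
  define I where "I = (\<lambda>k (\<sigma> :: nat \<Rightarrow> int). \<sigma> 6 = int n \<and> \<sigma> 7 = 2 ^ k \<and> \<sigma> 8 = int k \<and> \<sigma> 9 = H ^ k \<and> \<sigma> 4 = H \<and> \<sigma> 2 = int l)"
  define E where "E = (\<lambda>k. elog (2 ^ k) n)"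
  define J where "J = (\<lambda>k (\<sigma> :: nat \<Rightarrow> int). \<sigma> 6 = int (n ^ 2 ^ k) \<and> \<sigma> 7 = 2 ^ E k \<and> \<sigma> 8 = int (E k) \<and> \<sigma> 9 = H ^ E k \<and>
    \<sigma> 4 = H \<and> \<sigma> 2 = int l \<and> \<sigma> 10 = int k)"
  \<comment> \<open>The only order test of the language is strict, hence the comparison with
    \<open>m + 1\<close>.\<close>
  have le_iff: "2 * 2 ^ k < int m + 1 \<longleftrightarrow> 2 * 2 ^ k \<le> m" for k m
  proof -
    have "2 * 2 ^ k < int m + 1 \<longleftrightarrow> int (2 * 2 ^ k) \<le> int m" by simp
    then show ?thesis by (simp only: of_nat_le_iff)
  qed
  have L1: "ht (I 0) (loop (Var 7 \<^bold>+ Var 7 \<^bold>< Var 6 \<^bold>+ Lit 1) log_incr) (t * (20 + 10) + 10) (I t)"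
  proof (rule ht_pre[OF ht_loop])
    fix k assume "k < t"
    show "ht (I k) log_incr 20 (I (Suc k))" unfolding log_incr_def
      by (rule ht_pre, (rule ht_seq ht_asg)+) (auto simp: I_def)
  next
    fix k \<sigma> assume "k \<le> t" and \<sigma>: "I k \<sigma>"
    have "2 ^ Suc k \<le> n \<longleftrightarrow> k < t"
    proof
      assume "k < t"
      then have "(2::nat) ^ Suc k \<le> 2 ^ t" by (intro power_increasing) auto
      then show "2 ^ Suc k \<le> n" using t by linarith
    next
      assume "2 ^ Suc k \<le> n"
      then have "(2::nat) ^ Suc k < 2 ^ Suc t" using t by linarith
      then show "k < t" by simp
    qed
    then show "val (Var 7 \<^bold>+ Var 7 \<^bold>< Var 6 \<^bold>+ Lit 1) \<sigma> \<noteq> 0 \<longleftrightarrow> k < t"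
      using \<sigma> le_iff[of k n] by (simp add: I_def)
  qed auto
  have body: "ht (J k) (asg 6 (Var 6 \<^bold>* Var 6) ;; asg 7 (Var 7 \<^bold>* Var 7) ;; asg 8 (Var 8 \<^bold>+ Var 8) ;; asg 9 (Var 9 \<^bold>* Var 9) ;;
        cond (Var 7 \<^bold>+ Var 7 \<^bold>< Var 6 \<^bold>+ Lit 1) log_incr Skip ;; asg 10 (Var 10 \<^bold>+ Lit 1)) 80 (J (Suc k))" for k
  proof -
    have ed: "E (Suc k) = (if 2 * 2 ^ (2 * E k) \<le> n ^ 2 ^ Suc k then 2 * E k + 1 else 2 * E k)"
      using elog_double[OF n(1)] by (simp add: E_def)
    have pw: "int n ^ 2 ^ k * int n ^ 2 ^ k = int n ^ 2 ^ Suc k"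
      by (simp flip: power_add mult_2)
    have db: "a ^ E k * a ^ E k = a ^ (2 * E k)" for a :: int
      by (simp flip: power_add mult_2)
    show ?thesis unfolding log_incr_def
      by (rule ht_pre, (rule ht_seq ht_asg ht_cond ht_skip)+,
        use le_iff[of "2 * E k" "n ^ 2 ^ Suc k"] in
          \<open>auto simp: J_def ed db pw simp del: power_Suc; simp add: mult.commute\<close>) simp
  qed
  have L2: "ht (J 0) (loop (Var 10 \<^bold>< Var 2)
       (asg 6 (Var 6 \<^bold>* Var 6) ;; asg 7 (Var 7 \<^bold>* Var 7) ;; asg 8 (Var 8 \<^bold>+ Var 8) ;; asg 9 (Var 9 \<^bold>* Var 9) ;;
        cond (Var 7 \<^bold>+ Var 7 \<^bold>< Var 6 \<^bold>+ Lit 1) log_incr Skip ;; asg 10 (Var 10 \<^bold>+ Lit 1))) (l * (80 + 10) + 10) (J l)"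
    by (rule ht_pre[OF ht_loop[where I = J, OF body]]) (auto simp: J_def)
  have 1: "ht (I t) (asg 10 (Lit 0)) 10 (J 0)"
    by (rule ht_pre[OF ht_asg]) (auto simp: I_def J_def E_def t_def)
  have 0: "ht (\<lambda>\<sigma>. \<sigma> 5 = int n \<and> \<sigma> 2 = int l \<and> \<sigma> 4 = H)
      (asg 6 (Var 5) ;; asg 7 (Lit 1) ;; asg 8 (Lit 0) ;; asg 9 (Lit 1)) 100 (I 0)"
    by (rule ht_pre, (rule ht_seq ht_asg)+) (auto simp: I_def)
  show ?thesis unfolding log_prog_def
    apply (rule ht_conseq[where Q = "J l"])
    apply (rule ht_seq)+
    apply (rule L2)
    apply (rule 1)
    apply (rule L1)
    apply (rule ht_asg)+
    using tB by (auto simp: I_def J_def E_def)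
qed

end

section \<open>Computing the approximate parameter\<close>

text \<open>\<open>y_approx x\<close> is the cube root of \<open>x\<close> times
  \<open>N ^ 3 * E / D ^ 4\<close>. Cubing removes the root and leaves an inequality between
  integers, with \<open>D ^ 12\<close> from the denominator and 1000000 from the scale 100. This is
  the loop test of \<open>approx_prog\<close>.\<close>

lemma y_approx_floor_iff:
  assumes "num_of x > 0" "den_of x > 0" "lnln_of x > 0"
  shows "(int k + 1) ^ 3 * int (den_of x) ^ 12
      < 1000000 * int x * int (num_of x) ^ 9 * lnln_of x ^ 3 + 1 \<longleftrightarrow> k < nat \<lfloor>100 * y_approx x\<rfloor>"
proof -
  define N D E where "N = real (num_of x)" and "D = real (den_of x)" and "E = real_of_int (lnln_of x)"
  have D: "D > 0" and N: "N > 0" and E: "E > 0" using assms by (auto simp: D_def N_def E_def)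
  have y0: "y_approx x \<ge> 0"
    unfolding y_approx_def N_def[symmetric] D_def[symmetric] E_def[symmetric] using D N E by simp
  have "(real x powr (1/3)) ^ 3 = real x" by (cases "x = 0") (auto simp: powr_power)
  then have y3: "y_approx x ^ 3 * D ^ 12 = real x * N ^ 9 * E ^ 3"
    unfolding y_approx_def N_def[symmetric] D_def[symmetric] E_def[symmetric]
    using D by (simp add: power_mult_distrib power_divide flip: power_mult power_add)
  have "k < nat \<lfloor>100 * y_approx x\<rfloor> \<longleftrightarrow> int k + 1 \<le> \<lfloor>100 * y_approx x\<rfloor>" by linarith
  also have "\<dots> \<longleftrightarrow> real k + 1 \<le> 100 * y_approx x" by (simp add: le_floor_iff)
  also have "\<dots> \<longleftrightarrow> (real k + 1) ^ 3 \<le> (100 * y_approx x) ^ 3"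
    using y0 by (subst power_mono_iff) auto
  also have "\<dots> \<longleftrightarrow> (real k + 1) ^ 3 * D ^ 12 \<le> (100 * y_approx x) ^ 3 * D ^ 12"
    using D by simp
  also have "(100 * y_approx x) ^ 3 * D ^ 12 = 1000000 * real x * N ^ 9 * E ^ 3"
    using y3 by (simp add: power_mult_distrib)
  also have "(real k + 1) ^ 3 * D ^ 12 \<le> 1000000 * real x * N ^ 9 * E ^ 3 \<longleftrightarrow>
      (int k + 1) ^ 3 * int (den_of x) ^ 12 \<le> 1000000 * int x * int (num_of x) ^ 9 * lnln_of x ^ 3"
    unfolding N_def D_def E_def by (subst of_int_le_iff[where 'a = real, symmetric]) simp
  finally show ?thesis by linarith
qed

lemma elog_le_mult: "n > 0 \<Longrightarrow> elog L n \<le> L * n"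
proof -
  assume n: "n > 0"
  have "(2::nat) ^ elog L n \<le> n ^ L" using elog_le[OF n] .
  also have "\<dots> \<le> (2 ^ n) ^ L" using less_exp[of n] by (intro power_mono) auto
  also have "\<dots> = 2 ^ (L * n)" by (simp add: mult.commute flip: power_mult)
  finally show ?thesis by simp
qed

text \<open>Covers the four numbers whose logarithms \<open>approx_prog\<close> takes, so that each
  logarithm costs O(ell x).\<close>

lemma approx_size:
  assumes "x > 0"
  shows "x < 2 ^ (3 * ell x)" "x + 1 < 2 ^ (3 * ell x)" "num_of x < 2 ^ (3 * ell x)" "den_of x < 2 ^ (3 * ell x)"
proof -
  define L where "L = (2::nat) ^ ell x"
  have x3: "x * (x * x) < L" using ell_less[of x] by (simp add: L_def power3_eq_cube)
  have "x * 1 \<le> x * x" using assms by (intro mult_le_mono) auto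
  then have x1: "x \<le> x * x" by simp
  have "x * (x * 1) \<le> x * (x * x)" using assms by (intro mult_le_mono) auto
  then have x2: "x * x < L" using x3 unfolding mult_1_right by linarith
  have xL: "x < L" using x1 x2 by linarith
  have L: "L \<ge> 2" using x2 x1 assms by linarith
  have P: "(2::nat) ^ (3 * ell x) = L * L * L"
    by (simp add: L_def mult.commute[of 3] power_mult power3_eq_cube)
  have LL: "L * L * 2 \<le> L * L * L" using L by (intro mult_le_mono) auto
  have L2: "L * 2 \<le> L * L" using L by (intro mult_le_mono) auto
  show "x < 2 ^ (3 * ell x)" "x + 1 < 2 ^ (3 * ell x)"
    unfolding P using x1 x2 L L2 LL by linarith+
  have "num_of x \<le> L * x" unfolding num_of_def L_def by (rule elog_le_mult[OF assms])
  also have "\<dots> \<le> L * L" using xL by (intro mult_le_mono) auto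
  finally show "num_of x < 2 ^ (3 * ell x)" unfolding P using L L2 LL by linarith
  have "den_of x \<le> x * elog L (x + 1)" unfolding den_of_def L_def by simp
  also have "\<dots> \<le> x * (L * (x + 1))" using elog_le_mult[of "x + 1" L] by (intro mult_le_mono) auto
  also have "\<dots> = L * (x * x) + L * x" by (simp add: algebra_simps)
  also have "\<dots> < L * L + L * L"
    using x2 xL L by (intro add_strict_mono mult_strict_left_mono) auto
  finally show "den_of x < 2 ^ (3 * ell x)" unfolding P using LL by linarith
qed

context machine begin

definition log_call :: "nat \<Rightarrow> lexp \<Rightarrow> prog" where
  "log_call v e = (asg 5 e ;; log_prog ;; asg v (Var 8))"

lemma mods_log_call [simp]: "mods (log_call v e) = {5, 6, 7, 8, 9, 10, v}"
  by (auto simp: log_call_def)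

lemma ht_log_call:
  assumes n: "n > 0" "n < 2 ^ B" and v: "v \<noteq> 9"
    and P: "\<And>\<sigma>. P \<sigma> \<Longrightarrow> val e \<sigma> = int n \<and> \<sigma> 2 = int l \<and> \<sigma> 4 = H"
    and Q: "\<And>\<sigma> \<sigma>'. P \<sigma> \<Longrightarrow> (\<And>j. j \<notin> {5, 6, 7, 8, 9, 10, v} \<Longrightarrow> \<sigma>' j = \<sigma> j) \<Longrightarrow>
      \<sigma>' v = int (elog (2 ^ l) n) \<Longrightarrow> \<sigma>' 9 = H ^ elog (2 ^ l) n \<Longrightarrow> Q \<sigma>'"
  shows "ht P (log_call v e) (1000 * (B + l + 1) + lcost e + 10) Q"
proof (rule ht_frame[where Q = "\<lambda>\<sigma>. \<sigma> v = int (elog (2 ^ l) n) \<and> \<sigma> 9 = H ^ elog (2 ^ l) n" and P = P])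
  show "ht P (log_call v e) (lcost e + 2 + (1000 * (B + l + 1) + 4))
      (\<lambda>\<sigma>. \<sigma> v = int (elog (2 ^ l) n) \<and> \<sigma> 9 = H ^ elog (2 ^ l) n)"
    unfolding log_call_def
  proof (rule ht_compose[OF _ ht_compose[OF log_prog_correct[OF n]]])
    show "ht P (asg 5 e) (lcost e + 2) (\<lambda>\<sigma>. \<sigma> 5 = int n \<and> \<sigma> 2 = int l \<and> \<sigma> 4 = H)"
      by (rule ht_pre[OF ht_asg]) (use P in auto)
    show "ht (\<lambda>\<sigma>. \<sigma> 8 = int (elog (2 ^ l) n) \<and> \<sigma> 9 = H ^ elog (2 ^ l) n) (asg v (Var 8)) 4
        (\<lambda>\<sigma>. \<sigma> v = int (elog (2 ^ l) n) \<and> \<sigma> 9 = H ^ elog (2 ^ l) n)"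
      by (rule ht_pre[OF ht_asg]) (use v in auto)
  qed
qed (use Q in auto)

definition ell_prog :: prog where
  "ell_prog = (asg 2 (Lit 0) ;; asg 3 (Lit 1) ;;
     loop (Var 3 \<^bold>< lpow (Var 1) 3 \<^bold>+ Lit 1) (asg 3 (Var 3 \<^bold>+ Var 3) ;; asg 2 (Var 2 \<^bold>+ Lit 1)))"

lemma ell_prog_correct:
  "ht (\<lambda>\<sigma>. \<sigma> 1 = int x) ell_prog (100 * (ell x + 1)) (\<lambda>\<sigma>. \<sigma> 2 = int (ell x))"
proof -
  define I where "I = (\<lambda>k (\<sigma> :: nat \<Rightarrow> int). \<sigma> 1 = int x \<and> \<sigma> 2 = int k \<and> \<sigma> 3 = 2 ^ k)"
  have "int (2 ^ k) < int (x ^ 3) + 1 \<longleftrightarrow> k < ell x" for k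
    using ell_iff[of x k] by linarith
  then have iff: "2 ^ k \<le> int x ^ 3 \<longleftrightarrow> k < ell x" for k by simp
  have "ht (I 0) (loop (Var 3 \<^bold>< lpow (Var 1) 3 \<^bold>+ Lit 1) (asg 3 (Var 3 \<^bold>+ Var 3) ;; asg 2 (Var 2 \<^bold>+ Lit 1)))
      (ell x * (20 + 20) + 20) (I (ell x))"
  proof (rule ht_pre[OF ht_loop])
    show "ht (I k) (asg 3 (Var 3 \<^bold>+ Var 3) ;; asg 2 (Var 2 \<^bold>+ Lit 1)) 20 (I (Suc k))" for k
      by (rule ht_pre, (rule ht_seq ht_asg)+) (auto simp: I_def)
  qed (auto simp: I_def iff)
  note loop = this
  show ?thesis unfolding ell_prog_def
    apply (rule ht_conseq)
       apply ((rule ht_seq)+, rule loop, (rule ht_asg)+)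
    by (auto simp: I_def)
qed

lemma mods_ell_prog [simp]: "mods ell_prog = {2, 3}"
  by (auto simp: ell_prog_def)

text \<open>Variable 4 is set to the base 1 because only logarithms are wanted here, not the powers
  that \<open>log_prog\<close> produces beside them. The last loop counts up to the integer part of
  \<open>100 * y_approx\<close>; this costs about \<open>y\<close> and stays within the
  bound.\<close>

definition approx_prog :: prog where
  "approx_prog = (asg 4 (Lit 1) ;; ell_prog ;; log_call 25 (Var 1) ;; log_call 26 (Var 1 \<^bold>+ Lit 1) ;;
     asg 26 (Var 1 \<^bold>* (Var 26 \<^bold>- Var 25)) ;; log_call 27 (Var 25) ;; log_call 29 (Var 26) ;;
     asg 27 (Var 27 \<^bold>- Var 29) ;; asg 28 (Lit 1000000 \<^bold>* Var 1 \<^bold>* lpow (Var 25) 9 \<^bold>* lpow (Var 27) 3) ;;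
     asg 24 (lpow (Var 26) 12) ;; asg 11 (Lit 0) ;;
     loop (lpow (Var 11 \<^bold>+ Lit 1) 3 \<^bold>* Var 24 \<^bold>< Var 28 \<^bold>+ Lit 1) (asg 11 (Var 11 \<^bold>+ Lit 1)))"

lemma mods_approx_prog [simp]:
  "mods approx_prog = {2, 3, 4, 5, 6, 7, 8, 9, 10, 11, 24, 25, 26, 27, 28, 29}"
  by (auto simp: approx_prog_def)

lemma approx_prog_correct:
  assumes x: "x > 0" "num_of x > 0" "den_of x > 0" "lnln_of x > 0"
  defines "K \<equiv> nat \<lfloor>100 * y_approx x\<rfloor>"
  shows "ht (\<lambda>\<sigma>. \<sigma> 1 = int x) approx_prog (20000 * (ell x + K + 1))
    (\<lambda>\<sigma>. \<sigma> 2 = int (ell x) \<and> \<sigma> 11 = int K)"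
proof -
  define l where "l = ell x"
  let ?B = "3 * l"
  let ?c = "1000 * (?B + l + 1) + 20"
  note size = approx_size[OF x(1), folded l_def]
  define P1 where "P1 = (\<lambda>\<sigma> :: nat \<Rightarrow> int. \<sigma> 1 = int x \<and> \<sigma> 4 = 1)"
  define P2 where "P2 = (\<lambda>\<sigma>. P1 \<sigma> \<and> \<sigma> 2 = int l)"
  define P3 where "P3 = (\<lambda>\<sigma>. P2 \<sigma> \<and> \<sigma> 25 = int (num_of x))"
  define P4 where "P4 = (\<lambda>\<sigma>. P3 \<sigma> \<and> \<sigma> 26 = int (elog (2 ^ l) (x + 1)))"
  define P5 where "P5 = (\<lambda>\<sigma>. P3 \<sigma> \<and> \<sigma> 26 = int (den_of x))"
  define P6 where "P6 = (\<lambda>\<sigma>. P5 \<sigma> \<and> \<sigma> 27 = int (elog (2 ^ l) (num_of x)))"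
  define P7 where "P7 = (\<lambda>\<sigma>. P6 \<sigma> \<and> \<sigma> 29 = int (elog (2 ^ l) (den_of x)))"
  define I where "I = (\<lambda>k (\<sigma> :: nat \<Rightarrow> int). \<sigma> 2 = int l \<and> \<sigma> 11 = int k \<and> \<sigma> 24 = int (den_of x) ^ 12 \<and>
     \<sigma> 28 = 1000000 * int x * int (num_of x) ^ 9 * lnln_of x ^ 3)"
  have num: "num_of x = elog (2 ^ l) x" by (simp add: num_of_def l_def)
  have den: "int (den_of x) = int x * (int (elog (2 ^ l) (x + 1)) - int (elog (2 ^ l) x))"
    using elog_mono[of x "x + 1" "2 ^ l"] x(1) by (simp add: den_of_def l_def of_nat_diff)
  have lnln: "lnln_of x = int (elog (2 ^ l) (num_of x)) - int (elog (2 ^ l) (den_of x))"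
    by (simp add: lnln_of_def l_def)
  have 1: "ht (\<lambda>\<sigma>. \<sigma> 1 = int x) (asg 4 (Lit 1)) 3 P1"
    by (rule ht_pre[OF ht_asg]) (auto simp: P1_def)
  have 2: "ht P1 ell_prog (100 * (l + 1)) P2"
    by (rule ht_frame[OF ell_prog_correct[of x, folded l_def]]) (auto simp: P1_def P2_def)
  have 3: "ht P2 (log_call 25 (Var 1)) ?c P3"
    by (rule ht_pre[OF ht_log_call[where P = P2 and Q = P3, OF x(1) size(1)]])
      (auto simp: P1_def P2_def P3_def num)
  have 4: "ht P3 (log_call 26 (Var 1 \<^bold>+ Lit 1)) ?c P4"
    by (rule ht_pre[OF ht_log_call[where P = P3 and Q = P4, OF _ size(2)]])
      (auto simp: P1_def P2_def P3_def P4_def num)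
  have 5: "ht P4 (asg 26 (Var 1 \<^bold>* (Var 26 \<^bold>- Var 25))) 20 P5"
    by (rule ht_pre[OF ht_asg]) (auto simp: P1_def P2_def P3_def P4_def P5_def den num)
  have 6: "ht P5 (log_call 27 (Var 25)) ?c P6"
    by (rule ht_pre[OF ht_log_call[where P = P5 and Q = P6, OF x(2) size(3)]])
      (auto simp: P1_def P2_def P3_def P5_def P6_def)
  have 7: "ht P6 (log_call 29 (Var 26)) ?c P7"
    by (rule ht_pre[OF ht_log_call[where P = P6 and Q = P7, OF x(3) size(4)]])
      (auto simp: P1_def P2_def P3_def P5_def P6_def P7_def)
  have loop: "ht (I 0) (loop (lpow (Var 11 \<^bold>+ Lit 1) 3 \<^bold>* Var 24 \<^bold>< Var 28 \<^bold>+ Lit 1) (asg 11 (Var 11 \<^bold>+ Lit 1)))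
      (K * (6 + 40) + 40) (I K)"
  proof (rule ht_pre[OF ht_loop])
    show "ht (I k) (asg 11 (Var 11 \<^bold>+ Lit 1)) 6 (I (Suc k))" for k
      by (rule ht_pre[OF ht_asg]) (auto simp: I_def)
    show "(val (lpow (Var 11 \<^bold>+ Lit 1) 3 \<^bold>* Var 24 \<^bold>< Var 28 \<^bold>+ Lit 1) \<sigma> \<noteq> 0) = (k < K)" if "I k \<sigma>" for k \<sigma>
      using that y_approx_floor_iff[OF x(2-4), of k] by (simp add: I_def K_def)
  qed auto
  have 8: "ht P7 (asg 27 (Var 27 \<^bold>- Var 29) ;; asg 28 (Lit 1000000 \<^bold>* Var 1 \<^bold>* lpow (Var 25) 9 \<^bold>* lpow (Var 27) 3) ;;
     asg 24 (lpow (Var 26) 12) ;; asg 11 (Lit 0) ;;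
     loop (lpow (Var 11 \<^bold>+ Lit 1) 3 \<^bold>* Var 24 \<^bold>< Var 28 \<^bold>+ Lit 1) (asg 11 (Var 11 \<^bold>+ Lit 1))) (1000 * (K + 1)) (I K)"
    apply (rule ht_pre)
      apply ((rule ht_seq)+, rule loop, (rule ht_asg)+)
     apply (auto simp: I_def P1_def P2_def P3_def P5_def P6_def P7_def lnln)
    done
  show ?thesis unfolding approx_prog_def
    by (rule ht_conseq[OF ht_compose[OF 1 ht_compose[OF 2 ht_compose[OF 3 ht_compose[OF 4 ht_compose[OF 5 ht_compose[OF 6 ht_compose[OF 7 8]]]]]]]])
      (auto simp: I_def l_def)
qed

end

section \<open>Primality tests by factorials\<close>

text \<open>For composite \<open>n = p * q\<close> both factors are below \<open>n\<close> but may
  coincide; squaring lets each take its own copy of the factorial, which makes 4 come out right. A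
  loop over \<open>n\<close> carries the factorial along, so the test costs O(1).\<close>

lemma fact_square_mod_iff_prime:
  assumes "n > 0"
  shows "(fact (n - 1) * fact (n - 1)) mod int n \<noteq> 0 \<longleftrightarrow> prime n"
proof -
  have "(fact (n - 1) * fact (n - 1)) mod int n = int ((fact (n - 1) * fact (n - 1)) mod n)"
    by (simp only: of_nat_mod of_nat_mult of_nat_fact)
  then have "(fact (n - 1) * fact (n - 1)) mod int n = 0 \<longleftrightarrow> n dvd fact (n - 1) * fact (n - 1)"
    by (simp only: of_nat_eq_0_iff mod_eq_0_iff_dvd)
  also have "\<dots> \<longleftrightarrow> \<not> prime n"
  proof
    assume dvd: "n dvd fact (n - 1) * fact (n - 1)"
    show "\<not> prime n"
    proof
      assume n: "prime n"
      then have "n dvd fact (n - 1)" using dvd prime_dvd_mult_iff by blast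
      then show False using prime_dvd_fact_iff[OF n, of "n - 1"] assms by linarith
    qed
  next
    assume np: "\<not> prime n"
    show "n dvd fact (n - 1) * fact (n - 1)"
    proof (cases "n = 1")
      case False
      then obtain p where p: "prime p" "p dvd n" using prime_factor_nat by blast
      then obtain q where q: "n = p * q" by blast
      have "q \<noteq> 1" "q \<noteq> 0" using q np p(1) assms by auto
      moreover have "p > 1" using prime_gt_1_nat[OF p(1)] .
      ultimately have "p < n" "q < n" unfolding q by auto
      then have "p dvd fact (n - 1)" "q dvd fact (n - 1)"
        using \<open>p > 1\<close> \<open>q \<noteq> 0\<close> by (intro dvd_fact; linarith)+
      then have "p * q dvd fact (n - 1) * fact (n - 1)" by (rule mult_dvd_mono)
      then show ?thesis using q by simp
    qed simp
  qed
  finally show ?thesis by simp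
qed

lemma small_prime_factor:
  fixes n :: nat
  assumes "\<not> prime n" "n > 1"
  shows "\<exists>p. prime p \<and> p dvd n \<and> p ^ 2 \<le> n"
proof -
  obtain p where p: "prime p" "p dvd n" using prime_factor_nat assms by (metis less_irrefl)
  then obtain q where q: "n = p * q" by blast
  show ?thesis
  proof (cases "p \<le> q")
    case True
    then have "p ^ 2 \<le> n" unfolding power2_eq_square q by (intro mult_le_mono) auto
    with p show ?thesis by blast
  next
    case False
    have "q \<noteq> 1" "q \<noteq> 0" using q assms p(1) by auto
    then obtain r where r: "prime r" "r dvd q" using prime_factor_nat by blast
    then have "r \<le> q" using \<open>q \<noteq> 0\<close> by (intro dvd_imp_le) auto
    then have "r ^ 2 \<le> n" unfolding power2_eq_square q using False by (intro mult_le_mono) auto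
    with r q show ?thesis by (meson dvd_mult)
  qed
qed

text \<open>The base \<open>M!\<close> has a common factor with every composite \<open>n\<close>, so the Fermat test has no
  pseudoprimes here, and \<open>(M!) ^ n\<close> is updated by one multiplication per \<open>n\<close>.\<close>

lemma power_mod_iff_prime:
  assumes "n > M" "n < (M + 1) ^ 2" "n > 1"
  shows "fact M ^ (n - 1) mod int n = 1 \<longleftrightarrow> prime n"
proof -
  have "fact M ^ (n - 1) mod int n = int (fact M ^ (n - 1) mod n)"
    by (simp only: of_nat_mod of_nat_power of_nat_fact)
  then have "fact M ^ (n - 1) mod int n = 1 \<longleftrightarrow> fact M ^ (n - 1) mod n = 1"
    by (simp only: of_nat_eq_1_iff)
  also have "\<dots> \<longleftrightarrow> prime n"
  proof
    assume n: "prime n"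
    moreover have "\<not> n dvd fact M" using prime_dvd_fact_iff[OF n, of M] assms by simp
    ultimately have "[fact M ^ (n - 1) = 1] (mod n)" by (rule fermat_theorem)
    then show "(fact M ^ (n - 1)) mod n = 1" using assms unfolding unique_euclidean_semiring_class.cong_def by simp
  next
    assume *: "fact M ^ (n - 1) mod n = 1"
    show "prime n"
    proof (rule ccontr)
      assume "\<not> prime n"
      then obtain p where p: "prime p" "p dvd n" "p ^ 2 \<le> n"
        using small_prime_factor assms(3) by blast
      have "p \<le> M"
      proof (rule ccontr)
        assume "\<not> p \<le> M"
        then have "(M + 1) ^ 2 \<le> p ^ 2" by (intro power_mono) auto
        then show False using p(3) assms(2) by linarith
      qed
      then have "p dvd fact M" using p(1) prime_dvd_fact_iff by blast
      moreover have "fact M dvd (fact M ^ (n - 1) :: nat)" using assms by (intro dvd_power) auto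
      ultimately have "p dvd fact M ^ (n - 1)" by (rule dvd_trans)
      then have "p dvd fact M ^ (n - 1) mod n" using p(2) by (rule dvd_mod)
      then show False using * p(1) by simp
    qed
  qed
  finally show ?thesis .
qed

section \<open>The smooth part and the window on the machine\<close>

locale function_machine = machine prim b + cmult f for prim b and f :: "nat \<Rightarrow> int" +
  fixes cf :: prog and Tf :: nat
  assumes cf: "n > 0 \<Longrightarrow> computes_within prim cf [int n] (f n) Tf" and stores_cf: "stores cf \<subseteq> {..<b}"
begin

lemma ht_call_f:
  "ht (\<lambda>\<sigma>. \<exists>n > 0. val e \<sigma> = int n \<and> Q (\<sigma>(r := f n))) (call1 cf r e) (Tf + lcost e + 6) Q"
  unfolding ht_def
proof (intro allI impI)
  fix s assume "\<exists>n > 0. val e (vars s) = int n \<and> Q ((vars s)(r := f n))"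
  then obtain n where n: "n > 0" "val e (vars s) = int n" "Q ((vars s)(r := f n))" by blast
  with ht_call1[OF cf[OF n(1)] stores_cf, of e Q r]
  show "\<exists>m s'. m \<le> Tf + lcost e + 6 \<and> exec prim (call1 cf r e) s m s' \<and> Q (vars s')"
    unfolding ht_def by blast
qed

definition pf_prog :: prog where
  "pf_prog = (cond ((Var 16 \<^bold>* Var 16) \<^bold>% (Var 15)) (call1 cf 17 (Var 15)) (asg 17 (Lit 0)) ;;
     asg 16 (Var 16 \<^bold>* Var 15))"

lemma mods_pf_prog [simp]: "mods pf_prog = {16, 17}"
  using stores_cf by (auto simp: pf_prog_def)

lemma pf_prog_correct:
  assumes "n > 0"
  shows "ht (\<lambda>\<sigma>. \<sigma> 15 = int n \<and> \<sigma> 16 = fact (n - 1)) pf_prog (Tf + 40)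
    (\<lambda>\<sigma>. \<sigma> 17 = pf f n \<and> \<sigma> 16 = fact n)"
proof -
  have fa: "fact (n - 1) * int n = fact n" using assms by (simp add: fact_reduce mult.commute)
  show ?thesis unfolding pf_prog_def
    by (rule ht_pre, (rule ht_seq ht_asg ht_cond ht_call_f)+)
      (use assms fa fact_square_mod_iff_prime[OF assms] in \<open>auto simp: pf_def\<close>)
qed

definition geom_prog :: prog where
  "geom_prog = (asg 21 (Lit 1) ;; asg 10 (Lit 0) ;;
     loop (Var 10 \<^bold>< Var 2) (asg 21 (Var 21 \<^bold>* Var 20 \<^bold>+ Lit 1) ;; asg 10 (Var 10 \<^bold>+ Lit 1)))"

lemma mods_geom_prog [simp]: "mods geom_prog = {10, 21}"
  by (auto simp: geom_prog_def)

lemma geom_prog_correct: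
  "ht (\<lambda>\<sigma>. \<sigma> 20 = G \<and> \<sigma> 2 = int l) geom_prog (100 * (l + 1)) (\<lambda>\<sigma>. \<sigma> 21 = (\<Sum>k\<le>l. G ^ k))"
proof -
  define I where "I = (\<lambda>k (\<sigma> :: nat \<Rightarrow> int). \<sigma> 20 = G \<and> \<sigma> 2 = int l \<and> \<sigma> 10 = int k \<and> \<sigma> 21 = (\<Sum>i\<le>k. G ^ i))"
  have step: "(\<Sum>i\<le>k. G ^ i) * G + 1 = (\<Sum>i\<le>Suc k. G ^ i)" for k
    by (subst sum.atMost_Suc_shift) (simp add: sum_distrib_left mult.commute)
  have loop: "ht (I 0) (loop (Var 10 \<^bold>< Var 2) (asg 21 (Var 21 \<^bold>* Var 20 \<^bold>+ Lit 1) ;; asg 10 (Var 10 \<^bold>+ Lit 1)))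
      (l * (30 + 10) + 10) (I l)"
  proof (rule ht_pre[OF ht_loop])
    show "ht (I k) (asg 21 (Var 21 \<^bold>* Var 20 \<^bold>+ Lit 1) ;; asg 10 (Var 10 \<^bold>+ Lit 1)) 30 (I (Suc k))" for k
      by (rule ht_pre, (rule ht_seq ht_asg)+) (auto simp: I_def step simp del: sum.atMost_Suc)
  qed (auto simp: I_def)
  show ?thesis unfolding geom_prog_def
    apply (rule ht_conseq)
       apply ((rule ht_seq)+, rule loop, (rule ht_asg)+)
    by (auto simp: I_def)
qed

definition bound_body :: prog where
  "bound_body = (pf_prog ;;
     (asg 18 (Var 18 \<^bold>+ Var 17) ;; asg 20 (Var 17) ;; cond (Var 20 \<^bold>< Lit 0) (asg 20 (Lit 0 \<^bold>- Var 20)) Skip) ;;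
     geom_prog ;; (asg 19 (Var 19 \<^bold>* Var 21) ;; asg 15 (Var 15 \<^bold>+ Lit 1)))"

text \<open>A pass of its own: \<open>H\<close> depends on the values of \<open>f\<close> at all
  primes up to \<open>M\<close> and must be known before anything is packed.\<close>

definition bound_prog :: prog where
  "bound_prog = (asg 15 (Lit 1) ;; asg 16 (Lit 1) ;; asg 18 (Lit 0) ;; asg 19 (Lit 1) ;;
     loop (Var 15 \<^bold>< Var 14 \<^bold>+ Lit 1) bound_body)"

lemma mods_bound_prog [simp]: "mods bound_prog = {10, 15, 16, 17, 18, 19, 20, 21}"
  by (auto simp: bound_prog_def bound_body_def)

lemma bound_prog_correct:
  "ht (\<lambda>\<sigma>. \<sigma> 14 = int M \<and> \<sigma> 2 = int l) bound_prog ((Tf + 300) * (M + 1) * (l + 1))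
    (\<lambda>\<sigma>. \<sigma> 16 = fact M \<and> \<sigma> 18 = (\<Sum>n=1..M. pf f n) \<and> \<sigma> 19 = (\<Prod>n=1..M. \<Sum>k\<le>l. \<bar>pf f n\<bar> ^ k))"
proof -
  define J where "J = (\<lambda>k (\<sigma> :: nat \<Rightarrow> int). \<sigma> 14 = int M \<and> \<sigma> 2 = int l \<and> \<sigma> 15 = int k + 1 \<and>
     \<sigma> 18 = (\<Sum>n=1..k. pf f n) \<and> \<sigma> 19 = (\<Prod>n=1..k. \<Sum>i\<le>l. \<bar>pf f n\<bar> ^ i))"
  define I where "I = (\<lambda>k \<sigma>. J k \<sigma> \<and> \<sigma> 16 = fact k)"
  define I1 where "I1 = (\<lambda>k \<sigma>. J k \<sigma> \<and> \<sigma> 16 = fact (Suc k) \<and> \<sigma> 17 = pf f (Suc k))"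
  define I2 where "I2 = (\<lambda>k (\<sigma> :: nat \<Rightarrow> int). \<sigma> 14 = int M \<and> \<sigma> 2 = int l \<and> \<sigma> 15 = int k + 1 \<and>
     \<sigma> 18 = (\<Sum>n=1..Suc k. pf f n) \<and> \<sigma> 19 = (\<Prod>n=1..k. \<Sum>i\<le>l. \<bar>pf f n\<bar> ^ i) \<and>
     \<sigma> 16 = fact (Suc k) \<and> \<sigma> 20 = \<bar>pf f (Suc k)\<bar>)"
  define I3 where "I3 = (\<lambda>k \<sigma>. I2 k \<sigma> \<and> \<sigma> 21 = (\<Sum>i\<le>l. \<bar>pf f (Suc k)\<bar> ^ i))"
  have b1: "ht (I k) pf_prog (Tf + 40) (I1 k)" for k
    by (rule ht_frame[OF pf_prog_correct[of "Suc k"]]) (auto simp: I_def I1_def J_def)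
  have b2: "ht (I1 k) (asg 18 (Var 18 \<^bold>+ Var 17) ;; asg 20 (Var 17) ;;
     cond (Var 20 \<^bold>< Lit 0) (asg 20 (Lit 0 \<^bold>- Var 20)) Skip) 40 (I2 k)" for k
    by (rule ht_pre, (rule ht_seq ht_asg ht_cond ht_skip)+) (auto simp: I1_def I2_def J_def)
  have b3: "ht (I2 k) geom_prog (100 * (l + 1)) (I3 k)" for k
    by (rule ht_frame[OF geom_prog_correct[of "\<bar>pf f (Suc k)\<bar>" l]]) (auto simp: I3_def I2_def)
  have b4: "ht (I3 k) (asg 19 (Var 19 \<^bold>* Var 21) ;; asg 15 (Var 15 \<^bold>+ Lit 1)) 20 (I (Suc k))" for k
    by (rule ht_pre, (rule ht_seq ht_asg)+) (auto simp: I_def I3_def I2_def J_def)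
  have body: "ht (I k) bound_body (Tf + 120 + 100 * (l + 1)) (I (Suc k))" for k
    unfolding bound_body_def
    by (rule ht_pre[OF ht_compose[OF b1 ht_compose[OF b2 ht_compose[OF b3 b4]]]]) auto
  have loop: "ht (I 0) (loop (Var 15 \<^bold>< Var 14 \<^bold>+ Lit 1) bound_body) (M * (Tf + 120 + 100 * (l + 1) + 7) + 7) (I M)"
    by (rule ht_pre[OF ht_loop[where I = I, OF body]]) (auto simp: I_def J_def)
  have "ht (\<lambda>\<sigma>. \<sigma> 14 = int M \<and> \<sigma> 2 = int l) bound_prog (100 + M * (Tf + 120 + 100 * (l + 1) + 7)) (I M)"
    unfolding bound_prog_def
    apply (rule ht_pre)
      apply ((rule ht_seq)+, rule loop, (rule ht_asg)+)
     apply (auto simp: I_def J_def)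
    done
  moreover have "100 + M * (Tf + 120 + 100 * (l + 1) + 7) \<le> (Tf + 300) * (M + 1) * (l + 1)"
    by (simp add: algebra_simps)
  ultimately show ?thesis
    by (elim ht_conseq) (auto simp: I_def J_def)
qed


text \<open>\<open>log_call 8\<close> copies variable 8 to itself; only the power of
  \<open>H\<close> in variable 9 is wanted.\<close>

definition poly_body :: prog where
  "poly_body = (pf_prog ;; log_call 8 (Var 15) ;; asg 20 (Var 17 \<^bold>* Var 9) ;; geom_prog ;;
     (asg 22 (Var 22 \<^bold>* (Lit 1 \<^bold>- Var 20)) ;; asg 23 (Var 23 \<^bold>* Var 21) ;; asg 15 (Var 15 \<^bold>+ Lit 1)))"

definition poly_prog :: prog where
  "poly_prog = (asg 15 (Lit 1) ;; asg 16 (Lit 1) ;; asg 22 (Lit 1) ;; asg 23 (Lit 1) ;;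
     loop (Var 15 \<^bold>< Var 14 \<^bold>+ Lit 1) poly_body)"

lemma mods_poly_prog [simp]: "mods poly_prog = {5, 6, 7, 8, 9, 10, 15, 16, 17, 20, 21, 22, 23}"
  by (auto simp: poly_prog_def poly_body_def)

lemma poly_prog_correct:
  assumes "M < 2 ^ l"
  shows "ht (\<lambda>\<sigma>. \<sigma> 14 = int M \<and> \<sigma> 2 = int l \<and> \<sigma> 4 = H) poly_prog ((Tf + 5000) * (M + 1) * (l + 1))
    (\<lambda>\<sigma>. \<sigma> 22 = (\<Prod>n=1..M. 1 - pf f n * H ^ elog (2 ^ l) n) \<and>
      \<sigma> 23 = (\<Prod>n=1..M. \<Sum>k\<le>l. (pf f n * H ^ elog (2 ^ l) n) ^ k))"
proof -
  let ?L = "2 ^ l :: nat"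
  let ?G = "\<lambda>n. pf f n * H ^ elog ?L n"
  define J where "J = (\<lambda>k (\<sigma> :: nat \<Rightarrow> int). \<sigma> 14 = int M \<and> \<sigma> 2 = int l \<and> \<sigma> 4 = H \<and> \<sigma> 15 = int k + 1 \<and>
     \<sigma> 22 = (\<Prod>n=1..k. 1 - ?G n) \<and> \<sigma> 23 = (\<Prod>n=1..k. \<Sum>i\<le>l. ?G n ^ i))"
  define I where "I = (\<lambda>k \<sigma>. J k \<sigma> \<and> \<sigma> 16 = fact k)"
  define I1 where "I1 = (\<lambda>k \<sigma>. J k \<sigma> \<and> \<sigma> 16 = fact (Suc k) \<and> \<sigma> 17 = pf f (Suc k))"
  define I2 where "I2 = (\<lambda>k \<sigma>. I1 k \<sigma> \<and> \<sigma> 9 = H ^ elog ?L (Suc k))"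
  define I3 where "I3 = (\<lambda>k \<sigma>. I1 k \<sigma> \<and> \<sigma> 20 = ?G (Suc k))"
  define I4 where "I4 = (\<lambda>k \<sigma>. I3 k \<sigma> \<and> \<sigma> 21 = (\<Sum>i\<le>l. ?G (Suc k) ^ i))"
  have b1: "ht (I k) pf_prog (Tf + 40) (I1 k)" for k
    by (rule ht_frame[OF pf_prog_correct[of "Suc k"]]) (auto simp: I_def I1_def J_def)
  have b2: "ht (I1 k) (log_call 8 (Var 15)) (1000 * (l + l + 1) + 20) (I2 k)" if "k < M" for k
  proof (rule ht_pre[OF ht_log_call[where P = "I1 k" and Q = "I2 k" and n = "Suc k" and B = l and l = l and H = H]])
    show "Suc k < 2 ^ l" using that assms by simp
  qed (auto simp: I2_def I1_def J_def)
  have b3: "ht (I2 k) (asg 20 (Var 17 \<^bold>* Var 9)) 10 (I3 k)" for k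
    by (rule ht_pre[OF ht_asg]) (auto simp: I1_def I2_def I3_def J_def)
  have b4: "ht (I3 k) geom_prog (100 * (l + 1)) (I4 k)" for k
    by (rule ht_frame[OF geom_prog_correct[of "?G (Suc k)" l]]) (auto simp: I4_def I3_def I1_def J_def)
  have b5: "ht (I4 k) (asg 22 (Var 22 \<^bold>* (Lit 1 \<^bold>- Var 20)) ;; asg 23 (Var 23 \<^bold>* Var 21) ;; asg 15 (Var 15 \<^bold>+ Lit 1)) 30
      (I (Suc k))" for k
    by (rule ht_pre, (rule ht_seq ht_asg)+) (auto simp: I_def I4_def I3_def I1_def J_def)
  define m where "m = Tf + 40 + (1000 * (l + l + 1) + 20 + (10 + (100 * (l + 1) + 30)))"
  have body: "ht (I k) poly_body m (I (Suc k))" if "k < M" for k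
    unfolding poly_body_def m_def
    by (rule ht_compose[OF b1 ht_compose[OF b2[OF that] ht_compose[OF b3 ht_compose[OF b4 b5]]]])
  have loop: "ht (I 0) (loop (Var 15 \<^bold>< Var 14 \<^bold>+ Lit 1) poly_body) (M * (m + 7) + 7) (I M)"
    by (rule ht_pre[OF ht_loop[where I = I, OF body]]) (auto simp: I_def J_def)
  have "ht (\<lambda>\<sigma>. \<sigma> 14 = int M \<and> \<sigma> 2 = int l \<and> \<sigma> 4 = H) poly_prog (100 + M * (m + 7)) (I M)"
    unfolding poly_prog_def
    apply (rule ht_pre)
      apply ((rule ht_seq)+, rule loop, (rule ht_asg)+)
     apply (auto simp: I_def J_def)
    done
  moreover have "100 + M * (m + 7) \<le> (Tf + 5000) * (M + 1) * (l + 1)"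
    by (simp add: m_def algebra_simps)
  ultimately show ?thesis
    by (elim ht_conseq) (auto simp: I_def J_def)
qed

definition lbal :: "lexp \<Rightarrow> lexp \<Rightarrow> lexp" where
  "lbal a m = (a \<^bold>+ m \<^bold>/ Lit 2) \<^bold>% m \<^bold>- m \<^bold>/ Lit 2"

lemma val_lbal [simp]: "val (lbal a m) \<sigma> = bal (val a \<sigma>) (val m \<sigma>)"
  by (simp add: lbal_def bal_def)

lemma lcost_lbal [simp]: "lcost (lbal a m) = lcost a + 3 * lcost m + 7"
  by (simp add: lbal_def)

text \<open>The factorial is saved in variable 30 before \<open>poly_prog\<close> overwrites
  variable 16. Multiplying variable 9 by \<open>H\<close> raises the exponent to
  \<open>Suc (elog L n)\<close>, so that the residue keeps exponents up to
  \<open>elog L n\<close>.\<close>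

definition smooth_prog :: prog where
  "smooth_prog = (bound_prog ;; (asg 30 (Var 16) ;; asg 4 (Lit 4 \<^bold>* Var 19 \<^bold>* Var 19 \<^bold>+ Lit 3)) ;; poly_prog ;;
     log_call 8 (Var 12) ;; (asg 24 (Var 9 \<^bold>* Var 4) ;; asg 22 (lbal (Var 22) (Var 24) \<^bold>* Var 23)) ;;
     log_call 8 (Var 1) ;; (asg 24 (Var 9 \<^bold>* Var 4) ;; asg 22 (lbal (Var 22) (Var 24)) ;;
     asg 24 (Var 4 \<^bold>- Lit 1) ;; asg 22 (lbal (Var 22) (Var 24))))"

lemma mods_smooth_prog [simp]:
  "mods smooth_prog = {4, 5, 6, 7, 8, 9, 10, 15, 16, 17, 18, 19, 20, 21, 22, 23, 24, 30}"
  by (auto simp: smooth_prog_def)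

lemma smooth_prog_correct:
  assumes y: "0 < y" "y \<le> M" "M < X" and l: "X ^ 2 < 2 ^ l"
  shows "ht (\<lambda>\<sigma>. \<sigma> 14 = int M \<and> \<sigma> 2 = int l \<and> \<sigma> 12 = int y \<and> \<sigma> 1 = int X) smooth_prog
    ((2 * Tf + 20000) * (M + 1) * (l + 1))
    (\<lambda>\<sigma>. \<sigma> 30 = fact M \<and> \<sigma> 18 = (\<Sum>n=1..M. pf f n) \<and>
      \<sigma> 22 = (\<Sum>(d, m) | d \<in> {1..y} \<and> m \<in> smooth l M \<and> d * m \<le> X. moebius d * f (d * m)))"
proof -
  let ?L = "2 ^ l :: nat"
  define C where "C = (\<Prod>n=1..M. \<Sum>k\<le>l. \<bar>pf f n\<bar> ^ k)"
  define H where "H = 4 * C ^ 2 + 3"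
  define P where "P = (\<Prod>n=1..M. 1 - pf f n * H ^ elog ?L n)"
  define Q where "Q = (\<Prod>n=1..M. \<Sum>k\<le>l. (pf f n * H ^ elog ?L n) ^ k)"
  define S where "S = (\<Sum>n=1..M. pf f n)"
  have "X * 1 \<le> X ^ 2" unfolding power2_eq_square using y by (intro mult_le_mono) auto
  then have Xl: "X < 2 ^ l" using l by simp
  have "l > 0" using Xl y by (cases l) auto
  have Xl': "X < 2 ^ Suc l" using Xl by simp
  have result: "bal (bal (bal P (H ^ Suc (elog ?L y)) * Q) (H ^ Suc (elog ?L X))) (H - 1)
      = (\<Sum>(d, m) | d \<in> {1..y} \<and> m \<in> smooth l M \<and> d * m \<le> X. moebius d * f (d * m))"
    by (rule smooth_part[OF y(1,2) _ l \<open>l > 0\<close> Xl' C_def H_def P_def Q_def]) (use y in simp)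
  define R0 where "R0 = (\<lambda>\<sigma> :: nat \<Rightarrow> int. \<sigma> 14 = int M \<and> \<sigma> 2 = int l \<and> \<sigma> 12 = int y \<and> \<sigma> 1 = int X)"
  define R1 where "R1 = (\<lambda>\<sigma>. R0 \<sigma> \<and> \<sigma> 18 = S \<and> \<sigma> 16 = fact M \<and> \<sigma> 19 = C)"
  define R2 where "R2 = (\<lambda>\<sigma>. R0 \<sigma> \<and> \<sigma> 18 = S \<and> \<sigma> 30 = fact M \<and> \<sigma> 4 = H)"
  define R3 where "R3 = (\<lambda>\<sigma>. R2 \<sigma> \<and> \<sigma> 22 = P \<and> \<sigma> 23 = Q)"
  define R4 where "R4 = (\<lambda>\<sigma>. R3 \<sigma> \<and> \<sigma> 9 = H ^ elog ?L y)"
  define R5 where "R5 = (\<lambda>\<sigma>. R2 \<sigma> \<and> \<sigma> 22 = bal P (H ^ Suc (elog ?L y)) * Q)"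
  define R6 where "R6 = (\<lambda>\<sigma>. R5 \<sigma> \<and> \<sigma> 9 = H ^ elog ?L X)"
  have b1: "ht R0 bound_prog ((Tf + 300) * (M + 1) * (l + 1)) R1"
    by (rule ht_frame[OF bound_prog_correct[of M l]]) (auto simp: R0_def R1_def S_def C_def)
  have b2: "ht R1 (asg 30 (Var 16) ;; asg 4 (Lit 4 \<^bold>* Var 19 \<^bold>* Var 19 \<^bold>+ Lit 3)) 20 R2"
    by (rule ht_pre, (rule ht_seq ht_asg)+) (auto simp: R0_def R1_def R2_def H_def power2_eq_square)
  have b3: "ht R2 poly_prog ((Tf + 5000) * (M + 1) * (l + 1)) R3"
    by (rule ht_frame[OF poly_prog_correct[of M l H]])
      (use Xl y in \<open>auto simp: R0_def R2_def R3_def P_def Q_def\<close>)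
  have b4: "ht R3 (log_call 8 (Var 12)) (1000 * (l + l + 1) + 20) R4"
  proof (rule ht_pre[OF ht_log_call[where P = R3 and Q = R4 and n = y and B = l and l = l and H = H]])
    show "y < 2 ^ l" using y Xl by simp
  qed (use y in \<open>auto simp: R0_def R2_def R3_def R4_def\<close>)
  have b5: "ht R4 (asg 24 (Var 9 \<^bold>* Var 4) ;; asg 22 (lbal (Var 22) (Var 24) \<^bold>* Var 23)) 50 R5"
    by (rule ht_pre, (rule ht_seq ht_asg)+)
      (auto simp: R0_def R2_def R3_def R4_def R5_def mult.commute)
  have b6: "ht R5 (log_call 8 (Var 1)) (1000 * (l + l + 1) + 20) R6"
    by (rule ht_pre[OF ht_log_call[where P = R5 and Q = R6 and n = X and B = l and l = l and H = H]])
      (use y Xl in \<open>auto simp: R0_def R2_def R5_def R6_def\<close>)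
  have b7: "ht R6 (asg 24 (Var 9 \<^bold>* Var 4) ;; asg 22 (lbal (Var 22) (Var 24)) ;;
     asg 24 (Var 4 \<^bold>- Lit 1) ;; asg 22 (lbal (Var 22) (Var 24))) 100
     (\<lambda>\<sigma>. \<sigma> 30 = fact M \<and> \<sigma> 18 = S \<and>
       \<sigma> 22 = bal (bal (bal P (H ^ Suc (elog ?L y)) * Q) (H ^ Suc (elog ?L X))) (H - 1))"
    by (rule ht_pre, (rule ht_seq ht_asg)+)
      (auto simp: R0_def R2_def R5_def R6_def mult.commute)
  note prog = ht_compose[OF b1 ht_compose[OF b2 ht_compose[OF b3 ht_compose[OF b4 ht_compose[OF b5 ht_compose[OF b6 b7[unfolded result]]]]]]]
  show ?thesis unfolding smooth_prog_def
    by (rule ht_conseq[OF prog]) (auto simp: R0_def S_def algebra_simps)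
qed

definition power_prog :: prog where
  "power_prog = (asg 31 (Var 0) ;; asg 32 (Lit 1) ;; asg 33 (Var 30) ;; asg 10 (Lit 0) ;;
     loop (Var 10 \<^bold>< Var 2)
       (cond (Var 31 \<^bold>% Lit 2) (asg 32 (Var 32 \<^bold>* Var 33)) Skip ;; asg 33 (Var 33 \<^bold>* Var 33) ;;
        asg 31 (Var 31 \<^bold>/ Lit 2) ;; asg 10 (Var 10 \<^bold>+ Lit 1)))"

lemma mods_power_prog [simp]: "mods power_prog = {10, 31, 32, 33}"
  by (auto simp: power_prog_def)

text \<open>Square and multiply, always with \<open>l\<close> rounds: in surplus rounds variable 31
  is 0 and the product stays unchanged.\<close>

lemma power_prog_correct:
  assumes "x < 2 ^ l"
  shows "ht (\<lambda>\<sigma>. \<sigma> 0 = int x \<and> \<sigma> 30 = R \<and> \<sigma> 2 = int l) power_prog (100 * (l + 1)) (\<lambda>\<sigma>. \<sigma> 32 = R ^ x)"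
proof -
  define I where "I = (\<lambda>k (\<sigma> :: nat \<Rightarrow> int). \<sigma> 2 = int l \<and> \<sigma> 10 = int k \<and> \<sigma> 31 = int (x div 2 ^ k) \<and>
    \<sigma> 32 * \<sigma> 33 ^ (x div 2 ^ k) = R ^ x)"
  have step: "a * c * (c * c) ^ (n div 2) = a * c ^ n" if "n mod 2 = 1" for a c :: int and n :: nat
  proof -
    have "n = 1 + 2 * (n div 2)" using that by presburger
    then have "c ^ n = c ^ (1 + 2 * (n div 2))" by simp
    then show ?thesis by (simp add: power_add power_mult power2_eq_square)
  qed
  have step0: "a * (c * c) ^ (n div 2) = a * c ^ n" if "n mod 2 = 0" for a c :: int and n :: nat
  proof -
    have "n = 2 * (n div 2)" using that by presburger
    then have "c ^ n = c ^ (2 * (n div 2))" by simp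
    then show ?thesis by (simp add: power_mult power2_eq_square)
  qed
  have dv: "x div 2 ^ Suc k = x div 2 ^ k div 2" for k
    by (simp only: power_Suc2 div_mult2_eq)
  have md: "int n mod 2 = 0 \<longleftrightarrow> n mod 2 = 0" for n by presburger
  have dn: "int n div 2 = int (n div 2)" for n by presburger
  have loop: "ht (I 0) (loop (Var 10 \<^bold>< Var 2)
       (cond (Var 31 \<^bold>% Lit 2) (asg 32 (Var 32 \<^bold>* Var 33)) Skip ;; asg 33 (Var 33 \<^bold>* Var 33) ;;
        asg 31 (Var 31 \<^bold>/ Lit 2) ;; asg 10 (Var 10 \<^bold>+ Lit 1))) (l * (50 + 10) + 10) (I l)"
  proof (rule ht_pre[OF ht_loop])
    show "ht (I k) (cond (Var 31 \<^bold>% Lit 2) (asg 32 (Var 32 \<^bold>* Var 33)) Skip ;; asg 33 (Var 33 \<^bold>* Var 33) ;;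
        asg 31 (Var 31 \<^bold>/ Lit 2) ;; asg 10 (Var 10 \<^bold>+ Lit 1)) 50 (I (Suc k))" for k
    proof (rule ht_pre, (rule ht_seq ht_asg ht_cond ht_skip)+, goal_cases)
      case (1 \<sigma>)
      then show ?case using step[of "x div 2 ^ k" "\<sigma> 32" "\<sigma> 33"] step0[of "x div 2 ^ k" "\<sigma> 32" "\<sigma> 33"]
        md[of "x div 2 ^ k"] dn[of "x div 2 ^ k"]
        by (cases "x div 2 ^ k mod 2 = 0") (simp_all add: I_def dv del: of_nat_div power_Suc)
    qed simp
  qed (auto simp: I_def)
  show ?thesis unfolding power_prog_def
    apply (rule ht_conseq)
       apply ((rule ht_seq)+, rule loop, (rule ht_asg)+)
    using assms by (auto simp: I_def)
qed

definition window_body :: prog where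
  "window_body = (cond (Var 32 \<^bold>% Var 15 \<^bold>= Lit 1) (call1 cf 17 (Var 15) ;; asg 13 (Var 13 \<^bold>- Var 17)) Skip ;;
     asg 32 (Var 32 \<^bold>* Var 30) ;; asg 15 (Var 15 \<^bold>+ Lit 1))"

definition window_prog :: prog where
  "window_prog = (power_prog ;; asg 15 (Var 0 \<^bold>+ Lit 1) ;; loop (Var 15 \<^bold>< Var 1 \<^bold>+ Lit 1) window_body)"

text \<open>The factorial test used up to \<open>M\<close> would be too expensive here, since
  reaching \<open>x!\<close> takes \<open>x\<close> multiplications; the starting power of
  \<open>M!\<close> takes O(l). The bound \<open>(M + 1) ^ 2\<close> guarantees every composite of
  the window a prime factor up to \<open>M\<close>.\<close>

lemma window_prog_correct:
  assumes "x < 2 ^ l" "M \<le> x" "x + w < (M + 1) ^ 2" "x > 0"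
  shows "ht (\<lambda>\<sigma>. \<sigma> 0 = int x \<and> \<sigma> 1 = int (x + w) \<and> \<sigma> 30 = fact M \<and> \<sigma> 2 = int l \<and> \<sigma> 13 = v) window_prog
    (100 * (l + 1) + (Tf + 100) * (w + 1)) (\<lambda>\<sigma>. \<sigma> 13 = v - (\<Sum>n\<in>{x<..x + w}. pf f n))"
proof -
  define I where "I = (\<lambda>k (\<sigma> :: nat \<Rightarrow> int). \<sigma> 1 = int (x + w) \<and> \<sigma> 30 = fact M \<and> \<sigma> 15 = int (x + k + 1) \<and>
    \<sigma> 32 = fact M ^ (x + k) \<and> \<sigma> 13 = v - (\<Sum>n\<in>{x<..x + k}. pf f n))"
  have ins: "{x<..Suc (x + k)} = insert (Suc (x + k)) {x<..x + k}" for k by auto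
  have pr: "fact M ^ (x + k) mod (1 + (int x + int k)) = 1 \<longleftrightarrow> prime (Suc (x + k))" if "k < w" for k
    using power_mod_iff_prime[of M "Suc (x + k)"] assms that by simp
  have body: "ht (I k) window_body (Tf + 60) (I (Suc k))" if "k < w" for k
    unfolding window_body_def
    by (rule ht_pre, (rule ht_seq ht_asg ht_cond ht_call_f ht_skip)+)
      (use pr[OF that] in \<open>auto simp: I_def ins pf_def intro!: exI[of _ "Suc (x + k)"]\<close>)
  have loop: "ht (I 0) (loop (Var 15 \<^bold>< Var 1 \<^bold>+ Lit 1) window_body) (w * (Tf + 60 + 7) + 7) (I w)"
    by (rule ht_pre[OF ht_loop[where I = I, OF body]]) (auto simp: I_def)
  define R where "R = (\<lambda>\<sigma> :: nat \<Rightarrow> int. \<sigma> 0 = int x \<and> \<sigma> 1 = int (x + w) \<and> \<sigma> 30 = fact M \<and> \<sigma> 2 = int l \<and> \<sigma> 13 = v)"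
  have 1: "ht R power_prog (100 * (l + 1)) (\<lambda>\<sigma>. R \<sigma> \<and> \<sigma> 32 = fact M ^ x)"
    by (rule ht_frame[OF power_prog_correct[OF assms(1), of "fact M"]]) (auto simp: R_def)
  have 2: "ht (\<lambda>\<sigma>. R \<sigma> \<and> \<sigma> 32 = fact M ^ x) (asg 15 (Var 0 \<^bold>+ Lit 1)) 10 (I 0)"
    by (rule ht_pre[OF ht_asg]) (auto simp: R_def I_def)
  show ?thesis unfolding window_prog_def
    by (rule ht_conseq[OF ht_compose[OF 1 ht_compose[OF 2 loop]]]) (auto simp: R_def I_def algebra_simps)
qed

end

section \<open>The displaced argument and the complete program\<close>

definition y_scaled :: "nat \<Rightarrow> nat" where
  "y_scaled x = nat \<lfloor>100 * y_approx x\<rfloor>"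

text \<open>Since \<open>y_scaled x / 100\<close> is within \<open>1/50\<close> of \<open>y_of x\<close>, the integer part of \<open>y_of x\<close> is certain
  unless \<open>y_scaled x\<close> ends in \<open>00\<close> or \<open>99\<close>.\<close>

definition ambiguous :: "nat \<Rightarrow> bool" where
  "ambiguous x \<longleftrightarrow> (y_scaled x + 1) mod 100 < 2"

definition shift :: "nat \<Rightarrow> nat" where
  "shift x = (if ambiguous x then x div (2 * (y_scaled x div 100 + 1)) else 0)"

definition approx_ok :: "nat \<Rightarrow> bool" where
  "approx_ok x \<longleftrightarrow> x > 0 \<and> num_of x > 0 \<and> den_of x > 0 \<and> lnln_of x > 0"

context machine begin

definition start_prog :: prog where
  "start_prog = (asg 1 (Var 0) ;; approx_prog ;;
     cond ((Var 11 \<^bold>+ Lit 1) \<^bold>% Lit 100 \<^bold>< Lit 2)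
       (asg 1 (Var 0 \<^bold>+ Var 0 \<^bold>/ (Lit 2 \<^bold>* (Var 11 \<^bold>/ Lit 100 \<^bold>+ Lit 1))) ;; approx_prog) Skip ;;
     (asg 12 (Var 11 \<^bold>/ Lit 100) ;; asg 14 (Var 1 \<^bold>/ (Var 12 \<^bold>+ Lit 1))))"

lemma start_prog_correct:
  assumes "approx_ok x" "approx_ok (x + shift x)"
  defines "X \<equiv> x + shift x"
  shows "ht (\<lambda>\<sigma>. \<sigma> 0 = int x) start_prog (60000 * (ell x + y_scaled x + ell X + y_scaled X + 1))
    (\<lambda>\<sigma>. \<sigma> 0 = int x \<and> \<sigma> 1 = int X \<and> \<sigma> 2 = int (ell X) \<and> \<sigma> 12 = int (y_scaled X div 100) \<and>
      \<sigma> 14 = int (X div (y_scaled X div 100 + 1)))"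
proof -
  define P1 where "P1 = (\<lambda>\<sigma> :: nat \<Rightarrow> int. \<sigma> 0 = int x \<and> \<sigma> 1 = int x)"
  define P2 where "P2 = (\<lambda>\<sigma>. P1 \<sigma> \<and> \<sigma> 2 = int (ell x) \<and> \<sigma> 11 = int (y_scaled x))"
  define P3 where "P3 = (\<lambda>\<sigma> :: nat \<Rightarrow> int. \<sigma> 0 = int x \<and> \<sigma> 1 = int X)"
  define P4 where "P4 = (\<lambda>\<sigma>. P3 \<sigma> \<and> \<sigma> 2 = int (ell X) \<and> \<sigma> 11 = int (y_scaled X))"
  have dv: "int a div 100 = int (a div 100)" for a by (simp add: zdiv_int)
  have amb: "(int a + 1) mod 100 < 2 \<longleftrightarrow> (a + 1) mod 100 < 2" for a
  proof -
    have "(int a + 1) mod 100 = int ((a + 1) mod 100)" by (simp add: zmod_int add.commute)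
    then show ?thesis by simp
  qed
  have 1: "ht (\<lambda>\<sigma>. \<sigma> 0 = int x) (asg 1 (Var 0)) 4 P1"
    by (rule ht_pre[OF ht_asg]) (auto simp: P1_def)
  have 2: "ht P1 approx_prog (20000 * (ell x + y_scaled x + 1)) P2"
    by (rule ht_frame[OF approx_prog_correct[of x]])
      (use assms in \<open>auto simp: P1_def P2_def approx_ok_def y_scaled_def\<close>)
  have 3: "ht P2 (cond ((Var 11 \<^bold>+ Lit 1) \<^bold>% Lit 100 \<^bold>< Lit 2)
       (asg 1 (Var 0 \<^bold>+ Var 0 \<^bold>/ (Lit 2 \<^bold>* (Var 11 \<^bold>/ Lit 100 \<^bold>+ Lit 1))) ;; approx_prog) Skip)
       (8 + (16 + 20000 * (ell X + y_scaled X + 1))) P4"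
  proof (cases "ambiguous x")
    case True
    then have X: "X = x + x div (2 * (y_scaled x div 100 + 1))" by (simp add: X_def shift_def)
    have "int x div (2 * (int (y_scaled x) div 100 + 1)) = int (x div (2 * (y_scaled x div 100 + 1)))"
      by (simp only: zdiv_int of_nat_mult of_nat_add of_nat_numeral of_nat_1)
    then have a: "ht P2 (asg 1 (Var 0 \<^bold>+ Var 0 \<^bold>/ (Lit 2 \<^bold>* (Var 11 \<^bold>/ Lit 100 \<^bold>+ Lit 1)))) 16 P3"
      by (intro ht_pre[OF ht_asg]) (auto simp: P1_def P2_def P3_def X)
    have b: "ht P3 approx_prog (20000 * (ell X + y_scaled X + 1)) P4"
      by (rule ht_frame[OF approx_prog_correct[of X]])
        (use assms in \<open>auto simp: P3_def P4_def approx_ok_def y_scaled_def\<close>)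
    show ?thesis
      by (rule ht_pre[OF ht_cond_true[OF ht_compose[OF a b]]])
        (use True amb[of "y_scaled x"] in \<open>auto simp: P2_def ambiguous_def\<close>)
  next
    case False
    then have "X = x" by (simp add: X_def shift_def)
    then have "P2 = P4" by (simp add: P1_def P2_def P3_def P4_def)
    have "ht P2 (cond ((Var 11 \<^bold>+ Lit 1) \<^bold>% Lit 100 \<^bold>< Lit 2)
       (asg 1 (Var 0 \<^bold>+ Var 0 \<^bold>/ (Lit 2 \<^bold>* (Var 11 \<^bold>/ Lit 100 \<^bold>+ Lit 1))) ;; approx_prog) Skip)
       (lcost ((Var 11 \<^bold>+ Lit 1) \<^bold>% Lit 100 \<^bold>< Lit 2) + 1) P2"
      by (rule ht_cond_false[OF ht_skip])
        (use False amb[of "y_scaled x"] in \<open>auto simp: P2_def ambiguous_def\<close>)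
    then show ?thesis unfolding \<open>P2 = P4\<close> by (rule ht_pre) auto
  qed
  have 4: "ht P4 (asg 12 (Var 11 \<^bold>/ Lit 100) ;; asg 14 (Var 1 \<^bold>/ (Var 12 \<^bold>+ Lit 1))) 20
    (\<lambda>\<sigma>. \<sigma> 0 = int x \<and> \<sigma> 1 = int X \<and> \<sigma> 2 = int (ell X) \<and> \<sigma> 12 = int (y_scaled X div 100) \<and>
      \<sigma> 14 = int (X div (y_scaled X div 100 + 1)))"
  proof -
    have "int X div (int (y_scaled X) div 100 + 1) = int (X div (y_scaled X div 100 + 1))"
      by (simp only: zdiv_int of_nat_mult of_nat_add of_nat_numeral of_nat_1)
    then show ?thesis
      by (intro ht_pre[OF ht_seq[OF ht_asg ht_asg]]) (auto simp: P3_def P4_def dv)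
  qed
  show ?thesis unfolding start_prog_def
    by (rule ht_conseq[OF ht_compose[OF 1 ht_compose[OF 2 ht_compose[OF 3 4]]]]) auto
qed

end

lemma sum_pf: "(\<Sum>n\<in>A. pf f n) = (\<Sum>p | p \<in> A \<and> prime p. f p)" if "finite A"
  unfolding pf_def using that by (subst sum.inter_filter[symmetric]) auto

context function_machine begin

definition prime_sum_prog :: "prog \<Rightarrow> prog" where
  "prime_sum_prog cS = (start_prog ;; call2 cS 13 (Var 12) (Var 1) ;; smooth_prog ;;
     asg 13 (Var 13 \<^bold>- Var 22 \<^bold>+ Var 18) ;; window_prog)"

text \<open>\<open>S0\<close> minus its smooth part leaves the primes in \<open>{M<..X}\<close>.
  Those up to \<open>M\<close> are added from the sum that \<open>bound_prog\<close> keeps in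
  variable 18, and those beyond \<open>x\<close> are removed by the window.\<close>

lemma prime_sum_prog_correct:
  assumes ok: "approx_ok x" "approx_ok (x + shift x)" and cS: "stores cS \<subseteq> {..<b}"
  defines "X \<equiv> x + shift x"
  defines "y \<equiv> y_scaled X div 100"
  defines "M \<equiv> X div (y + 1)"
  assumes S: "computes_within prim cS [\<lfloor>y_of (real X)\<rfloor>, int X] (S0 f (y_of (real X)) (real X)) TS"
    and y: "\<lfloor>y_of (real X)\<rfloor> = int y" "0 < y" "y \<le> M" "M \<le> x"
  shows "computes_within prim (main1 (prime_sum_prog cS) 13) [int x] (prime_sum f (real x))
    ((3 * Tf + 100000) * (ell x + y_scaled x + y_scaled X + (M + 1) * (ell X + 1) + shift x + TS + 1))"
proof (rule computes_within_mono[OF ht_main])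
  define l where "l = ell X"
  define v where "v = S0 f (y_of (real X)) (real X)"
  define T where "T = (\<Sum>(d, m) | d \<in> {1..y} \<and> m \<in> smooth l M \<and> d * m \<le> X. moebius d * f (d * m))"
  define S where "S = (\<Sum>n=1..M. pf f n)"
  have x0: "x > 0" using ok by (simp add: approx_ok_def)
  have X0: "X > 0" using x0 by (simp add: X_def)
  have X1: "X < (M + 1) * (y + 1)" unfolding M_def
    using dividend_less_div_times[of "y + 1" X] by simp
  \<comment> \<open>Through \<open>y <= M\<close> the bound by \<open>M + 1\<close> and
    \<open>y + 1\<close> becomes one by a square, on which both the uniqueness in
    \<open>large_part\<close> and the primality test of the window rest.\<close>
  also have "\<dots> \<le> (M + 1) * (M + 1)" using y(3) by (intro mult_le_mono) auto
  finally have X2: "X < (M + 1) ^ 2" by (simp add: power2_eq_square)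
  have "X ^ 2 * 1 \<le> X ^ 2 * X" using X0 by (intro mult_le_mono) auto
  moreover have "X ^ 3 = X ^ 2 * X" by (simp add: power2_eq_square power3_eq_cube)
  ultimately have lX: "X ^ 2 < 2 ^ l" using ell_less[of X] unfolding l_def by linarith
  have "X * 1 \<le> X ^ 2" unfolding power2_eq_square using X0 by (intro mult_le_mono) auto
  then have lX1: "X < 2 ^ l" using lX by linarith
  then have lX2: "X < 2 ^ Suc l" by simp
  have xX: "x \<le> X" by (simp add: X_def)
  have "M * 2 \<le> M * (y + 1)" using y(2) by (intro mult_le_mono) auto
  also have "\<dots> \<le> X" unfolding M_def by (rule div_times_less_eq_dividend)
  finally have MX: "M < X" using y(2,3) by linarith
  have val: "v - T + S - (\<Sum>n\<in>{x<..x + shift x}. pf f n) = prime_sum f (real x)"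
  proof -
    have "v - T = (\<Sum>p | prime p \<and> M < p \<and> p \<le> X. f p)"
      unfolding v_def T_def by (rule large_part[OF y(1) X2 X1 lX2])
    also have "\<dots> = (\<Sum>n\<in>{M<..X}. pf f n)"
      by (subst sum_pf) (auto intro!: sum.cong)
    finally have "v - T + S = (\<Sum>n\<in>{M<..X}. pf f n) + (\<Sum>n=1..M. pf f n)" by (simp add: S_def)
    also have "\<dots> = (\<Sum>n\<in>{M<..X} \<union> {1..M}. pf f n)" by (rule sum.union_disjoint[symmetric]) auto
    also have "{M<..X} \<union> {1..M} = {x<..X} \<union> {1..x}" using MX xX y(2,3) by auto
    also have "(\<Sum>n\<in>\<dots>. pf f n) = (\<Sum>n\<in>{x<..X}. pf f n) + (\<Sum>n=1..x. pf f n)"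
      by (rule sum.union_disjoint) auto
    also have "(\<Sum>n=1..x. pf f n) = prime_sum f (real x)"
      unfolding prime_sum_def
      by (subst sum_pf) (auto intro!: sum.cong dest: prime_gt_0_nat)
    finally show ?thesis by (simp add: X_def)
  qed
  define P1 where "P1 = (\<lambda>\<sigma> :: nat \<Rightarrow> int. \<sigma> 0 = int x \<and> \<sigma> 1 = int X \<and> \<sigma> 2 = int l \<and> \<sigma> 12 = int y \<and> \<sigma> 14 = int M)"
  define P2 where "P2 = (\<lambda>\<sigma>. P1 \<sigma> \<and> \<sigma> 13 = v)"
  define P3 where "P3 = (\<lambda>\<sigma>. P2 \<sigma> \<and> \<sigma> 22 = T \<and> \<sigma> 18 = S \<and> \<sigma> 30 = fact M)"
  define P4 where "P4 = (\<lambda>\<sigma>. P1 \<sigma> \<and> \<sigma> 13 = v - T + S \<and> \<sigma> 30 = fact M)"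
  have 1: "ht (\<lambda>\<sigma>. \<sigma> 0 = int x) start_prog (60000 * (ell x + y_scaled x + l + y_scaled X + 1)) P1"
    by (rule ht_conseq[OF start_prog_correct[OF ok]]) (auto simp: P1_def l_def X_def y_def M_def)
  have 2: "ht P1 (call2 cS 13 (Var 12) (Var 1)) (TS + 20) P2"
    by (rule ht_pre[OF ht_call2[OF S cS]]) (auto simp: P1_def P2_def v_def y(1))
  have 3: "ht P2 smooth_prog ((2 * Tf + 20000) * (M + 1) * (l + 1)) P3"
    by (rule ht_frame[OF smooth_prog_correct[OF y(2,3) MX lX]])
      (auto simp: P1_def P2_def P3_def T_def S_def)
  have 4: "ht P3 (asg 13 (Var 13 \<^bold>- Var 22 \<^bold>+ Var 18)) 20 P4"
    by (rule ht_pre[OF ht_asg]) (auto simp: P1_def P2_def P3_def P4_def)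
  have 5: "ht P4 window_prog (100 * (l + 1) + (Tf + 100) * (shift x + 1))
      (\<lambda>\<sigma>. \<sigma> 13 = v - T + S - (\<Sum>n\<in>{x<..x + shift x}. pf f n))"
    by (rule ht_conseq[OF window_prog_correct[of x l M "shift x"]])
      (use xX lX1 y(4) X2 x0 in \<open>auto simp: P1_def P4_def X_def\<close>)
  show "ht (\<lambda>\<sigma>. \<sigma> 0 = int x) (prime_sum_prog cS)
      (60000 * (ell x + y_scaled x + l + y_scaled X + 1) + (TS + 20 + ((2 * Tf + 20000) * (M + 1) * (l + 1) +
       (20 + (100 * (l + 1) + (Tf + 100) * (shift x + 1))))))
      (\<lambda>\<sigma>. \<sigma> 13 = prime_sum f (real x))"
    unfolding prime_sum_prog_def val[symmetric]
    by (rule ht_compose[OF 1 ht_compose[OF 2 ht_compose[OF 3 ht_compose[OF 4 5]]]])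
  define Z where "Z = (M + 1) * (l + 1)"
  have Z: "l + 1 \<le> Z" unfolding Z_def by simp
  define C where "C = 3 * Tf + 100000"
  have "(2 * Tf + 20000) * (M + 1) * (l + 1) = (2 * Tf + 20000) * Z" by (simp only: Z_def mult.assoc)
  then show "60000 * (ell x + y_scaled x + l + y_scaled X + 1) + (TS + 20 + ((2 * Tf + 20000) * (M + 1) * (l + 1) +
       (20 + (100 * (l + 1) + (Tf + 100) * (shift x + 1))))) + 8
    \<le> (3 * Tf + 100000) * (ell x + y_scaled x + y_scaled X + (M + 1) * (ell X + 1) + shift x + TS + 1)"
    unfolding l_def[symmetric] Z_def[symmetric] using Z by (simp add: algebra_simps)
qed

end

section \<open>Size of the parameters against the time bound\<close>

definition budget :: "real \<Rightarrow> real" where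
  "budget x = x powr (2/3) / (ln x)\<^sup>2"

text \<open>The error 1/50 is 1/100 from \<open>y_approx_correct\<close> and 1/100 from rounding
  down.\<close>

lemma y_scaled_bounds:
  "\<forall>\<^sub>F x in at_top. approx_ok x \<and> \<bar>real (y_scaled x) / 100 - y_of (real x)\<bar> \<le> 1 / 50 \<and>
     (\<not> ambiguous x \<longrightarrow> \<lfloor>y_of (real x)\<rfloor> = int (y_scaled x div 100)) \<and>
     (ambiguous x \<longrightarrow> (\<exists>q::int. \<bar>y_of (real x) - q\<bar> < 1 / 50))"
  using y_approx_correct eventually_gt_at_top[of "0::nat"]
proof eventually_elim
  case (elim x)
  let ?K = "y_scaled x"
  have "0 \<le> y_approx x" unfolding y_approx_def using elim by simp
  then have K: "real ?K \<le> 100 * y_approx x" "100 * y_approx x < real ?K + 1"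
    unfolding y_scaled_def by linarith+
  have y: "y_approx x < y_of (real x) + 1 / 100" "y_of (real x) < y_approx x + 1 / 100" using elim by linarith+
  have 1: "\<bar>real ?K / 100 - y_of (real x)\<bar> \<le> 1 / 50" using K y by linarith
  have dm: "real ?K = 100 * real (?K div 100) + real (?K mod 100)"
    by (metis mult_div_mod_eq of_nat_add of_nat_mult of_nat_numeral)
  have 2: "\<lfloor>y_of (real x)\<rfloor> = int (?K div 100)" if "\<not> ambiguous x"
  proof -
    \<comment> \<open>\<open>y_of x\<close> lies strictly between \<open>(?K - 1) / 100\<close> and
      \<open>(?K + 2) / 100\<close>, so with endings 01 to 98 no integer lies between it and
      \<open>?K / 100\<close>.\<close>
    have "1 \<le> ?K mod 100 \<and> ?K mod 100 \<le> 98" 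
      using that mod_Suc[of ?K 100] mod_less_divisor[of 100 ?K] unfolding ambiguous_def
      by (simp split: if_splits)
    then have "1 \<le> real (?K mod 100)" "real (?K mod 100) \<le> 98" by auto
    then have "real (?K div 100) \<le> y_of (real x)" "y_of (real x) < real (?K div 100) + 1"
      using K y dm by linarith+
    then show ?thesis by (simp add: floor_eq_iff)
  qed
  have 3: "\<exists>q::int. \<bar>y_of (real x) - q\<bar> < 1 / 50" if "ambiguous x"
  proof -
    have "?K mod 100 = 0 \<or> ?K mod 100 = 99"
      using that mod_Suc[of ?K 100] unfolding ambiguous_def by (auto split: if_splits)
    then consider "real (?K mod 100) = 0" | "real (?K mod 100) = 99" by force
    then show ?thesis
    proof cases
      case 1
      then have "\<bar>y_of (real x) - real (?K div 100)\<bar> < 1 / 50"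
        using K y dm by (intro iffD2[OF abs_less_iff] conjI; linarith)
      then show ?thesis by (intro exI[of _ "int (?K div 100)"]) simp
    next
      case 2
      then have "\<bar>y_of (real x) - (real (?K div 100) + 1)\<bar> < 1 / 50"
        using K y dm by (intro iffD2[OF abs_less_iff] conjI; linarith)
      then show ?thesis by (intro exI[of _ "int (?K div 100) + 1"]) simp
    qed
  qed
  show ?case using elim 1 2 3 by (auto simp: approx_ok_def)
qed

text \<open>The term that dictates \<open>y\<close> is \<open>M * ell X\<close>, at most a constant
  times \<open>ln X * X / y_of X\<close>, which is the budget divided by ln ln X. Quantities at
  \<open>X\<close> are brought back to \<open>x\<close> through \<open>X <= 2 * x\<close>.\<close>

lemma eventually_parameters:
  fixes TS :: "nat \<Rightarrow> nat"
  assumes TS: "(\<lambda>x. real (TS x)) \<in> O(\<lambda>x. budget (real x))"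
  shows "\<exists>C. \<forall>\<^sub>F x in at_top. let X = x + shift x; y = y_scaled X div 100; M = X div (y + 1) in
    approx_ok x \<and> approx_ok X \<and> \<lfloor>y_of (real X)\<rfloor> = int y \<and> 0 < y \<and> y \<le> M \<and> M \<le> x \<and> 2 \<le> X \<and>
    real (ell x + y_scaled x + y_scaled X + (M + 1) * (ell X + 1) + shift x + TS X + 1) \<le> C * budget (real x)"
proof -
  obtain C0 where C0: "C0 > 0" "\<forall>\<^sub>F x in at_top. norm (real (TS x)) \<le> C0 * norm (budget (real x))"
    using landau_o.bigE[OF TS] by blast
  have r1: "\<forall>\<^sub>F t in at_top. ln t * (t / y_of t) \<le> budget t"
    unfolding y_of_def budget_def by real_asymp
  have r2: "\<forall>\<^sub>F t in at_top. y_of t \<le> budget t" unfolding y_of_def budget_def by real_asymp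
  have r3: "\<forall>\<^sub>F t in at_top. ln t \<le> budget t" unfolding budget_def by real_asymp
  have r4: "\<forall>\<^sub>F t::real in at_top. 1 \<le> ln t" by real_asymp
  have r5: "\<forall>\<^sub>F t in at_top. 3 \<le> y_of t" unfolding y_of_def by real_asymp
  have r6: "\<forall>\<^sub>F t in at_top. (y_of t + 1) ^ 2 \<le> t" unfolding y_of_def by real_asymp
  have r7: "\<forall>\<^sub>F t::real in at_top. 2 \<le> t" by real_asymp
  \<comment> \<open>One threshold for all facts, because they are used both at \<open>x\<close> and
    at \<open>X\<close>, which is at least \<open>x\<close>.\<close>
  have "\<forall>\<^sub>F z in at_top. norm (real (TS z)) \<le> C0 * norm (budget (real z)) \<and>
     approx_ok z \<and> \<bar>real (y_scaled z) / 100 - y_of (real z)\<bar> \<le> 1 / 50 \<and>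
     (\<not> ambiguous z \<longrightarrow> \<lfloor>y_of (real z)\<rfloor> = int (y_scaled z div 100)) \<and>
     (ambiguous z \<longrightarrow> (\<exists>q::int. \<bar>y_of (real z) - q\<bar> < 1 / 50)) \<and>
     ln (real z) * (real z / y_of (real z)) \<le> budget (real z) \<and> y_of (real z) \<le> budget (real z) \<and>
     ln (real z) \<le> budget (real z) \<and> 1 \<le> ln (real z) \<and> 3 \<le> y_of (real z) \<and> (y_of (real z) + 1) ^ 2 \<le> real z \<and> 2 \<le> real z"
    using C0(2) y_scaled_bounds r1[THEN eventually_nat] r2[THEN eventually_nat] r3[THEN eventually_nat]
      r4[THEN eventually_nat] r5[THEN eventually_nat] r6[THEN eventually_nat] r7[THEN eventually_nat]
    by eventually_elim blast
  then obtain z0 where z0: "\<And>z. z \<ge> z0 \<Longrightarrow> norm (real (TS z)) \<le> C0 * norm (budget (real z)) \<and>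
     approx_ok z \<and> \<bar>real (y_scaled z) / 100 - y_of (real z)\<bar> \<le> 1 / 50 \<and>
     (\<not> ambiguous z \<longrightarrow> \<lfloor>y_of (real z)\<rfloor> = int (y_scaled z div 100)) \<and>
     (ambiguous z \<longrightarrow> (\<exists>q::int. \<bar>y_of (real z) - q\<bar> < 1 / 50)) \<and>
     ln (real z) * (real z / y_of (real z)) \<le> budget (real z) \<and> y_of (real z) \<le> budget (real z) \<and>
     ln (real z) \<le> budget (real z) \<and> 1 \<le> ln (real z) \<and> 3 \<le> y_of (real z) \<and> (y_of (real z) + 1) ^ 2 \<le> real z \<and> 2 \<le> real z"
    unfolding eventually_at_top_linorder by blast
  show ?thesis
  proof (rule exI[of _ "1000 + 2 * C0"])
    from y_of_shift eventually_ge_at_top[of z0]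
    show "\<forall>\<^sub>F x in at_top. let X = x + shift x; y = y_scaled X div 100; M = X div (y + 1) in
      approx_ok x \<and> approx_ok X \<and> \<lfloor>y_of (real X)\<rfloor> = int y \<and> 0 < y \<and> y \<le> M \<and> M \<le> x \<and> 2 \<le> X \<and>
      real (ell x + y_scaled x + y_scaled X + (M + 1) * (ell X + 1) + shift x + TS X + 1) \<le> (1000 + 2 * C0) * budget (real x)"
    proof eventually_elim
      case (elim x)
      define w where "w = shift x"
      define X where "X = x + w"
      define y where "y = y_scaled X div 100"
      define M where "M = X div (y + 1)"
      have Zx: "x \<ge> z0" and ZX: "X \<ge> z0" using elim(2) by (auto simp: X_def)
      note zx = z0[OF Zx] and zX = z0[OF ZX]
      define w' where "w' = x div (2 * (y_scaled x div 100 + 1))"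
      have sh: "w' \<le> x" "real w' \<le> real x / y_of (real x)"
        "1 / 20 \<le> y_of (real (x + w')) - y_of (real x)" "y_of (real (x + w')) - y_of (real x) \<le> 3 / 5"
        using elim(1) zx by (auto simp: Let_def w'_def)
      have w: "w \<le> w'" by (simp add: w_def w'_def shift_def)
      have unamb: "\<not> ambiguous X"
      proof (cases "ambiguous x")
        case True
        then have Xw: "X = x + w'" by (simp add: X_def w_def w'_def shift_def)
        obtain p :: int where p: "\<bar>y_of (real x) - p\<bar> < 1 / 50" using zx True by blast
        show ?thesis
        proof
          assume "ambiguous X"
          then obtain q :: int where q: "\<bar>y_of (real X) - q\<bar> < 1 / 50" using zX by blast
          \<comment> \<open>The increment is between 1/20 and 3/5 and each distance to an integer is
            below 1/50, so \<open>q - p\<close> would lie between 1/100 and 16/25.\<close>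
          have "real_of_int (q - p) > 0" "real_of_int (q - p) < 1"
            using p q sh(3,4) unfolding Xw by linarith+
          then have "0 < q - p" "q - p < 1" by (simp_all only: of_int_0_less_iff of_int_less_1_iff)
          then show False by linarith
        qed
      qed (simp add: X_def w_def shift_def)
      have fl: "\<lfloor>y_of (real X)\<rfloor> = int y" using zX unamb by (simp add: y_def)
      have y: "real y \<le> y_of (real X)" "y_of (real X) < real y + 1" using fl by linarith+
      have y3: "3 \<le> y" using zX y by linarith
      have X2: "X \<le> 2 * x" using w sh(1) by (simp add: X_def)
      have x0: "real x \<ge> 2" "real X \<ge> 2" using zx zX by auto
      have "real ((y + 1) * (y + 1)) \<le> (y_of (real X) + 1) ^ 2"
        unfolding power2_eq_square of_nat_mult using y by (intro mult_mono) auto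
      also have "\<dots> \<le> real X" using zX by blast
      finally have "(y + 1) * (y + 1) \<le> X" by (simp only: of_nat_le_iff)
      then have yM: "y \<le> M" unfolding M_def by (subst less_eq_div_iff_mult_less_eq) auto
      have "M * 4 \<le> M * (y + 1)" using y3 by (intro mult_le_mono) auto
      also have MX: "M * (y + 1) \<le> X" unfolding M_def by (rule div_times_less_eq_dividend)
      finally have Mx: "M \<le> x" using X2 by linarith
      have yX0: "y_of (real X) > 0" "y_of (real x) > 0" using zX zx by linarith+
      have "real M * y_of (real X) \<le> real M * (real y + 1)" using y by (intro mult_left_mono) auto
      also have "\<dots> = real (M * (y + 1))" by (simp add: algebra_simps)
      also have "\<dots> \<le> real X" using MX by (simp only: of_nat_le_iff)
      finally have M: "real M \<le> real X / y_of (real X)" using yX0 by (simp add: pos_le_divide_eq)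
      have "y_of (real X) + 1 \<le> (y_of (real X) + 1) ^ 2" using yX0 by (simp add: power2_eq_square)
      then have "y_of (real X) \<le> real X" using zX by linarith
      then have q1: "1 \<le> real X / y_of (real X)" using yX0 by simp
      have bud: "budget (real X) \<le> 2 * budget (real x)"
      proof -
        have "real X powr (2/3) \<le> (2 * real x) powr (2/3)" using X2 x0 by (intro powr_mono2) auto
        also have "\<dots> = 2 powr (2/3) * real x powr (2/3)" by (simp add: powr_mult)
        also have "\<dots> \<le> 2 powr 1 * real x powr (2/3)" by (intro mult_right_mono powr_mono) auto
        finally have 1: "real X powr (2/3) \<le> 2 * real x powr (2/3)" by simp
        have "ln (real x) \<le> ln (real X)" using x0 by (subst ln_le_cancel_iff) (auto simp: X_def)
        then have 2: "(ln (real x))\<^sup>2 \<le> (ln (real X))\<^sup>2" using zx by (intro power_mono) auto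
        have "budget (real X) \<le> (2 * real x powr (2/3)) / (ln (real x))\<^sup>2"
          unfolding budget_def using 1 2 zx by (intro frac_le) auto
        then show ?thesis by (simp add: budget_def)
      qed
      define B where "B = budget (real x)"
      have B: "B \<ge> 0" by (simp add: B_def budget_def)
      have l1: "real (ell x) \<le> 8 * B"
        using ell_le[of x] x0 zx unfolding B_def by linarith
      have k1: "real (y_scaled x) \<le> 200 * B"
        using zx unfolding B_def by linarith
      have k2: "real (y_scaled X) \<le> 400 * B"
        using zX bud unfolding B_def by linarith
      have lX: "real (ell X) + 1 \<le> 9 * ln (real X)"
        using ell_le[of X] x0 zX by linarith
      have "(real M + 1) * (real (ell X) + 1) \<le> (2 * (real X / y_of (real X))) * (9 * ln (real X))"
        using M q1 lX by (intro mult_mono) auto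
      also have "\<dots> = 18 * (ln (real X) * (real X / y_of (real X)))" by simp
      also have "\<dots> \<le> 36 * B" using zX bud unfolding B_def by linarith
      finally have m: "(real M + 1) * (real (ell X) + 1) \<le> 36 * B" .
      have "1 * (real x / y_of (real x)) \<le> ln (real x) * (real x / y_of (real x))"
        using zx yX0 by (intro mult_right_mono) auto
      then have ww: "real w \<le> B" using w sh(2) zx unfolding B_def by linarith
      have "real (TS X) \<le> C0 * budget (real X)" using zX by (simp add: budget_def)
      also have "\<dots> \<le> C0 * (2 * B)" using bud C0(1) unfolding B_def by (intro mult_left_mono) auto
      finally have ts: "real (TS X) \<le> 2 * C0 * B" by simp
      have one: "1 \<le> B" using zx unfolding B_def by linarith
      have "real (ell x + y_scaled x + y_scaled X + (M + 1) * (ell X + 1) + w + TS X + 1) \<le> (1000 + 2 * C0) * B"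
      proof -
        have "real (ell x + y_scaled x + y_scaled X + (M + 1) * (ell X + 1) + w + TS X + 1)
            = real (ell x) + real (y_scaled x) + real (y_scaled X) + (real M + 1) * (real (ell X) + 1)
              + real w + real (TS X) + 1"
          by (simp only: of_nat_add of_nat_mult of_nat_1)
        then show ?thesis
          using l1 k1 k2 m ww ts one unfolding distrib_right[of 1000 "2 * C0" B] by linarith
      qed
      then show ?case
        unfolding Let_def w_def[symmetric] X_def[symmetric] y_def[symmetric] M_def[symmetric] B_def[symmetric]
        using zx zX fl y3 yM Mx x0 by auto
    qed
  qed
qed

section \<open>The algorithm for the truncated Moebius sum\<close>

context machine begin

definition moebius_prog :: prog where
  "moebius_prog = (asg 5 (Var 3) ;; asg 6 (Lit 1) ;; asg 7 (Lit 2) ;;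
     loop (Var 7 \<^bold>< Var 2 \<^bold>+ Lit 1)
       (cond (Var 5 \<^bold>% Var 7) Skip
          (asg 5 (Var 5 \<^bold>/ Var 7) ;; asg 6 (Lit 0 \<^bold>- Var 6) ;; cond (Var 5 \<^bold>% Var 7) Skip (asg 6 (Lit 0))) ;;
        asg 7 (Var 7 \<^bold>+ Lit 1)) ;;
     cond (Lit 1 \<^bold>< Var 5) (asg 6 (Lit 0 \<^bold>- Var 6)) Skip)"

lemma mods_moebius_prog [simp]: "mods moebius_prog = {5, 6, 7}"
  by (auto simp: moebius_prog_def)

text \<open>Trial division. As long as the running sign is nonzero, the cofactor has no prime factor
  below the current divisor, so a divisor that is found is prime.\<close>

definition moebius_inv :: "nat \<Rightarrow> nat \<Rightarrow> nat \<Rightarrow> int \<Rightarrow> bool" where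
  "moebius_inv n d m c \<longleftrightarrow> 0 < m \<and> m \<le> n \<and> c * moebius m = moebius n \<and>
     (c \<noteq> 0 \<longrightarrow> (\<forall>p. prime p \<longrightarrow> p dvd m \<longrightarrow> d \<le> p))"

lemma moebius_inv_skip:
  assumes "moebius_inv n d m c" "\<not> d dvd m"
  shows "moebius_inv n (Suc d) m c"
proof -
  have "Suc d \<le> p" if "p dvd m" "d \<le> p" for p
    using that assms(2) by (cases "p = d") auto
  then show ?thesis using assms(1) unfolding moebius_inv_def by blast
qed

text \<open>A second factor \<open>d\<close> sets the sign to 0. From then on divisors may be
  composite (4 for \<open>n = 8\<close>), but \<open>c * moebius m = moebius n\<close> already fixes
  the answer; hence the clause on prime factors is conditional on
  \<open>c \<noteq> 0\<close>.\<close>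

lemma moebius_inv_divide:
  assumes inv: "moebius_inv n d (d * m) c" and d: "d \<ge> 2"
  shows "moebius_inv n (Suc d) m (if d dvd m then 0 else - c)"
proof -
  have m: "0 < m" "m \<le> n"
  proof -
    have "1 * m \<le> d * m" using d by (intro mult_le_mono) auto
    moreover have "0 < d * m" "d * m \<le> n" using inv unfolding moebius_inv_def by auto
    ultimately show "0 < m" "m \<le> n" by (cases m; simp)+
  qed
  show ?thesis
  proof (cases "c = 0")
    case True
    then show ?thesis using inv m unfolding moebius_inv_def by auto
  next
    case False
    then have small: "prime p \<Longrightarrow> p dvd d * m \<Longrightarrow> d \<le> p" for p
      using inv unfolding moebius_inv_def by blast
    obtain p where p: "prime p" "p dvd d" using prime_factor_nat[of d] d by auto
    then have "d \<le> p" using small by simp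
    moreover have "p \<le> d" using p d by (intro dvd_imp_le) auto
    ultimately have pd: "prime d" using p by simp
    show ?thesis
    proof (cases "d dvd m")
      case True
      then show ?thesis using inv m moebius_prime_dvd[OF pd True] unfolding moebius_inv_def by auto
    next
      case nd: False
      have "Suc d \<le> q" if "prime q" "q dvd m" for q
        using small[of q] that nd by (cases "q = d") auto
      then show ?thesis using inv m nd moebius_prime_mult[OF pd nd] unfolding moebius_inv_def by auto
    qed
  qed
qed

text \<open>A cofactor above 1 that is at most \<open>s ^ 2\<close> and has no prime factor up to
  \<open>s\<close> is itself prime.\<close>

lemma moebius_inv_final:
  assumes inv: "moebius_inv n (Suc s) m c" and n: "n \<le> s ^ 2"
  shows "moebius n = (if 1 < m then - c else c)"
proof (cases "c = 0")
  case True
  then show ?thesis using inv unfolding moebius_inv_def by auto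
next
  case False
  show ?thesis
  proof (cases "m = 1")
    case True
    then show ?thesis using inv unfolding moebius_inv_def by auto
  next
    case m1: False
    then have m: "1 < m" using inv unfolding moebius_inv_def by linarith
    have "prime m"
    proof (rule ccontr)
      assume "\<not> prime m"
      then obtain p where p: "prime p" "p dvd m" "p ^ 2 \<le> m" using small_prime_factor m by blast
      then have "Suc s \<le> p" using inv False unfolding moebius_inv_def by blast
      then have "(Suc s) ^ 2 \<le> p ^ 2" by (intro power_mono) auto
      moreover have "s ^ 2 < (Suc s) ^ 2" by (intro power_strict_mono) auto
      ultimately show False using p(3) n inv unfolding moebius_inv_def by linarith
    qed
    then have "moebius (m * 1) = - moebius 1" using m by (intro moebius_prime_mult) auto
    then show ?thesis using inv m unfolding moebius_inv_def by auto
  qed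
qed

lemma moebius_prog_correct:
  assumes n: "0 < n" "n \<le> s ^ 2"
  shows "ht (\<lambda>\<sigma>. \<sigma> 3 = int n \<and> \<sigma> 2 = int s) moebius_prog (100 * (s + 1)) (\<lambda>\<sigma>. \<sigma> 6 = moebius n)"
proof -
  have s0: "s > 0" using n by (cases s) auto
  define I where "I = (\<lambda>k (\<sigma> :: nat \<Rightarrow> int). \<sigma> 2 = int s \<and> \<sigma> 7 = int (Suc (Suc k)) \<and>
    (\<exists>m. \<sigma> 5 = int m \<and> moebius_inv n (Suc (Suc k)) m (\<sigma> 6)))"
  let ?body = "cond (Var 5 \<^bold>% Var 7) Skip
      (asg 5 (Var 5 \<^bold>/ Var 7) ;; asg 6 (Lit 0 \<^bold>- Var 6) ;; cond (Var 5 \<^bold>% Var 7) Skip (asg 6 (Lit 0))) ;;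
    asg 7 (Var 7 \<^bold>+ Lit 1)"
  have md: "int m mod int d = 0 \<longleftrightarrow> d dvd m" for m d
    by (metis int_dvd_int_iff mod_eq_0_iff_dvd)
  have body: "ht (I k) ?body 60 (I (Suc k))" for k
  proof (rule ht_pre, (rule ht_seq ht_asg ht_cond ht_skip)+, goal_cases)
    case (1 \<sigma>)
    let ?d = "Suc (Suc k)"
    have d: "2 + int k = int ?d" by simp
    obtain m where m: "\<sigma> 5 = int m" "moebius_inv n ?d m (\<sigma> 6)" using 1 by (auto simp: I_def)
    have s: "\<sigma> 2 = int s" "\<sigma> 7 = int ?d" using 1 by (simp_all add: I_def)
    show ?case
    proof (cases "?d dvd m")
      case False
      then show ?thesis using moebius_inv_skip[OF m(2) False] m(1) s md[of m ?d]
        by (auto simp: I_def simp del: of_nat_Suc)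
    next
      case True
      then obtain q where q: "m = ?d * q" by blast
      then have "int m div int ?d = int q" by (metis nat.distinct(1) nonzero_mult_div_cancel_left of_nat_0_eq_iff of_nat_mult)
      moreover have "int m mod int ?d = 0" using md[of m ?d] True by blast
      moreover have "moebius_inv n (Suc ?d) q (if ?d dvd q then 0 else - \<sigma> 6)"
        by (rule moebius_inv_divide) (use m(2) q in auto)
      ultimately show ?thesis using m(1) s md[of q ?d]
        by (auto simp: I_def simp del: of_nat_Suc split: if_splits)
    qed
  qed simp
  have loop: "ht (I 0) (loop (Var 7 \<^bold>< Var 2 \<^bold>+ Lit 1) ?body) ((s - 1) * (60 + 10) + 10) (I (s - 1))"
    by (rule ht_pre[OF ht_loop[where I = I, OF body]]) (use s0 in \<open>auto simp: I_def\<close>)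
  have fin: "ht (I (s - 1)) (cond (Lit 1 \<^bold>< Var 5) (asg 6 (Lit 0 \<^bold>- Var 6)) Skip) 20 (\<lambda>\<sigma>. \<sigma> 6 = moebius n)"
  proof (rule ht_pre, (rule ht_seq ht_asg ht_cond ht_skip)+, goal_cases)
    case (1 \<sigma>)
    have "Suc (Suc (s - 1)) = Suc s" using s0 by simp
    with 1 obtain m where m: "\<sigma> 5 = int m" "moebius_inv n (Suc s) m (\<sigma> 6)" unfolding I_def by metis
    then show ?case using moebius_inv_final[OF m(2) n(2)] by simp
  qed simp
  have init: "I 0 (\<sigma>(5 := int n, 6 := 1, 7 := 2))" if "\<sigma> 2 = int s" for \<sigma>
    using that n(1) prime_ge_2_nat unfolding I_def moebius_inv_def
    by (auto simp flip: numeral_2_eq_2)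
  show ?thesis unfolding moebius_prog_def
    apply (rule ht_pre)
      apply ((rule ht_seq)+, rule fin, rule loop, (rule ht_asg)+)
     apply (use init in simp)
    apply simp
    done
qed

text \<open>Trial division up to the square root of \<open>y\<close> costs about
  \<open>y ^ (3/2)\<close> in all, that is \<open>sqrt x\<close> up to logarithms, far below the
  bound. The root is found once by counting and limits the divisors for every
  \<open>n\<close>.\<close>

definition S0_prog :: "prog \<Rightarrow> prog \<Rightarrow> prog" where
  "S0_prog cf cF = (asg 2 (Lit 0) ;; loop (Var 2 \<^bold>* Var 2 \<^bold>< Var 0) (asg 2 (Var 2 \<^bold>+ Lit 1)) ;;
     (asg 3 (Lit 1) ;; asg 4 (Lit 0)) ;;
     loop (Var 3 \<^bold>< Var 0 \<^bold>+ Lit 1)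
       (moebius_prog ;; call1 cf 8 (Var 3) ;; call1 cF 9 (Var 1 \<^bold>/ Var 3) ;;
        (asg 4 (Var 4 \<^bold>+ Var 6 \<^bold>* Var 8 \<^bold>* Var 9) ;; asg 3 (Var 3 \<^bold>+ Lit 1))))"

text \<open>The given algorithm for \<open>F\<close> takes integers, so it is called with the
  integer quotient.\<close>

lemma summatory_div:
  assumes "n > 0"
  shows "summatory f (real x / real n) = summatory f (real (x div n))"
proof -
  have "real m \<le> real x / real n \<longleftrightarrow> real m \<le> real (x div n)" for m
  proof -
    have "real m \<le> real x / real n \<longleftrightarrow> real (m * n) \<le> real x" using assms by (simp add: pos_le_divide_eq)
    also have "\<dots> \<longleftrightarrow> m \<le> x div n" using assms by (simp only: of_nat_le_iff less_eq_div_iff_mult_less_eq)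
    finally show ?thesis by simp
  qed
  then show ?thesis by (simp add: summatory_def)
qed

lemma S0_prog_correct:
  assumes cf: "\<And>n. n > 0 \<Longrightarrow> computes_within prim cf [int n] (f n) T" "stores cf \<subseteq> {..<b}"
    and cF: "\<And>n. n > 0 \<Longrightarrow> computes_within prim cF [int n] (summatory f (real n)) T" "stores cF \<subseteq> {..<b}"
    and y: "\<lfloor>yr\<rfloor> = int y" "y \<le> x" and s: "s = (LEAST s. y \<le> s ^ 2)"
  shows "computes_within prim (main2 (S0_prog cf cF) 4) [\<lfloor>yr\<rfloor>, int x] (S0 f yr (real x))
    ((2 * T + 500) * (y + 1) * (s + 1))"
proof (rule computes_within_mono[OF ht_main2])
  have sq: "y \<le> s ^ 2" unfolding s by (rule LeastI[of _ y]) (simp add: power2_eq_square)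
  have iff: "k ^ 2 < y \<longleftrightarrow> k < s" for k
  proof
    assume "k < s" then show "k ^ 2 < y" using not_less_Least[of k "\<lambda>s. y \<le> s ^ 2"] unfolding s by simp
  next
    assume "k ^ 2 < y"
    then have "k ^ 2 < s ^ 2" using sq by linarith
    then show "k < s" by (rule power_less_imp_less_base) simp
  qed
  have iff': "int k * int k < int y \<longleftrightarrow> k < s" for k
    using iff[of k] unfolding power2_eq_square by (simp only: of_nat_mult[symmetric] of_nat_less_iff)
  define R where "R = (\<lambda>\<sigma> :: nat \<Rightarrow> int. \<sigma> 0 = int y \<and> \<sigma> 1 = int x)"
  define A where "A = (\<lambda>k \<sigma>. R \<sigma> \<and> \<sigma> 2 = int k)"
  have 1: "ht R (asg 2 (Lit 0)) 3 (A 0)"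
    by (rule ht_pre[OF ht_asg]) (auto simp: R_def A_def)
  have 2: "ht (A 0) (loop (Var 2 \<^bold>* Var 2 \<^bold>< Var 0) (asg 2 (Var 2 \<^bold>+ Lit 1))) (s * (6 + 8) + 8) (A s)"
  proof (rule ht_pre[OF ht_loop[where I = A]])
    show "ht (A k) (asg 2 (Var 2 \<^bold>+ Lit 1)) 6 (A (Suc k))" for k
      by (rule ht_pre[OF ht_asg]) (auto simp: R_def A_def)
  qed (auto simp: R_def A_def iff')
  define summand where "summand = (\<lambda>n. moebius n * f n * summatory f (real (x div n)))"
  define I where "I = (\<lambda>k \<sigma>. A s \<sigma> \<and> \<sigma> 3 = int (Suc k) \<and> \<sigma> 4 = (\<Sum>n=1..k. summand n))"
  have 3: "ht (A s) (asg 3 (Lit 1) ;; asg 4 (Lit 0)) 6 (I 0)"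
    by (rule ht_pre, (rule ht_seq ht_asg)+) (auto simp: R_def A_def I_def)
  let ?m = "100 * (s + 1) + (T + 8 + (T + 11 + 20))"
  have body: "ht (I k) (moebius_prog ;; call1 cf 8 (Var 3) ;; call1 cF 9 (Var 1 \<^bold>/ Var 3) ;;
        (asg 4 (Var 4 \<^bold>+ Var 6 \<^bold>* Var 8 \<^bold>* Var 9) ;; asg 3 (Var 3 \<^bold>+ Lit 1))) ?m (I (Suc k))" if k: "k < y" for k
  proof -
    have dv: "int x div (1 + int k) = int (x div Suc k)" by (simp add: zdiv_int)
    \<comment> \<open>The algorithm for \<open>F\<close> is specified at positive arguments only;
      \<open>y <= x\<close> provides them.\<close>
    have x0: "x div Suc k > 0" using k y(2) by (simp add: div_greater_zero_iff)
    have a: "ht (I k) moebius_prog (100 * (s + 1)) (\<lambda>\<sigma>. I k \<sigma> \<and> \<sigma> 6 = moebius (Suc k))"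
      by (rule ht_frame[OF moebius_prog_correct[of "Suc k" s]])
        (use k sq in \<open>auto simp: I_def A_def R_def\<close>)
    have b: "ht (\<lambda>\<sigma>. I k \<sigma> \<and> \<sigma> 6 = moebius (Suc k)) (call1 cf 8 (Var 3)) (T + 8)
        (\<lambda>\<sigma>. I k \<sigma> \<and> \<sigma> 6 = moebius (Suc k) \<and> \<sigma> 8 = f (Suc k))"
      by (rule ht_pre[OF ht_call1[OF cf(1)[of "Suc k"] cf(2)]]) (auto simp: I_def A_def R_def)
    have c: "ht (\<lambda>\<sigma>. I k \<sigma> \<and> \<sigma> 6 = moebius (Suc k) \<and> \<sigma> 8 = f (Suc k)) (call1 cF 9 (Var 1 \<^bold>/ Var 3)) (T + 11)
        (\<lambda>\<sigma>. I k \<sigma> \<and> \<sigma> 6 = moebius (Suc k) \<and> \<sigma> 8 = f (Suc k) \<and> \<sigma> 9 = summatory f (real (x div Suc k)))"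
      by (rule ht_pre[OF ht_call1[OF cF(1)[OF x0] cF(2)]]) (auto simp: I_def A_def R_def dv)
    have d: "ht (\<lambda>\<sigma>. I k \<sigma> \<and> \<sigma> 6 = moebius (Suc k) \<and> \<sigma> 8 = f (Suc k) \<and> \<sigma> 9 = summatory f (real (x div Suc k)))
        (asg 4 (Var 4 \<^bold>+ Var 6 \<^bold>* Var 8 \<^bold>* Var 9) ;; asg 3 (Var 3 \<^bold>+ Lit 1)) 20 (I (Suc k))"
      by (rule ht_pre, (rule ht_seq ht_asg)+) (auto simp: I_def A_def R_def summand_def)
    show ?thesis by (rule ht_compose[OF a ht_compose[OF b ht_compose[OF c d]]])
  qed
  have 4: "ht (I 0) (loop (Var 3 \<^bold>< Var 0 \<^bold>+ Lit 1)
       (moebius_prog ;; call1 cf 8 (Var 3) ;; call1 cF 9 (Var 1 \<^bold>/ Var 3) ;;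
        (asg 4 (Var 4 \<^bold>+ Var 6 \<^bold>* Var 8 \<^bold>* Var 9) ;; asg 3 (Var 3 \<^bold>+ Lit 1)))) (y * (?m + 7) + 7) (I y)"
    by (rule ht_pre[OF ht_loop[where I = I, OF body]]) (auto simp: I_def A_def R_def)
  have S0: "S0 f yr (real x) = (\<Sum>n=1..y. summand n)"
  proof -
    have "{n. 1 \<le> n \<and> real n \<le> yr} = {1..y}" using y(1) by (auto simp: floor_eq_iff)
    then show ?thesis unfolding S0_def summand_def
      by (intro sum.cong) (auto simp: summatory_div)
  qed
  show "ht (\<lambda>\<sigma>. \<sigma> 0 = \<lfloor>yr\<rfloor> \<and> \<sigma> 1 = int x) (S0_prog cf cF) (3 + (s * (6 + 8) + 8 + (6 + (y * (?m + 7) + 7))))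
      (\<lambda>\<sigma>. \<sigma> 4 = S0 f yr (real x))"
    unfolding S0_prog_def
    by (rule ht_conseq[OF ht_compose[OF 1 ht_compose[OF 2 ht_compose[OF 3 4]]]]) (auto simp: R_def I_def S0 y(1))
  show "3 + (s * (6 + 8) + 8 + (6 + (y * (?m + 7) + 7))) + 12 \<le> (2 * T + 500) * (y + 1) * (s + 1)"
    by (simp add: algebra_simps)
qed

end

section \<open>Running times\<close>

text \<open>O(1) constrains large arguments only; the finitely many other values are added to the
  constant.\<close>

lemma bounded_of_bigo_1:
  fixes T :: "nat \<Rightarrow> nat"
  assumes "(\<lambda>x. real (T x)) \<in> O(\<lambda>_. 1)"
  shows "\<exists>B. \<forall>x. T x \<le> B"
proof -
  obtain c where "\<forall>\<^sub>F n in at_top. norm (real (T n)) \<le> c * norm (1 :: real)"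
    using landau_o.bigE[OF assms] by blast
  then obtain n0 where c: "\<And>n. n \<ge> n0 \<Longrightarrow> real (T n) \<le> c"
    unfolding eventually_at_top_linorder by auto
  have "T n \<le> nat \<lceil>c\<rceil> + (\<Sum>i<n0. T i)" for n
  proof (cases "n < n0")
    case True
    then have "T n \<le> (\<Sum>i<n0. T i)" by (intro member_le_sum) auto
    then show ?thesis by simp
  next
    case False
    then have "T n \<le> nat \<lceil>c\<rceil>" using c[of n] by linarith
    then show ?thesis by simp
  qed
  then show ?thesis by blast
qed

lemma computable_in_constant_time:
  assumes "computable_in_time prim {1..} (\<lambda>n. [int n]) g (\<lambda>_. 1)"
  shows "\<exists>c T. \<forall>n > 0. computes_within prim c [int n] (g n) T"
proof -
  obtain c T where c: "\<forall>n\<in>{1..}. computes_within prim c [int n] (g n) (T n)"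
    and T: "(\<lambda>n. real (T n)) \<in> O(\<lambda>_. 1)"
    using assms unfolding computable_in_time_def by blast
  obtain B where "T n \<le> B" for n using bounded_of_bigo_1[OF T] by blast
  then have "\<forall>n > 0. computes_within prim c [int n] (g n) B"
    using c computes_within_mono by (metis One_nat_def Suc_leI atLeast_iff)
  then show ?thesis by blast
qed

lemma machine_above: "\<exists>b. machine b \<and> stores c \<subseteq> {..<b} \<and> stores d \<subseteq> {..<b}"
proof -
  obtain b where "stores c \<union> stores d \<subseteq> {..<b}"
    using finite_nat_bounded[of "stores c \<union> stores d"] by auto
  \<comment> \<open>The successor keeps table 0 free for arguments and results.\<close>
  then have "machine (Suc b) \<and> stores c \<subseteq> {..<Suc b} \<and> stores d \<subseteq> {..<Suc b}"
    by (auto simp: machine_def)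
  then show ?thesis by blast
qed

lemma one_budget: "(\<lambda>_. 1) \<in> O(\<lambda>x. budget (real x))"
  unfolding budget_def by real_asymp

lemma budget_nonneg: "budget x \<ge> 0"
  by (simp add: budget_def)

lemma bigo_budget: "(\<lambda>x. real (nat \<lfloor>C * budget (real x)\<rfloor>)) \<in> O(\<lambda>x. budget (real x))"
proof (rule bigoI[of _ "\<bar>C\<bar>"], rule always_eventually, rule allI)
  fix x
  have "C * budget (real x) \<le> \<bar>C\<bar> * budget (real x)" by (intro mult_right_mono budget_nonneg) auto
  moreover have "0 \<le> \<bar>C\<bar> * budget (real x)" using budget_nonneg by simp
  ultimately have "real (nat \<lfloor>C * budget (real x)\<rfloor>) \<le> \<bar>C\<bar> * budget (real x)" by linarith
  then show "norm (real (nat \<lfloor>C * budget (real x)\<rfloor>)) \<le> \<bar>C\<bar> * norm (budget (real x))"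
    using budget_nonneg[of "real x"] by simp
qed

lemma prime_sum_computable:
  assumes f: "completely_multiplicative f" "f 1 = 1"
    and comp: "computable_in_time prim {1..} (\<lambda>n. [int n]) f (\<lambda>_. 1)"
    and S0: "S0_fast prim f"
  shows "computable_in_time prim {1..} (\<lambda>x. [int x]) (\<lambda>x. prime_sum f (real x)) (\<lambda>x. budget (real x))"
proof -
  obtain cf Tf where cf: "\<And>n. n > 0 \<Longrightarrow> computes_within prim cf [int n] (f n) Tf"
    using computable_in_constant_time[OF comp] by blast
  obtain cS TS where cS: "\<forall>x\<in>{2..}. computes_within prim cS [\<lfloor>y_of (real x)\<rfloor>, int x] (S0 f (y_of (real x)) (real x)) (TS x)"
    and TS: "(\<lambda>x. real (TS x)) \<in> O(\<lambda>x. budget (real x))"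
    using S0 unfolding S0_fast_def computable_in_time_def budget_def by blast
  obtain b where b: "machine b" "stores cf \<subseteq> {..<b}" "stores cS \<subseteq> {..<b}"
    using machine_above by blast
  interpret function_machine prim b f cf Tf
    using f b cf by (auto simp: function_machine_def function_machine_axioms_def cmult_def completely_multiplicative_def)
  obtain C x0 where x0: "\<And>x. x \<ge> x0 \<Longrightarrow> let X = x + shift x; y = y_scaled X div 100; M = X div (y + 1) in
    approx_ok x \<and> approx_ok X \<and> \<lfloor>y_of (real X)\<rfloor> = int y \<and> 0 < y \<and> y \<le> M \<and> M \<le> x \<and> 2 \<le> X \<and>
    real (ell x + y_scaled x + y_scaled X + (M + 1) * (ell X + 1) + shift x + TS X + 1) \<le> C * budget (real x)"
    using eventually_parameters[OF TS] unfolding eventually_at_top_linorder by blast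
  define D where "D = real (3 * Tf + 100000) * C"
  show ?thesis
  proof (rule computable_in_timeI[where i = 0, OF _ _ bigo_budget[of D] one_budget])
    fix x assume "x0 \<le> x"
    define X where "X = x + shift x"
    define y where "y = y_scaled X div 100"
    define M where "M = X div (y + 1)"
    define n where "n = ell x + y_scaled x + y_scaled X + (M + 1) * (ell X + 1) + shift x + TS X + 1"
    have h: "approx_ok x" "approx_ok X" "\<lfloor>y_of (real X)\<rfloor> = int y" "0 < y" "y \<le> M" "M \<le> x" "2 \<le> X"
      "real n \<le> C * budget (real x)"
      using x0[OF \<open>x0 \<le> x\<close>] unfolding Let_def X_def[symmetric] y_def[symmetric] M_def[symmetric] n_def[symmetric]
      by blast+
    have "computes_within prim cS [\<lfloor>y_of (real X)\<rfloor>, int X] (S0 f (y_of (real X)) (real X)) (TS X)"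
      using cS h(7) by simp
    from prime_sum_prog_correct[of x cS "TS X", folded X_def, folded y_def, folded M_def, folded n_def,
        OF h(1,2) b(3) this h(3-6)]
    have 1: "computes_within prim (main1 (prime_sum_prog cS) 13) [int x] (prime_sum f (real x)) ((3 * Tf + 100000) * n)" .
    have "real ((3 * Tf + 100000) * n) \<le> D * budget (real x)"
      unfolding D_def of_nat_mult mult.assoc using h(8) by (intro mult_left_mono) auto
    then have "(3 * Tf + 100000) * n \<le> nat \<lfloor>D * budget (real x)\<rfloor>" by (simp only: le_nat_floor)
    with 1 show "computes_within prim (main1 (prime_sum_prog cS) 13) [int x] (prime_sum f (real x))
        (nat \<lfloor>D * budget (real x)\<rfloor>)"
      by (rule computes_within_mono)
  qed simp
qed

lemma S0_fast_of_summatory: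
  assumes f: "computable_in_time prim {1..} (\<lambda>n. [int n]) f (\<lambda>_. 1)"
    and F: "computable_in_time prim {1..} (\<lambda>u. [int u]) (\<lambda>u. summatory f (real u)) (\<lambda>_. 1)"
  shows "S0_fast prim f"
proof -
  obtain cf Tf where cf: "\<And>n. n > 0 \<Longrightarrow> computes_within prim cf [int n] (f n) Tf"
    using computable_in_constant_time[OF f] by blast
  obtain cF TF where cF: "\<And>n. n > 0 \<Longrightarrow> computes_within prim cF [int n] (summatory f (real n)) TF"
    using computable_in_constant_time[OF F] by blast
  obtain b where b: "machine b" "stores cf \<subseteq> {..<b}" "stores cF \<subseteq> {..<b}"
    using machine_above by blast
  interpret machine prim b by (rule b(1))
  define T where "T = Tf + TF"
  have cf': "computes_within prim cf [int n] (f n) T" if "n > 0" for n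
    by (rule computes_within_mono[OF cf[OF that]]) (simp add: T_def)
  have cF': "computes_within prim cF [int n] (summatory f (real n)) T" if "n > 0" for n
    by (rule computes_within_mono[OF cF[OF that]]) (simp add: T_def)
  \<comment> \<open>The second factor bounds \<open>s + 1\<close>, as \<open>s\<close> exceeds the
    square root of \<open>y_of x\<close> by at most 1.\<close>
  have r1: "\<forall>\<^sub>F t in at_top. (y_of t + 1) * (sqrt (y_of t) + 2) \<le> budget t"
    unfolding y_of_def budget_def by real_asymp
  have r2: "\<forall>\<^sub>F t in at_top. 1 \<le> y_of t" unfolding y_of_def by real_asymp
  have r3: "\<forall>\<^sub>F t in at_top. y_of t \<le> t" unfolding y_of_def by real_asymp
  from r1[THEN eventually_nat] r2[THEN eventually_nat] r3[THEN eventually_nat]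
  have "\<forall>\<^sub>F x in at_top. (y_of (real x) + 1) * (sqrt (y_of (real x)) + 2) \<le> budget (real x) \<and>
      1 \<le> y_of (real x) \<and> y_of (real x) \<le> real x"
    by eventually_elim blast
  then obtain x0 where x0: "\<And>x. x \<ge> x0 \<Longrightarrow> (y_of (real x) + 1) * (sqrt (y_of (real x)) + 2) \<le> budget (real x) \<and>
      1 \<le> y_of (real x) \<and> y_of (real x) \<le> real x"
    unfolding eventually_at_top_linorder by blast
  define D where "D = real (2 * T + 500)"
  show ?thesis unfolding S0_fast_def budget_def[symmetric]
  \<comment> \<open>The table of small cases is searched by \<open>x\<close>, here the second
    argument.\<close>
  proof (rule computable_in_timeI[where i = 1, OF _ _ bigo_budget[of D] one_budget])
    fix x assume "x0 \<le> x"
    note h = x0[OF this]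
    define y where "y = nat \<lfloor>y_of (real x)\<rfloor>"
    define s where "s = (LEAST s. y \<le> s ^ 2)"
    have fl: "\<lfloor>y_of (real x)\<rfloor> = int y" using h by (simp add: y_def)
    have y: "real y \<le> y_of (real x)" using fl by linarith
    have yx: "y \<le> x" using y h by linarith
    have "y > 0" using fl h by linarith
    then have "s > 0" using LeastI[of "\<lambda>s. y \<le> s ^ 2" y] by (intro Nat.gr0I) (auto simp: s_def power2_eq_square)
    then have "\<not> y \<le> (s - 1) ^ 2" using not_less_Least[of "s - 1" "\<lambda>s. y \<le> s ^ 2"] by (simp add: s_def)
    then have "real ((s - 1) ^ 2) \<le> real y" by linarith
    then have "(real s - 1) ^ 2 \<le> y_of (real x)" using y \<open>s > 0\<close> by (simp add: of_nat_diff)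
    then have "real s - 1 \<le> sqrt (y_of (real x))" by (rule real_le_rsqrt)
    then have "(real y + 1) * (real s + 1) \<le> (y_of (real x) + 1) * (sqrt (y_of (real x)) + 2)"
      using y h by (intro mult_mono) auto
    also have "\<dots> \<le> budget (real x)" using h by blast
    finally have "D * ((real y + 1) * (real s + 1)) \<le> D * budget (real x)"
      by (intro mult_left_mono) (auto simp: D_def)
    moreover have "real ((2 * T + 500) * (y + 1) * (s + 1)) = D * ((real y + 1) * (real s + 1))"
      by (simp only: D_def of_nat_mult of_nat_add of_nat_1 mult.assoc)
    ultimately have "real ((2 * T + 500) * (y + 1) * (s + 1)) \<le> D * budget (real x)" by (simp only:)
    then have "(2 * T + 500) * (y + 1) * (s + 1) \<le> nat \<lfloor>D * budget (real x)\<rfloor>" by (simp only: le_nat_floor)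
    with S0_prog_correct[OF cf' b(2) cF' b(3) fl yx s_def]
    show "computes_within prim (main2 (S0_prog cf cF) 4) [\<lfloor>y_of (real x)\<rfloor>, int x] (S0 f (y_of (real x)) (real x))
        (nat \<lfloor>D * budget (real x)\<rfloor>)"
      by (rule computes_within_mono)
  qed simp
qed

lemma prime_sum_computable_zero:
  assumes "\<And>n. n > 0 \<Longrightarrow> f n = 0"
  shows "computable_in_time prim {1..} (\<lambda>x. [int x]) (\<lambda>x. prime_sum f (real x)) (\<lambda>x. budget (real x))"
proof -
  have 0: "prime_sum f (real x) = 0" for x
    unfolding prime_sum_def using assms by (intro sum.neutral) (auto dest: prime_gt_0_nat)
  show ?thesis
  proof (rule computable_in_timeI[where i = 0 and c = "Store 0 (Const 0) (Const 0)", OF _ _ _ one_budget])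
    show "computes_within prim (Store 0 (Const 0) (Const 0)) [int x] (prime_sum f (real x)) 3" for x
      unfolding computes_within_def 0
    proof (intro allI impI)
      fix s
      show "\<exists>m s'. m \<le> 3 \<and> exec prim (Store 0 (Const 0) (Const 0)) s m s' \<and> s' 0 0 = 0"
        using exec.Store[of prim 0 "Const 0" "Const 0" s]
        by (intro exI[of _ 3] exI[of _ "s(0 := (s 0)(0 := 0))"]) (simp add: numeral_eq_Suc)
    qed
    show "(\<lambda>x. real 3) \<in> O(\<lambda>x. budget (real x))"
      using landau_o.big_trans[OF _ one_budget, of "\<lambda>x. real 3"] by simp
  qed simp
qed

theorem proposition7p1:
  fixes f :: "nat \<Rightarrow> int" and prim :: "nat \<Rightarrow> int \<Rightarrow> int"
  assumes "completely_multiplicative f"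
    and "computable_in_time prim {1..} (\<lambda>n. [int n]) f (\<lambda>_. 1)"
  shows "(S0_fast prim f \<longrightarrow>
            computable_in_time prim {1..} (\<lambda>x. [int x]) (\<lambda>x. prime_sum f (real x))
              (\<lambda>x. real x powr (2/3) / (ln (real x))\<^sup>2)) \<and>
         (computable_in_time prim {1..} (\<lambda>u. [int u]) (\<lambda>u. summatory f (real u)) (\<lambda>_. 1) \<longrightarrow>
            S0_fast prim f)"
proof (intro conjI impI)
  assume S0: "S0_fast prim f"
  show "computable_in_time prim {1..} (\<lambda>x. [int x]) (\<lambda>x. prime_sum f (real x))
      (\<lambda>x. real x powr (2/3) / (ln (real x))\<^sup>2)"
  proof (cases "f 1 = 1")
    case True
    from prime_sum_computable[OF assms(1) True assms(2) S0] show ?thesis by (simp only: budget_def)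
  next
    case False
    have mult: "f (a * b) = f a * f b" if "a > 0" "b > 0" for a b
      using assms(1) that unfolding completely_multiplicative_def by blast
    \<comment> \<open>\<open>f 1\<close> is idempotent, hence 0 or 1; if it is 0, then
      \<open>f\<close> vanishes at all positive integers.\<close>
    have "f 1 = 0" using mult[of 1 1] False by simp
    then have "f n = 0" if "n > 0" for n using mult[of 1 n] that by simp
    from prime_sum_computable_zero[of f prim, OF this] show ?thesis by (simp only: budget_def)
  qed
next
  assume "computable_in_time prim {1..} (\<lambda>u. [int u]) (\<lambda>u. summatory f (real u)) (\<lambda>_. 1)"
  with assms(2) show "S0_fast prim f" by (rule S0_fast_of_summatory)
qed

end
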